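(* Let $n\ge2$. There is a short exact sequence of Johnson Lie algebras $$0\to\mathrm{gr}_*^J(\mathfrak W_n)\to\mathrm{gr}_*^J(\mathfrak K_n)\to\mathbb Z^{n-1}\to0$$ which splits as a sequence of abelian groups, and therefore $\mathrm{gr}_*^J(\mathfrak K_n)\cong\mathbb Z^{n-1}\oplus\mathrm{gr}_*^J(\mathfrak W_n)$ as abelian groups.
   Context: $F(X_n)$ is the free group on $x_1,\dots,x_n$ and $\Gamma^m$ denotes its lower central series ($\Gamma^1=F(X_n)$). $J^m\mathrm{Aut}(F(X_n))=\ker(\mathrm{Aut}(F(X_n))\to\mathrm{Aut}(F(X_n)/\Gamma^mF(X_n)))$ and $IA_n=J^2\mathrm{Aut}(F(X_n))$. For a subgroup $G\le IA_n$, the Johnson filtration is $G_m=G\cap J^{m+1}\mathrm{Aut}(F(X_n))$, $m\ge1$, and the Johnson Lie algebra is $\mathrm{gr}_*^J(G)=\bigoplus_{m\ge1}G_m/G_{m+1}$, with bracket induced by group commutators. $P\Sigma_n$ is the subgroup of $\mathrm{Aut}(F(X_n))$ of automorphisms sending each $x_i$ to a conjugate of $x_i$; it lies in $IA_n$ and is generated by the $\chi_{i,j}$ ($i\ne j$), where $\chi_{i,j}(x_i)=x_j^{-1}x_ix_j$ and $\chi_{i,j}(x_k)=x_k$ for $k\neq i$. Let $p_n:P\Sigma_n\to P\Sigma_{n-1}$ be the epimorphism with $p_n(\chi_{i,j})=\chi_{i,j}$ if $n\notin\{i,j\}$ and $p_n(\chi_{i,j})=1$ if $n\in\{i,j\}$;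 $\mathfrak K_n=\ker p_n$. $\mathfrak K_n$ is generated by the conjugates in $P\Sigma_n$ of the $\chi_{i,j}$ with $n\in\{i,j\}$. Let $q_n:\mathfrak K_n\to\mathbb Z^{n-1}$, where $\mathbb Z^{n-1}$ is the free abelian group with basis $\chi_{1,n},\dots,\chi_{n-1,n}$, be the homomorphism sending each conjugate of $\chi_{i,n}$ to $\chi_{i,n}$ and each conjugate of $\chi_{n,i}$ to the identity; $\mathfrak W_n=\ker q_n$. The group $\mathbb Z^{n-1}$ is regarded as an abelian Lie algebra concentrated in degree $1$ (the Johnson Lie algebra of the subgroup of $\mathfrak K_n$ generated by the $\chi_{i,n}$). *)

theory Defs
  imports
    "HOL-Algebra.Bij"
    "HOL-Algebra.Generated_Groups"
    "HOL-Algebra.Product_Groups"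
    "HOL-Algebra.Free_Abelian_Groups"
begin

section \<open>Free groups\<close>

text \<open>
  The free group on \<open>X\<close> is the set of reduced words in the letters
  \<open>(x, True)\<close>, standing for \<open>x\<close>, and \<open>(x, False)\<close>, standing for the inverse of \<open>x\<close>.
\<close>

type_synonym 'a letter = "'a \<times> bool"
type_synonym 'a word = "'a letter list"

definition inv_letter :: "'a letter \<Rightarrow> 'a letter" where
  "inv_letter a = (fst a, \<not> snd a)"

definition reduced :: "'a word \<Rightarrow> bool" where
  "reduced = successively (\<lambda>a b. b \<noteq> inv_letter a)"

definition push_letter :: "'a letter \<Rightarrow> 'a word \<Rightarrow> 'a word" where
  "push_letter a w = (if w \<noteq> [] \<and> hd w = inv_letter a then tl w else a # w)"

definition free_group :: "'a set \<Rightarrow> 'a word monoid" where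
  "free_group X =
     \<lparr>carrier = {w. reduced w \<and> fst ` set w \<subseteq> X},
      monoid.mult = (\<lambda>u v. foldr push_letter u v),
      one = []\<rparr>"

definition free_gen :: "'a \<Rightarrow> 'a word" where
  "free_gen x = [(x, True)]"

text \<open>The homomorphism from the free group on \<open>X\<close> to \<open>G\<close> that extends \<open>f\<close>.\<close>

definition free_lift :: "'a set \<Rightarrow> ('g, 'b) monoid_scheme \<Rightarrow> ('a \<Rightarrow> 'g) \<Rightarrow> 'a word \<Rightarrow> 'g" where
  "free_lift X G f =
     (\<lambda>w \<in> carrier (free_group X).
        foldr (\<lambda>a g. (if snd a then f (fst a) else inv\<^bsub>G\<^esub> f (fst a)) \<otimes>\<^bsub>G\<^esub> g) w \<one>\<^bsub>G\<^esub>)"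

lemma inv_letter_inv_letter [simp]: "inv_letter (inv_letter a) = a"
  by (simp add: inv_letter_def)

lemma fst_inv_letter [simp]: "fst (inv_letter a) = fst a"
  by (simp add: inv_letter_def)

lemma inv_letter_eq_iff: "inv_letter a = b \<longleftrightarrow> a = inv_letter b"
  by auto

lemma reduced_Nil [simp]: "reduced []"
  by (simp add: reduced_def)

lemma reduced_Cons:
  "reduced (a # w) \<longleftrightarrow> (w = [] \<or> hd w \<noteq> inv_letter a) \<and> reduced w"
  by (auto simp: reduced_def successively_Cons)

lemma reduced_push_letter: "reduced w \<Longrightarrow> reduced (push_letter a w)"
  by (cases w) (auto simp: push_letter_def reduced_Cons)

lemma reduced_foldr_push_letter: "reduced w \<Longrightarrow> reduced (foldr push_letter u w)"
  by (induction u) (auto intro: reduced_push_letter)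

lemma set_push_letter: "set (push_letter a w) \<subseteq> insert a (set w)"
  by (cases w) (auto simp: push_letter_def)

lemma set_foldr_push_letter: "set (foldr push_letter u w) \<subseteq> set u \<union> set w"
  by (induction u) (use set_push_letter in fastforce)+

lemma push_letter_cancel:
  "reduced w \<Longrightarrow> push_letter a (push_letter (inv_letter a) w) = w"
  by (cases w) (auto simp: push_letter_def reduced_Cons)

lemma foldr_push_letter_push:
  assumes "reduced w"
  shows "foldr push_letter (push_letter a u) w = push_letter a (foldr push_letter u w)"
proof (cases "u \<noteq> [] \<and> hd u = inv_letter a")
  case True
  then obtain v where "u = inv_letter a # v" by (cases u) auto
  then show ?thesis
    using push_letter_cancel[OF reduced_foldr_push_letter[OF assms]]
    by (simp add: push_letter_def)
qed (auto simp: push_letter_def)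

lemma foldr_push_letter_assoc:
  assumes "reduced w"
  shows "foldr push_letter (foldr push_letter u v) w = foldr push_letter u (foldr push_letter v w)"
  by (induction u) (auto simp: foldr_push_letter_push[OF assms])

lemma foldr_push_letter_Nil: "reduced u \<Longrightarrow> foldr push_letter u [] = u"
  by (induction u) (auto simp: reduced_Cons push_letter_def)

lemma foldr_push_letter_inverse:
  "reduced w \<Longrightarrow> foldr push_letter (map inv_letter (rev u)) (foldr push_letter u w) = w"
proof (induction u arbitrary: w)
  case (Cons a u)
  then show ?case
    using push_letter_cancel[OF reduced_foldr_push_letter[OF Cons.prems], of "inv_letter a" u]
    by simp
qed simp

lemma group_free_group: "group (free_group X)"
proof (rule groupI)
  fix u v assume "u \<in> carrier (free_group X)" "v \<in> carrier (free_group X)"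
  then show "u \<otimes>\<^bsub>free_group X\<^esub> v \<in> carrier (free_group X)"
    using set_foldr_push_letter[of u v]
    by (fastforce simp: free_group_def reduced_foldr_push_letter)
next
  fix u assume u: "u \<in> carrier (free_group X)"
  let ?v = "foldr push_letter (map inv_letter (rev u)) []"
  have "?v \<in> carrier (free_group X)"
    using u set_foldr_push_letter[of "map inv_letter (rev u)" "[]"]
    by (fastforce simp: free_group_def reduced_foldr_push_letter)
  moreover have "?v \<otimes>\<^bsub>free_group X\<^esub> u = \<one>\<^bsub>free_group X\<^esub>"
    using u foldr_push_letter_assoc[of u "map inv_letter (rev u)" "[]"]
      foldr_push_letter_inverse[of "[]" u]
    by (simp add: free_group_def foldr_push_letter_Nil)
  ultimately show "\<exists>v\<in>carrier (free_group X). v \<otimes>\<^bsub>free_group X\<^esub> u = \<one>\<^bsub>free_group X\<^esub>"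
    by blast
qed (auto simp: free_group_def foldr_push_letter_assoc)


section \<open>The lower central series and the Johnson filtration\<close>

definition commutator :: "('a, 'b) monoid_scheme \<Rightarrow> 'a \<Rightarrow> 'a \<Rightarrow> 'a" where
  "commutator G x y = x \<otimes>\<^bsub>G\<^esub> y \<otimes>\<^bsub>G\<^esub> inv\<^bsub>G\<^esub> x \<otimes>\<^bsub>G\<^esub> inv\<^bsub>G\<^esub> y"

text \<open>Indexing starts at 1; the value at 0 is a dummy.\<close>

fun lower_central :: "('a, 'b) monoid_scheme \<Rightarrow> nat \<Rightarrow> 'a set" where
  "lower_central G 0 = carrier G"
| "lower_central G (Suc 0) = carrier G"
| "lower_central G (Suc (Suc m)) =
     generate G {commutator G x y | x y. x \<in> lower_central G (Suc m) \<and> y \<in> carrier G}"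

abbreviation FX :: "nat \<Rightarrow> nat word monoid" where
  "FX n \<equiv> free_group {1..n}"

abbreviation AutF :: "nat \<Rightarrow> (nat word \<Rightarrow> nat word) monoid" where
  "AutF n \<equiv> AutoGroup (FX n)"

definition induced_aut :: "('a, 'b) monoid_scheme \<Rightarrow> 'a set \<Rightarrow> ('a \<Rightarrow> 'a) \<Rightarrow> 'a set \<Rightarrow> 'a set" where
  "induced_aut G N \<phi> = (\<lambda>C \<in> carrier (G Mod N). \<phi> ` C)"

definition J_Aut :: "nat \<Rightarrow> nat \<Rightarrow> (nat word \<Rightarrow> nat word) set" where
  "J_Aut n m =
     kernel (AutF n) (AutoGroup (FX n Mod lower_central (FX n) m))
       (induced_aut (FX n) (lower_central (FX n) m))"

definition johnson_filt ::
    "nat \<Rightarrow> (nat word \<Rightarrow> nat word) set \<Rightarrow> nat \<Rightarrow> (nat word \<Rightarrow> nat word) set" where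
  "johnson_filt n G m = G \<inter> J_Aut n (m + 1)"


section \<open>Graded Lie rings\<close>

text \<open>
  A Lie algebra over the integers is an abelian group, written multiplicatively as usual
  in HOL-Algebra (so \<open>\<otimes>\<close> is the addition of the Lie algebra and \<open>\<one>\<close> its zero), with a bracket.
  \<open>grade L m\<close> is the set of homogeneous elements of degree \<open>m\<close>, including zero.
\<close>

record 'a graded_lie = "'a monoid" +
  bracket :: "'a \<Rightarrow> 'a \<Rightarrow> 'a"
  grade :: "nat \<Rightarrow> 'a set"

locale lie_ring = comm_group L for L :: "('a, 'b) graded_lie_scheme" (structure) +
  assumes bracket_closed:
      "\<lbrakk>x \<in> carrier L; y \<in> carrier L\<rbrakk> \<Longrightarrow> bracket L x y \<in> carrier L"
    and bracket_add_left:
      "\<lbrakk>x \<in> carrier L; y \<in> carrier L; z \<in> carrier L\<rbrakk>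
        \<Longrightarrow> bracket L (x \<otimes> y) z = bracket L x z \<otimes> bracket L y z"
    and bracket_add_right:
      "\<lbrakk>x \<in> carrier L; y \<in> carrier L; z \<in> carrier L\<rbrakk>
        \<Longrightarrow> bracket L x (y \<otimes> z) = bracket L x y \<otimes> bracket L x z"
    and bracket_self: "x \<in> carrier L \<Longrightarrow> bracket L x x = \<one>"
    and jacobi:
      "\<lbrakk>x \<in> carrier L; y \<in> carrier L; z \<in> carrier L\<rbrakk>
        \<Longrightarrow> bracket L x (bracket L y z) \<otimes> bracket L y (bracket L z x)
              \<otimes> bracket L z (bracket L x y) = \<one>"

definition graded_lie_hom ::
    "('a, 'c) graded_lie_scheme \<Rightarrow> ('b, 'd) graded_lie_scheme \<Rightarrow> ('a \<Rightarrow> 'b) set" where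
  "graded_lie_hom L M =
     {f \<in> hom L M.
        (\<forall>x\<in>carrier L. \<forall>y\<in>carrier L. f (bracket L x y) = bracket M (f x) (f y)) \<and>
        (\<forall>m. f ` grade L m \<subseteq> grade M m)}"

definition lie_short_exact ::
    "('a, 'd) graded_lie_scheme \<Rightarrow> ('b, 'e) graded_lie_scheme \<Rightarrow> ('c, 'f) graded_lie_scheme
      \<Rightarrow> ('a \<Rightarrow> 'b) \<Rightarrow> ('b \<Rightarrow> 'c) \<Rightarrow> bool" where
  "lie_short_exact L M N f g \<longleftrightarrow>
     lie_ring L \<and> lie_ring M \<and> lie_ring N \<and>
     f \<in> graded_lie_hom L M \<and> g \<in> graded_lie_hom M N \<and>
     f \<in> mon L M \<and> f ` carrier L = kernel M N g \<and> g \<in> epi M N"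

text \<open>An abelian group as an abelian Lie algebra concentrated in degree 1.\<close>

definition abelian_lie_deg1 :: "'a monoid \<Rightarrow> 'a graded_lie" where
  "abelian_lie_deg1 A =
     \<lparr>carrier = carrier A, monoid.mult = monoid.mult A, one = one A,
      bracket = (\<lambda>x y. \<one>\<^bsub>A\<^esub>),
      grade = (\<lambda>m. if m = 1 then carrier A else {\<one>\<^bsub>A\<^esub>})\<rparr>"


section \<open>The Johnson Lie algebra\<close>

definition johnson_quot ::
    "nat \<Rightarrow> (nat word \<Rightarrow> nat word) set \<Rightarrow> nat \<Rightarrow> (nat word \<Rightarrow> nat word) set monoid" where
  "johnson_quot n G m = (AutF n)\<lparr>carrier := johnson_filt n G m\<rparr> Mod johnson_filt n G (m + 1)"

text \<open>
  The bracket of a coset \<open>A\<close> in degree \<open>k\<close> and a coset \<open>B\<close> in degree \<open>l\<close> is the coset of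
  the commutator of any representatives; the union below ranges over equal cosets.
\<close>

definition johnson_coset_bracket ::
    "nat \<Rightarrow> (nat word \<Rightarrow> nat word) set \<Rightarrow> nat \<Rightarrow> nat
      \<Rightarrow> (nat word \<Rightarrow> nat word) set \<Rightarrow> (nat word \<Rightarrow> nat word) set \<Rightarrow> (nat word \<Rightarrow> nat word) set" where
  "johnson_coset_bracket n G k l A B =
     (\<Union>x\<in>A. \<Union>y\<in>B. johnson_filt n G (k + l + 1) #>\<^bsub>AutF n\<^esub> commutator (AutF n) x y)"

definition gr_J ::
    "nat \<Rightarrow> (nat word \<Rightarrow> nat word) set \<Rightarrow> (nat \<Rightarrow> (nat word \<Rightarrow> nat word) set) graded_lie" where
  "gr_J n G = (let S = sum_group {1..} (johnson_quot n G) in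
     \<lparr>carrier = carrier S, monoid.mult = monoid.mult S, one = one S,
      bracket = (\<lambda>u v. \<lambda>m\<in>{1..}.
        finprod (johnson_quot n G m)
          (\<lambda>k. johnson_coset_bracket n G k (m - k) (u k) (v (m - k))) {1..<m}),
      grade = (\<lambda>m. {u \<in> carrier S. \<forall>k\<in>{1..} - {m}. u k = \<one>\<^bsub>johnson_quot n G k\<^esub>})\<rparr>)"

text \<open>The homogeneous element of degree \<open>m\<close> represented by \<open>x\<close>, an element of the \<open>m\<close>-th filtration step.\<close>

definition johnson_class ::
    "nat \<Rightarrow> (nat word \<Rightarrow> nat word) set \<Rightarrow> nat \<Rightarrow> (nat word \<Rightarrow> nat word)
      \<Rightarrow> nat \<Rightarrow> (nat word \<Rightarrow> nat word) set" where
  "johnson_class n G m x =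
     (\<lambda>k\<in>{1..}. if k = m then johnson_filt n G (m + 1) #>\<^bsub>AutF n\<^esub> x
                 else \<one>\<^bsub>johnson_quot n G k\<^esub>)"


section \<open>Basis-conjugating automorphisms\<close>

definition PSigma :: "nat \<Rightarrow> (nat word \<Rightarrow> nat word) monoid" where
  "PSigma n = (AutF n)\<lparr>carrier := {\<phi> \<in> carrier (AutF n). \<forall>i\<in>{1..n}. \<exists>g\<in>carrier (FX n).
     \<phi> (free_gen i) = inv\<^bsub>FX n\<^esub> g \<otimes>\<^bsub>FX n\<^esub> free_gen i \<otimes>\<^bsub>FX n\<^esub> g}\<rparr>"

definition chi :: "nat \<Rightarrow> nat \<Rightarrow> nat \<Rightarrow> nat word \<Rightarrow> nat word" where
  "chi n i j = free_lift {1..n} (FX n)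
     (\<lambda>k. if k = i then inv\<^bsub>FX n\<^esub> free_gen j \<otimes>\<^bsub>FX n\<^esub> free_gen i \<otimes>\<^bsub>FX n\<^esub> free_gen j
          else free_gen k)"

text \<open>The free abelian group of rank \<open>n - 1\<close> with basis \<open>chi n 1 n, \<dots>, chi n (n - 1) n\<close>.\<close>

definition chi_lattice :: "nat \<Rightarrow> ((nat word \<Rightarrow> nat word) \<Rightarrow>\<^sub>0 int) monoid" where
  "chi_lattice n = free_Abelian_group ((\<lambda>i. chi n i n) ` {1..<n})"

definition is_p_map ::
    "nat \<Rightarrow> ((nat word \<Rightarrow> nat word) \<Rightarrow> (nat word \<Rightarrow> nat word)) \<Rightarrow> bool" where
  "is_p_map n p \<longleftrightarrow>
     p \<in> epi (PSigma n) (PSigma (n - 1)) \<and>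
     (\<forall>i\<in>{1..n}. \<forall>j\<in>{1..n}. i \<noteq> j \<longrightarrow>
        p (chi n i j) = (if n \<in> {i, j} then \<one>\<^bsub>PSigma (n - 1)\<^esub> else chi (n - 1) i j))"

definition KK ::
    "nat \<Rightarrow> ((nat word \<Rightarrow> nat word) \<Rightarrow> (nat word \<Rightarrow> nat word)) \<Rightarrow> (nat word \<Rightarrow> nat word) set" where
  "KK n p = kernel (PSigma n) (PSigma (n - 1)) p"

definition is_q_map ::
    "nat \<Rightarrow> ((nat word \<Rightarrow> nat word) \<Rightarrow> (nat word \<Rightarrow> nat word))
      \<Rightarrow> ((nat word \<Rightarrow> nat word) \<Rightarrow> ((nat word \<Rightarrow> nat word) \<Rightarrow>\<^sub>0 int)) \<Rightarrow> bool" where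
  "is_q_map n p q \<longleftrightarrow>
     q \<in> hom ((PSigma n)\<lparr>carrier := KK n p\<rparr>) (chi_lattice n) \<and>
     (\<forall>g\<in>carrier (PSigma n). \<forall>i\<in>{1..<n}.
        q (g \<otimes>\<^bsub>PSigma n\<^esub> chi n i n \<otimes>\<^bsub>PSigma n\<^esub> inv\<^bsub>PSigma n\<^esub> g) = frag_of (chi n i n) \<and>
        q (g \<otimes>\<^bsub>PSigma n\<^esub> chi n n i \<otimes>\<^bsub>PSigma n\<^esub> inv\<^bsub>PSigma n\<^esub> g) = \<one>\<^bsub>chi_lattice n\<^esub>)"

definition WW ::
    "nat \<Rightarrow> ((nat word \<Rightarrow> nat word) \<Rightarrow> (nat word \<Rightarrow> nat word))
      \<Rightarrow> ((nat word \<Rightarrow> nat word) \<Rightarrow> ((nat word \<Rightarrow> nat word) \<Rightarrow>\<^sub>0 int))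
      \<Rightarrow> (nat word \<Rightarrow> nat word) set" where
  "WW n p q = kernel ((PSigma n)\<lparr>carrier := KK n p\<rparr>) (chi_lattice n) q"

end

theory Submission
  imports Defs
begin

text \<open>
  For \<open>i < n\<close> let \<open>e\<^sub>i \<phi>\<close> be the exponent sum of \<open>x\<^sub>n\<close> in the element conjugating \<open>x\<^sub>i\<close> to
  \<open>\<phi> x\<^sub>i\<close>. These are homomorphisms, and together they agree with \<open>q\<close> on the conjugates of
  the \<open>\<chi>\<^sub>i\<^sub>n\<close> and \<open>\<chi>\<^sub>n\<^sub>i\<close>. Such conjugates generate \<open>K\<^sub>n\<close>, because the \<open>\<chi>\<^sub>i\<^sub>j\<close> generate the
  basis-conjugating automorphisms (Nielsen cancellation) and \<open>p\<close> is injective on the subgroup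
  generated by the \<open>\<chi>\<^sub>i\<^sub>j\<close> with \<open>i, j < n\<close>, where it is restriction; hence \<open>q\<close> is given by the
  \<open>e\<^sub>i\<close>. A map to the Heisenberg group shows that \<open>e\<^sub>i\<close> vanishes on automorphisms acting
  trivially modulo \<open>\<Gamma>\<^sup>3\<close>. So \<open>ker q\<close> contains the second filtration step of \<open>K\<^sub>n\<close>: the
  Johnson algebras of the two groups differ only in degree 1, the inclusion is the identity on
  families of cosets, and the quotient is the free abelian image of \<open>q\<close>.
\<close>

text \<open>The maps \<open>p\<close> and \<open>q\<close> are known only through values on the
  \<open>\<chi>\<^sub>i\<^sub>j\<close> and on conjugates, so neither kernel can be inspected
  directly; this is why generation statements carry the argument and why \<open>q\<close> has to be
  replaced by an explicit formula. The formula is additive because basis-conjugating automorphisms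
  act trivially on the abelianization: the element conjugating x_i under \<phi>\<psi> is g
  \<phi>(h), and exponent sums do not notice \<phi>. The Heisenberg group serves as target because
  it has class two, hence kills \<Gamma>^3, and yet conjugating (1, 0, 0) by (a, b, c) leaves b
  visible in the central coordinate. The number 3 is an index shift: the second filtration step
  consists of automorphisms trivial modulo the third term of the series. In degree 1 both algebras
  consist of cosets of one and the same subgroup, which is what makes the inclusion a plain
  identity. Exactness also asks for the Lie ring axioms. They are proved for any filtration with
  [F_k, F_l] inside F_(k+l), and the Johnson filtration is of this kind because
  [\<Gamma>^a, \<Gamma>^b] lies in \<Gamma>^(a+b).\<close>

section \<open>Commutators and the lower central series\<close>

context group
begin

lemma mult_inv_cancel_left:
  "\<lbrakk>x \<in> carrier G; y \<in> carrier G\<rbrakk> \<Longrightarrow> x \<otimes> (inv x \<otimes> y) = y"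
  "\<lbrakk>x \<in> carrier G; y \<in> carrier G\<rbrakk> \<Longrightarrow> inv x \<otimes> (x \<otimes> y) = y"
  by (simp_all flip: m_assoc)

text \<open>As rewrite rules these bring a product of variables and inverses into right-nested,
  freely cancelled form, so that \<open>simp\<close> settles word identities valid in free
  groups.\<close>

lemmas word_simps = m_assoc inv_mult_group mult_inv_cancel_left commutator_def

lemma commutator_closed [simp, intro]:
  "\<lbrakk>x \<in> carrier G; y \<in> carrier G\<rbrakk> \<Longrightarrow> commutator G x y \<in> carrier G"
  by (simp add: commutator_def)

lemma inv_commutator:
  "\<lbrakk>x \<in> carrier G; y \<in> carrier G\<rbrakk> \<Longrightarrow> inv (commutator G x y) = commutator G y x"
  by (simp add: word_simps)

lemma commutator_self: "x \<in> carrier G \<Longrightarrow> commutator G x x = \<one>"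
  by (simp add: word_simps)

lemma commutator_one_left: "y \<in> carrier G \<Longrightarrow> commutator G \<one> y = \<one>"
  by (simp add: commutator_def)

lemma mult_eq_commutator_mult:
  "\<lbrakk>x \<in> carrier G; y \<in> carrier G\<rbrakk> \<Longrightarrow> x \<otimes> y = commutator G x y \<otimes> (y \<otimes> x)"
  by (simp add: word_simps)

lemma commutator_conj:
  "\<lbrakk>x \<in> carrier G; y \<in> carrier G; g \<in> carrier G\<rbrakk> \<Longrightarrow>
    g \<otimes> commutator G x y \<otimes> inv g = commutator G (g \<otimes> x \<otimes> inv g) (g \<otimes> y \<otimes> inv g)"
  by (simp add: word_simps)

text \<open>The conjugate of \<open>commutator G y z\<close> by \<open>x\<close> is spelled as the
  correction \<open>commutator G x (commutator G y z)\<close> times the commutator itself: in a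
  central filtration the correction lies deeper and disappears.\<close>

lemma commutator_mult_left:
  "\<lbrakk>x \<in> carrier G; y \<in> carrier G; z \<in> carrier G\<rbrakk> \<Longrightarrow>
    commutator G (x \<otimes> y) z = commutator G x (commutator G y z) \<otimes> commutator G y z \<otimes> commutator G x z"
  by (simp add: word_simps)

lemma commutator_mult_right:
  "\<lbrakk>x \<in> carrier G; y \<in> carrier G; z \<in> carrier G\<rbrakk> \<Longrightarrow>
    commutator G x (y \<otimes> z) = commutator G x y \<otimes> commutator G y (commutator G x z) \<otimes> commutator G x z"
  by (simp add: word_simps)

text \<open>The factor \<open>commutator G y z \<otimes> z\<close> is the conjugate of
  \<open>z\<close> by \<open>y\<close>. In this spelling it differs from \<open>z\<close> by a left
  factor lying deeper in a filtration, which is how the Jacobi identity is extracted.\<close>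

lemma hall_witt:
  assumes "x \<in> carrier G" "y \<in> carrier G" "z \<in> carrier G"
  shows "commutator G (commutator G x y) (commutator G y z \<otimes> z) \<otimes>
         commutator G (commutator G y z) (commutator G z x \<otimes> x) \<otimes>
         commutator G (commutator G z x) (commutator G x y \<otimes> y) = \<one>"
  using assms by (simp add: word_simps)

lemma commutator_eq_one_iff:
  assumes "x \<in> carrier G" "y \<in> carrier G"
  shows "commutator G x y = \<one> \<longleftrightarrow> x \<otimes> y = y \<otimes> x"
proof
  assume "commutator G x y = \<one>"
  then show "x \<otimes> y = y \<otimes> x"
    using mult_eq_commutator_mult[OF assms] assms by simp
next
  assume "x \<otimes> y = y \<otimes> x"
  then have "commutator G x y = y \<otimes> x \<otimes> inv x \<otimes> inv y"
    by (simp add: commutator_def)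
  then show "commutator G x y = \<one>"
    using assms by (simp add: word_simps)
qed

text \<open>
  Hall's three subgroups argument, element by element: conjugation by \<open>w\<close> multiplies \<open>u\<close> by the
  central \<open>z\<close> and \<open>v\<close> by \<open>c\<close>, and neither change affects the commutator of \<open>u\<close> and \<open>v\<close>.
\<close>

lemma commutator_commutator_eq_one:
  assumes G: "u \<in> carrier G" "v \<in> carrier G" "w \<in> carrier G"
    and c1: "commutator G (commutator G u v) (commutator G w v) = \<one>"
    and c2: "commutator G u (commutator G w v) = \<one>"
    and c3: "commutator G (commutator G w u) (commutator G w v \<otimes> v) = \<one>"
    and c4: "commutator G (commutator G w u) u = \<one>"
  shows "commutator G (commutator G u v) w = \<one>"
proof -
  define z c k where "z = commutator G w u" and "c = commutator G w v" and "k = commutator G u v"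
  have zc [simp]: "z \<in> carrier G" "c \<in> carrier G" "k \<in> carrier G" using G by (auto simp: z_def c_def k_def)
  have uc: "u \<otimes> c = c \<otimes> u"
    using c2 commutator_eq_one_iff[of u c] G zc by (simp add: c_def)
  have kc: "k \<otimes> c = c \<otimes> k"
    using c1 commutator_eq_one_iff[of k c] G zc by (simp add: c_def k_def)
  have wuw: "w \<otimes> u \<otimes> inv w = z \<otimes> u" using G by (simp add: z_def word_simps)
  have wvw: "w \<otimes> v \<otimes> inv w = c \<otimes> v" using G by (simp add: c_def word_simps)
  have "w \<otimes> k \<otimes> inv w = commutator G (z \<otimes> u) (c \<otimes> v)"
    using commutator_conj[of u v w] G by (simp add: wuw wvw k_def)
  \<comment> \<open>\<open>z\<close> commutes with \<open>u\<close> and with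
    \<open>c \<otimes> v\<close>, the conjugate of \<open>v\<close> by \<open>w\<close>, hence with
    their commutator; so both factors contributed by \<open>z\<close> to the expansion are
    trivial.\<close>
  also have "\<dots> = commutator G u (c \<otimes> v)"
  proof -
    have zx: "commutator G z u = \<one>" "commutator G z (c \<otimes> v) = \<one>"
      using c3 c4 by (simp_all add: z_def c_def)
    define y where "y = c \<otimes> v"
    have y: "y \<in> carrier G" using G by (simp add: y_def)
    have "commutator G z (commutator G u y) = \<one>"
    proof -
      have 1: "z \<otimes> u = u \<otimes> z" using zx(1) commutator_eq_one_iff[of z u] G by simp
      have 2: "z \<otimes> y = y \<otimes> z" using zx(2) commutator_eq_one_iff[of z y] G y by (simp add: y_def)
      have conj: "z \<otimes> u \<otimes> inv z = u" "z \<otimes> y \<otimes> inv z = y"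
        unfolding 1 2 using G y by (simp_all add: word_simps)
      have "z \<otimes> commutator G u y \<otimes> inv z = commutator G u y"
        using commutator_conj[of u y z] G y by (simp add: conj)
      then show ?thesis
        using G y by (metis commutator_closed commutator_def r_inv zc(1))
    qed
    then show ?thesis
      using commutator_mult_left[of z u y] zx(2) G y by (simp add: y_def)
  qed
  also have "\<dots> = k"
  proof -
    have "commutator G u (c \<otimes> v) = u \<otimes> c \<otimes> v \<otimes> inv u \<otimes> inv v \<otimes> inv c"
      using G by (simp add: word_simps)
    also have "\<dots> = c \<otimes> k \<otimes> inv c"
      unfolding uc using G by (simp add: word_simps k_def)
    also have "\<dots> = k" unfolding kc[symmetric] using G by (simp add: word_simps)
    finally show ?thesis .
  qed
  finally have "w \<otimes> k = k \<otimes> w"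
    using G by (metis inv_solve_right m_closed zc(3))
  then show ?thesis
    using commutator_eq_one_iff[of k w] G by (simp add: k_def)
qed

end

lemma (in group_hom) hom_commutator:
  "\<lbrakk>x \<in> carrier G; y \<in> carrier G\<rbrakk> \<Longrightarrow> h (commutator G x y) = commutator H (h x) (h y)"
  by (simp add: commutator_def)

section \<open>The lower central series of an arbitrary group\<close>

context group
begin

lemma normal_lower_central: "lower_central G m \<lhd> G"
proof (induction m rule: nat_less_induct)
  case (1 m)
  consider "m = 0" | "m = Suc 0" | k where "m = Suc (Suc k)"
    by (metis not0_implies_Suc)
  then show ?case
  proof cases
    case 3
    then have IH: "lower_central G (Suc k) \<lhd> G" using 1 by simp
    interpret N: normal "lower_central G (Suc k)" G by (rule IH)
    show ?thesis
      unfolding 3 lower_central.simps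
    proof (rule normal_generateI)
      show "{commutator G x y |x y. x \<in> lower_central G (Suc k) \<and> y \<in> carrier G} \<subseteq> carrier G"
        by auto
    next
      fix h g
      assume "h \<in> {commutator G x y |x y. x \<in> lower_central G (Suc k) \<and> y \<in> carrier G}"
        and g: "g \<in> carrier G"
      then obtain x y where h: "h = commutator G x y" "x \<in> lower_central G (Suc k)" "y \<in> carrier G"
        by auto
      then have "g \<otimes> h \<otimes> inv g = commutator G (g \<otimes> x \<otimes> inv g) (g \<otimes> y \<otimes> inv g)"
        using g by (simp add: commutator_conj)
      moreover have "g \<otimes> x \<otimes> inv g \<in> lower_central G (Suc k)"
        using h g by (simp add: N.inv_op_closed2)
      ultimately show "g \<otimes> h \<otimes> inv g
          \<in> {commutator G x y |x y. x \<in> lower_central G (Suc k) \<and> y \<in> carrier G}"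
        using h g by auto
    qed
  qed (simp_all add: normal_self)
qed

lemma subgroup_lower_central: "subgroup (lower_central G m) G"
  using normal_lower_central normal_imp_subgroup by blast

lemma lower_central_carrier: "x \<in> lower_central G m \<Longrightarrow> x \<in> carrier G"
  by (rule subgroup.mem_carrier[OF subgroup_lower_central])

lemma commutator_lower_central:
  "\<lbrakk>x \<in> lower_central G (Suc k); y \<in> carrier G\<rbrakk> \<Longrightarrow>
    commutator G x y \<in> lower_central G (Suc (Suc k))"
  by (auto intro!: generate.incl)

lemma lower_central_Suc_subset: "lower_central G (Suc k) \<subseteq> lower_central G k"
proof (cases k)
  case (Suc j)
  interpret N: normal "lower_central G (Suc j)" G by (rule normal_lower_central)
  have "commutator G x y \<in> lower_central G (Suc j)"
    if "x \<in> lower_central G (Suc j)" "y \<in> carrier G" for x y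
  proof -
    have "commutator G x y = x \<otimes> (y \<otimes> inv x \<otimes> inv y)"
      using that by (simp add: word_simps)
    then show ?thesis using that by (simp add: N.inv_op_closed2)
  qed
  then show ?thesis
    unfolding Suc lower_central.simps(3)
    by (intro generate_subgroup_incl) (auto simp: subgroup_lower_central)
qed simp

lemma lower_central_antimono: "i \<le> j \<Longrightarrow> lower_central G j \<subseteq> lower_central G i"
  by (rule lift_Suc_antimono_le[of "lower_central G"]) (auto dest: subsetD[OF lower_central_Suc_subset])

end

context normal
begin

lemma group_hom_Mod: "group_hom G (G Mod H) (\<lambda>x. H #> x)"
  by (intro group_hom.intro group_hom_axioms.intro factorgroup_is_group r_coset_hom_Mod is_group)

lemma coset_eq_one_iff: "x \<in> carrier G \<Longrightarrow> H #> x = \<one>\<^bsub>G Mod H\<^esub> \<longleftrightarrow> x \<in> H"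
  using coset_join1[OF _ _ is_subgroup] coset_join2[OF _ is_subgroup] by auto

lemma coset_eq_iff:
  assumes "x \<in> carrier G" "y \<in> carrier G"
  shows "H #> x = H #> y \<longleftrightarrow> x \<otimes> inv y \<in> H"
  using assms rcos_module[OF is_group assms(2,1)] rcos_self[OF assms(1) is_subgroup]
    repr_independence[OF _ assms(2) is_subgroup, of x] by auto

end

text \<open>Induction on \<open>a\<close> with \<open>b\<close> free. For a generator
  \<open>commutator G u v\<close> of the next term, the three subgroups argument is run in the
  quotient by the target term; its hypotheses come from the induction hypothesis, applied to
  \<open>y\<close> and, one step deeper in \<open>b\<close>, to
  \<open>commutator G y v\<close>.\<close>

lemma (in group) commutator_lower_central_lower_central:
  assumes "x \<in> lower_central G (Suc a)" "y \<in> lower_central G (Suc b)"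
  shows "commutator G x y \<in> lower_central G (Suc a + Suc b)"
  using assms
proof (induction a arbitrary: b x y)
  case 0
  then have "commutator G y x \<in> lower_central G (Suc (Suc b))"
    by (simp add: commutator_lower_central del: lower_central.simps(3))
  then have "inv (commutator G y x) \<in> lower_central G (Suc (Suc b))"
    using subgroup.m_inv_closed[OF subgroup_lower_central] by blast
  moreover have "x \<in> carrier G" "y \<in> carrier G"
    using 0 lower_central_carrier by blast+
  ultimately show ?case
    by (simp add: inv_commutator del: lower_central.simps(3))
next
  case (Suc a)
  define N where "N = lower_central G (Suc (Suc a) + Suc b)"
  interpret N: normal N G unfolding N_def by (rule normal_lower_central)
  interpret h: group_hom G "G Mod N" "\<lambda>x. N #> x" by (rule N.group_hom_Mod)
  have w: "y \<in> carrier G" using Suc.prems lower_central_carrier by blast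
  have h1: "commutator (G Mod N) (N #> s) (N #> t) = \<one>\<^bsub>G Mod N\<^esub>"
    if "commutator G s t \<in> N" "s \<in> carrier G" "t \<in> carrier G" for s t
    using N.coset_eq_one_iff[of "commutator G s t"] that by (simp flip: h.hom_commutator)
  have gen: "commutator G (commutator G u v) y \<in> N"
    if u: "u \<in> lower_central G (Suc a)" and v: "v \<in> carrier G" for u v
  proof -
    note [simp del] = lower_central.simps(3)
    have uG: "u \<in> carrier G" using u lower_central_carrier by blast
    have c: "commutator G y v \<in> lower_central G (Suc (Suc b))"
      using Suc.prems v by (simp add: commutator_lower_central)
    have z: "commutator G y u \<in> lower_central G (Suc (a + Suc b))"
    proof -
      have "commutator G u y \<in> lower_central G (Suc (a + Suc b))"
        using Suc.IH[OF u Suc.prems(2)] by simp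
      then have "inv (commutator G u y) \<in> lower_central G (Suc (a + Suc b))"
        using subgroup.m_inv_closed[OF subgroup_lower_central] by blast
      then show ?thesis using uG w by (simp add: inv_commutator)
    qed
    have zx: "commutator G (commutator G y u) t \<in> N" if "t \<in> carrier G" for t
      using commutator_lower_central[OF z that] by (simp add: N_def)
    have uc: "commutator G t (commutator G y v) \<in> N" if "t \<in> lower_central G (Suc a)" for t
      using Suc.IH[OF that c] by (simp add: N_def)
    \<comment> \<open>Membership of \<open>commutator G u v\<close> in
      \<open>lower_central G (Suc a)\<close>, weaker than its true depth, is the one covered by the
      induction hypothesis; the missing step is supplied by \<open>commutator G y v\<close>.\<close>
    have kc: "commutator G (commutator G u v) (commutator G y v) \<in> N"
    proof (rule uc)
      show "commutator G u v \<in> lower_central G (Suc a)"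
        using commutator_lower_central[OF u v] lower_central_Suc_subset by blast
    qed
    have "commutator (G Mod N) (commutator (G Mod N) (N #> u) (N #> v)) (N #> y) = \<one>\<^bsub>G Mod N\<^esub>"
    proof (rule h.H.commutator_commutator_eq_one)
      have hc: "commutator (G Mod N) (N #> s) (N #> t) = N #> commutator G s t"
        if "s \<in> carrier G" "t \<in> carrier G" for s t using that h.hom_commutator by simp
      show "commutator (G Mod N) (commutator (G Mod N) (N #> u) (N #> v)) (commutator (G Mod N) (N #> y) (N #> v)) = \<one>\<^bsub>G Mod N\<^esub>"
        using kc h1[OF kc] uG v w by (simp add: hc)
      show "commutator (G Mod N) (N #> u) (commutator (G Mod N) (N #> y) (N #> v)) = \<one>\<^bsub>G Mod N\<^esub>"
        using h1[OF uc[OF u]] uG v w by (simp add: hc)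
      show "commutator (G Mod N) (commutator (G Mod N) (N #> y) (N #> u)) (N #> u) = \<one>\<^bsub>G Mod N\<^esub>"
        using h1[OF zx] uG v w by (simp add: hc)
      have "commutator (G Mod N) (N #> y) (N #> v) \<otimes>\<^bsub>G Mod N\<^esub> (N #> v) = N #> (commutator G y v \<otimes> v)"
        using uG v w by (simp add: hc del: mult_FactGroup)
      then show "commutator (G Mod N) (commutator (G Mod N) (N #> y) (N #> u))
            (commutator (G Mod N) (N #> y) (N #> v) \<otimes>\<^bsub>G Mod N\<^esub> (N #> v)) = \<one>\<^bsub>G Mod N\<^esub>"
        using h1[OF zx[of "commutator G y v \<otimes> v"]] uG v w by (simp add: hc)
    qed (use uG v w in auto)
    then show ?thesis
      using uG v w by (simp flip: h.hom_commutator N.coset_eq_one_iff del: one_FactGroup)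
  qed
  have "x \<in> carrier G \<and> commutator G x y \<in> N"
    using Suc.prems(1) unfolding lower_central.simps(3)
  proof (induction rule: generate.induct)
    case one
    then show ?case using w by (simp add: commutator_one_left)
  next
    case (incl x)
    then show ?case using gen lower_central_carrier by auto
  next
    case (inv x)
    then have x: "x \<in> carrier G" "commutator G x y \<in> N" using gen lower_central_carrier by auto
    have "commutator G (inv x) y = inv x \<otimes> inv (commutator G x y) \<otimes> x"
      using x w by (simp add: word_simps)
    then show ?case using x by (simp add: N.inv_op_closed1)
  next
    case (eng x1 x2)
    then show ?case
      using w N.m_closed[OF N.inv_op_closed2[of x1 "commutator G x2 y"], of "commutator G x1 y"]
        commutator_mult_left[of x1 x2 y]
      by (auto simp: commutator_def[of G x1 "commutator G x2 y"] m_assoc mult_inv_cancel_left)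
  qed
  then show ?case unfolding N_def by (rule conjunct2)
qed


section \<open>Automorphisms acting trivially modulo the lower central series\<close>

lemma carrier_AutoGroup [simp]: "carrier (AutoGroup G) = auto G"
  by (simp add: AutoGroup_def)

lemma one_AutoGroup: "\<one>\<^bsub>AutoGroup G\<^esub> = (\<lambda>x\<in>carrier G. x)"
  by (simp add: AutoGroup_def BijGroup_def)

lemma mult_AutoGroup:
  "\<lbrakk>\<phi> \<in> auto G; \<psi> \<in> auto G\<rbrakk> \<Longrightarrow> \<phi> \<otimes>\<^bsub>AutoGroup G\<^esub> \<psi> = compose (carrier G) \<phi> \<psi>"
  by (simp add: AutoGroup_def BijGroup_def auto_def)

lemma mult_AutoGroup_apply:
  "\<lbrakk>\<phi> \<in> auto G; \<psi> \<in> auto G; w \<in> carrier G\<rbrakk> \<Longrightarrow> (\<phi> \<otimes>\<^bsub>AutoGroup G\<^esub> \<psi>) w = \<phi> (\<psi> w)"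
  by (simp add: mult_AutoGroup compose_eq)

lemma auto_closed [intro]: "\<lbrakk>\<phi> \<in> auto G; w \<in> carrier G\<rbrakk> \<Longrightarrow> \<phi> w \<in> carrier G"
  by (auto simp: auto_def hom_def)

lemma auto_surj:
  assumes "\<phi> \<in> auto G" "w \<in> carrier G"
  obtains v where "v \<in> carrier G" "\<phi> v = w"
proof -
  have "w \<in> \<phi> ` carrier G" using assms by (simp add: auto_def Bij_def bij_betw_def)
  then show thesis using that by blast
qed

lemma auto_eqI:
  "\<lbrakk>\<phi> \<in> auto G; \<psi> \<in> auto G; \<And>w. w \<in> carrier G \<Longrightarrow> \<phi> w = \<psi> w\<rbrakk> \<Longrightarrow> \<phi> = \<psi>"
  by (auto simp: auto_def Bij_def intro: extensionalityI)

context group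
begin

lemma auto_group_hom: "\<phi> \<in> auto G \<Longrightarrow> group_hom G G \<phi>"
  by (auto simp: auto_def group_hom_def group_hom_axioms_def is_group)

lemma inv_AutoGroup_apply:
  assumes "\<phi> \<in> auto G" "w \<in> carrier G"
  shows "(inv\<^bsub>AutoGroup G\<^esub> \<phi>) (\<phi> w) = w" "\<phi> ((inv\<^bsub>AutoGroup G\<^esub> \<phi>) w) = w"
proof -
  interpret A: group "AutoGroup G" by (rule AutoGroup)
  have "inv\<^bsub>AutoGroup G\<^esub> \<phi> \<in> auto G" using A.inv_closed assms by simp
  then show "(inv\<^bsub>AutoGroup G\<^esub> \<phi>) (\<phi> w) = w" "\<phi> ((inv\<^bsub>AutoGroup G\<^esub> \<phi>) w) = w"
    using mult_AutoGroup_apply[of "inv\<^bsub>AutoGroup G\<^esub> \<phi>" G \<phi> w] mult_AutoGroup_apply[of \<phi> G "inv\<^bsub>AutoGroup G\<^esub> \<phi>" w]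
      A.l_inv[of \<phi>] A.r_inv[of \<phi>] assms by (simp_all add: one_AutoGroup)
qed

end

text \<open>The kernel of the action on the quotient by the m-th term, written elementwise and for
  an arbitrary group, so that the commutator calculus applies without coset maps.\<close>

definition lcs_kernel :: "('a, 'b) monoid_scheme \<Rightarrow> nat \<Rightarrow> ('a \<Rightarrow> 'a) set" where
  "lcs_kernel G m = {\<phi> \<in> auto G. \<forall>w\<in>carrier G. \<phi> w \<otimes>\<^bsub>G\<^esub> inv\<^bsub>G\<^esub> w \<in> lower_central G m}"

text \<open>If \<open>\<phi> w \<otimes> inv w\<close> always lies in \<open>H\<close>, then \<phi>
  maps every coset into itself, and a preimage of an element lies in the same coset as that element;
  surjectivity of \<phi> therefore makes the image the whole coset.\<close>

lemma (in normal) kernel_induced_aut: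
  "kernel (AutoGroup G) (AutoGroup (G Mod H)) (induced_aut G H) =
    {\<phi> \<in> auto G. \<forall>w\<in>carrier G. \<phi> w \<otimes> inv w \<in> H}"
proof -
  have eq: "induced_aut G H \<phi> = \<one>\<^bsub>AutoGroup (G Mod H)\<^esub> \<longleftrightarrow>
      (\<forall>w\<in>carrier G. \<phi> ` (H #> w) = H #> w)" for \<phi>
    by (auto simp: induced_aut_def one_AutoGroup carrier_FactGroup restrict_def fun_eq_iff)
  have "(\<forall>w\<in>carrier G. \<phi> ` (H #> w) = H #> w) \<longleftrightarrow> (\<forall>w\<in>carrier G. \<phi> w \<otimes> inv w \<in> H)"
    if \<phi>: "\<phi> \<in> auto G" for \<phi>
  proof (intro iffI ballI)
    fix w assume *: "\<forall>w\<in>carrier G. \<phi> ` (H #> w) = H #> w" and w: "w \<in> carrier G"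
    have "w \<in> H #> w" using rcos_self[OF w is_subgroup] .
    then have "\<phi> w \<in> H #> w" using * w by blast
    then show "\<phi> w \<otimes> inv w \<in> H" using rcos_module[OF is_group w] \<phi> w by blast
  next
    fix w assume *: "\<forall>w\<in>carrier G. \<phi> w \<otimes> inv w \<in> H" and w: "w \<in> carrier G"
    have same: "H #> \<phi> v = H #> v" if "v \<in> carrier G" for v
      using * that \<phi> coset_eq_iff by blast
    have coset: "v \<in> H #> u \<longleftrightarrow> H #> v = H #> u" if "v \<in> carrier G" "u \<in> carrier G" for u v
      using that rcos_self[OF _ is_subgroup] repr_independence[OF _ _ is_subgroup] by metis
    have sub: "H #> w \<subseteq> carrier G" using w by (simp add: r_coset_subset_G subset)
    show "\<phi> ` (H #> w) = H #> w"
    proof (intro equalityI subsetI)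
      fix v assume "v \<in> \<phi> ` (H #> w)"
      then obtain u where u: "v = \<phi> u" "u \<in> H #> w" by blast
      then show "v \<in> H #> w" using sub coset w same \<phi> by (metis auto_closed subsetD)
    next
      fix v assume v: "v \<in> H #> w"
      then obtain u where u: "u \<in> carrier G" "\<phi> u = v" using auto_surj[OF \<phi>] sub by blast
      then have "u \<in> H #> w" using v coset w same sub by (metis subsetD)
      then show "v \<in> \<phi> ` (H #> w)" using u by blast
    qed
  qed
  then show ?thesis by (auto simp: kernel_def eq)
qed

lemma J_Aut_eq_lcs_kernel: "J_Aut n m = lcs_kernel (FX n) m"
proof -
  interpret F: group "FX n" by (rule group_free_group)
  show ?thesis
    unfolding J_Aut_def lcs_kernel_def by (rule normal.kernel_induced_aut[OF F.normal_lower_central])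
qed

context group
begin

lemma lcs_kernel_auto: "\<phi> \<in> lcs_kernel G m \<Longrightarrow> \<phi> \<in> auto G"
  by (simp add: lcs_kernel_def)

lemma lcs_kernel_coset:
  assumes "\<phi> \<in> lcs_kernel G m" "w \<in> carrier G"
  shows "lower_central G m #> \<phi> w = lower_central G m #> w"
  using assms normal.coset_eq_iff[OF normal_lower_central, of "\<phi> w" w m]
  by (auto simp: lcs_kernel_def)

lemma lcs_kernelI:
  assumes "\<phi> \<in> auto G"
    "\<And>w. w \<in> carrier G \<Longrightarrow> lower_central G m #> \<phi> w = lower_central G m #> w"
  shows "\<phi> \<in> lcs_kernel G m"
  using assms normal.coset_eq_iff[OF normal_lower_central auto_closed[OF assms(1)]]
  by (simp add: lcs_kernel_def)

lemma lcs_kernel_antimono: "i \<le> j \<Longrightarrow> lcs_kernel G j \<subseteq> lcs_kernel G i"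
  using lower_central_antimono by (fastforce simp: lcs_kernel_def)

lemma subgroup_lcs_kernel: "subgroup (lcs_kernel G m) (AutoGroup G)"
proof -
  interpret A: group "AutoGroup G" by (rule AutoGroup)
  show ?thesis
  proof (rule A.subgroupI)
    show "lcs_kernel G m \<subseteq> carrier (AutoGroup G)" by (auto simp: lcs_kernel_def)
    have "\<one>\<^bsub>AutoGroup G\<^esub> \<in> lcs_kernel G m"
      using A.one_closed by (intro lcs_kernelI) (auto simp: one_AutoGroup)
    then show "lcs_kernel G m \<noteq> {}" by blast
  next
    fix \<phi> assume \<phi>: "\<phi> \<in> lcs_kernel G m"
    let ?\<psi> = "inv\<^bsub>AutoGroup G\<^esub> \<phi>"
    have \<psi>: "?\<psi> \<in> auto G" using A.inv_closed lcs_kernel_auto[OF \<phi>] by simp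
    show "?\<psi> \<in> lcs_kernel G m"
    proof (rule lcs_kernelI[OF \<psi>])
      fix w assume w: "w \<in> carrier G"
      then show "lower_central G m #> ?\<psi> w = lower_central G m #> w"
        using lcs_kernel_coset[OF \<phi>, of "?\<psi> w"] inv_AutoGroup_apply[OF lcs_kernel_auto[OF \<phi>] w] \<psi>
        by auto
    qed
  next
    fix \<phi> \<psi> assume *: "\<phi> \<in> lcs_kernel G m" "\<psi> \<in> lcs_kernel G m"
    then have a: "\<phi> \<in> auto G" "\<psi> \<in> auto G" by (auto simp: lcs_kernel_auto)
    show "\<phi> \<otimes>\<^bsub>AutoGroup G\<^esub> \<psi> \<in> lcs_kernel G m"
    proof (rule lcs_kernelI)
      show "\<phi> \<otimes>\<^bsub>AutoGroup G\<^esub> \<psi> \<in> auto G" using A.m_closed a by simp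
    next
      fix w assume w: "w \<in> carrier G"
      then show "lower_central G m #> (\<phi> \<otimes>\<^bsub>AutoGroup G\<^esub> \<psi>) w = lower_central G m #> w"
        using lcs_kernel_coset[OF *(1), of "\<psi> w"] lcs_kernel_coset[OF *(2) w] a
        by (auto simp: mult_AutoGroup_apply)
    qed
  qed
qed

text \<open>On a generator [u, v] with \<phi> u = a u and \<phi> v = b v, expanding [a u, b v]
  yields [u, v] and correction terms, each of which contains \<open>a\<close> or \<open>b\<close>
  and so lies in the target term.\<close>

lemma lcs_kernel_shift:
  assumes \<phi>: "\<phi> \<in> lcs_kernel G (Suc k)" and "w \<in> lower_central G (Suc m)"
  shows "\<phi> w \<otimes> inv w \<in> lower_central G (Suc m + k)"
  using assms(2)
proof (induction m arbitrary: w)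
  case 0
  then show ?case using \<phi> by (simp add: lcs_kernel_def)
next
  case (Suc m)
  note [simp del] = lower_central.simps(3)
  interpret \<phi>: group_hom G G \<phi> using auto_group_hom lcs_kernel_auto[OF \<phi>] by blast
  define N where "N = lower_central G (Suc (Suc m) + k)"
  interpret N: normal N G unfolding N_def by (rule normal_lower_central)
  interpret h: group_hom G "G Mod N" "\<lambda>x. N #> x" by (rule N.group_hom_Mod)
  have triv: "N #> x = \<one>\<^bsub>G Mod N\<^esub>" if "x \<in> N" for x
    using that N.coset_eq_one_iff N.subset by blast
  note [simp del] = one_FactGroup mult_FactGroup
  have gen: "N #> \<phi> (commutator G u v) = N #> commutator G u v"
    if u: "u \<in> lower_central G (Suc m)" and v: "v \<in> carrier G" for u v
  proof -
    have uG: "u \<in> carrier G" using u lower_central_carrier by blast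
    define a b where "a = \<phi> u \<otimes> inv u" and "b = \<phi> v \<otimes> inv v"
    have a: "a \<in> lower_central G (Suc (m + k))" using Suc.IH[OF u] by (simp add: a_def)
    have b: "b \<in> lower_central G (Suc k)" using \<phi> v by (simp add: b_def lcs_kernel_def)
    have aG: "a \<in> carrier G" and bG: "b \<in> carrier G" using a b lower_central_carrier by blast+
    have \<phi>u: "\<phi> u = a \<otimes> u" and \<phi>v: "\<phi> v = b \<otimes> v"
      using uG v by (simp_all add: a_def b_def m_assoc)
    have at: "N #> commutator G a t = \<one>\<^bsub>G Mod N\<^esub>" if "t \<in> carrier G" for t
      using commutator_lower_central[OF a that] by (intro triv) (simp add: N_def)
    have ub: "N #> commutator G u b = \<one>\<^bsub>G Mod N\<^esub>"
      using commutator_lower_central_lower_central[OF u b] by (intro triv) (simp add: N_def)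
    \<comment> \<open>This correction is one step deeper than required, since \<open>b\<close>
      already sits in term \<open>Suc k\<close>.\<close>
    have "commutator G b (commutator G u v) \<in> lower_central G (Suc k + Suc (Suc m))"
      using commutator_lower_central_lower_central[OF b commutator_lower_central[OF u v]] .
    then have "commutator G b (commutator G u v) \<in> N"
      using lower_central_antimono[of "Suc (Suc m) + k" "Suc k + Suc (Suc m)"] by (auto simp: N_def)
    then have buv: "N #> commutator G b (commutator G u v) = \<one>\<^bsub>G Mod N\<^esub>" by (rule triv)
    have "\<phi> (commutator G u v) = commutator G (a \<otimes> u) (b \<otimes> v)"
      using uG v by (simp add: \<phi>.hom_commutator \<phi>u \<phi>v)
    then have "N #> \<phi> (commutator G u v) = N #> commutator G u (b \<otimes> v)"
      using commutator_mult_left[of a u "b \<otimes> v"] aG bG uG v at by simp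
    also have "\<dots> = N #> commutator G u v"
      using commutator_mult_right[of u b v] bG uG v ub buv by simp
    finally show ?thesis .
  qed
  have "w \<in> carrier G \<and> N #> \<phi> w = N #> w"
    using Suc.prems unfolding lower_central.simps(3)
  proof (induction rule: generate.induct)
    case (inv x)
    then have "x \<in> carrier G" "N #> \<phi> x = N #> x" using gen lower_central_carrier by auto
    then show ?case by simp
  qed (use gen lower_central_carrier in auto)
  then show ?case
    using N.coset_eq_iff[of "\<phi> w" w] by (simp add: N_def)
qed

text \<open>With \<phi> w = x w and \<psi> w = y w, the shift lemma gives \<phi>\<psi> w = y x w and
  \<psi>\<phi> w = x y w modulo the target term, and \<open>x\<close> and \<open>y\<close> commute
  there. So \<phi>\<psi> and \<psi>\<phi> induce the same map.\<close>

lemma commutator_lcs_kernel: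
  assumes \<phi>: "\<phi> \<in> lcs_kernel G (Suc k)" and \<psi>: "\<psi> \<in> lcs_kernel G (Suc l)"
  shows "commutator (AutoGroup G) \<phi> \<psi> \<in> lcs_kernel G (Suc (k + l))"
proof -
  interpret A: group "AutoGroup G" by (rule AutoGroup)
  define N where "N = lower_central G (Suc (k + l))"
  interpret N: normal N G unfolding N_def by (rule normal_lower_central)
  interpret h: group_hom G "G Mod N" "\<lambda>x. N #> x" by (rule N.group_hom_Mod)
  have triv: "N #> x = \<one>\<^bsub>G Mod N\<^esub>" if "x \<in> N" for x
    using that N.coset_eq_one_iff N.subset by blast
  note [simp del] = one_FactGroup mult_FactGroup
  have a: "\<phi> \<in> auto G" "\<psi> \<in> auto G" using \<phi> \<psi> by (auto simp: lcs_kernel_auto)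
  interpret \<phi>: group_hom G G \<phi> using auto_group_hom a by blast
  interpret \<psi>: group_hom G G \<psi> using auto_group_hom a by blast
  have comm: "N #> \<phi> (\<psi> w) = N #> \<psi> (\<phi> w)" if w: "w \<in> carrier G" for w
  proof -
    define x y where "x = \<phi> w \<otimes> inv w" and "y = \<psi> w \<otimes> inv w"
    have x: "x \<in> lower_central G (Suc k)" and y: "y \<in> lower_central G (Suc l)"
      using \<phi> \<psi> w by (simp_all add: x_def y_def lcs_kernel_def)
    have G: "x \<in> carrier G" "y \<in> carrier G" using x y lower_central_carrier by blast+
    have w': "\<phi> w = x \<otimes> w" "\<psi> w = y \<otimes> w" using w by (simp_all add: x_def y_def m_assoc)
    have "\<phi> y \<otimes> inv y \<in> N" "\<psi> x \<otimes> inv x \<in> N"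
      using lcs_kernel_shift[OF \<phi> y] lcs_kernel_shift[OF \<psi> x] by (simp_all add: N_def add.commute)
    then have 1: "N #> \<phi> y = N #> y" "N #> \<psi> x = N #> x"
      using G N.coset_eq_iff by simp_all
    have "commutator G x y \<in> N"
      using commutator_lower_central_lower_central[OF x y]
        lower_central_antimono[of "Suc (k + l)" "Suc k + Suc l"] by (auto simp: N_def)
    then have 2: "N #> (x \<otimes> y) = N #> (y \<otimes> x)"
      using mult_eq_commutator_mult[OF G] G triv by simp
    have "N #> \<phi> (\<psi> w) = (N #> (y \<otimes> x)) \<otimes>\<^bsub>G Mod N\<^esub> (N #> w)"
      using G w 1 by (simp add: w' h.H.m_assoc)
    also have "\<dots> = N #> \<psi> (\<phi> w)"
      using G w 1 by (simp add: w' h.H.m_assoc flip: 2)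
    finally show ?thesis .
  qed
  show ?thesis
  proof (rule lcs_kernelI)
    show c: "commutator (AutoGroup G) \<phi> \<psi> \<in> auto G"
      using A.commutator_closed[of \<phi> \<psi>] a by simp
    fix w assume w: "w \<in> carrier G"
    have \<psi>\<phi>: "\<psi> \<otimes>\<^bsub>AutoGroup G\<^esub> \<phi> \<in> auto G" using A.m_closed a by simp
    \<comment> \<open>Writing \<open>w\<close> as the image of \<open>v\<close> under \<psi>\<phi>
      avoids inverses: the commutator sends \<open>w\<close> to \<phi>\<psi> v.\<close>
    obtain v where v: "v \<in> carrier G" "(\<psi> \<otimes>\<^bsub>AutoGroup G\<^esub> \<phi>) v = w"
      using auto_surj[OF \<psi>\<phi> w] .
    have "commutator (AutoGroup G) \<phi> \<psi> w = (\<phi> \<otimes>\<^bsub>AutoGroup G\<^esub> \<psi>) v"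
      using A.mult_eq_commutator_mult[of \<phi> \<psi>] a c \<psi>\<phi> v mult_AutoGroup_apply[OF c \<psi>\<phi>] by simp
    then show "lower_central G (Suc (k + l)) #> commutator (AutoGroup G) \<phi> \<psi> w =
        lower_central G (Suc (k + l)) #> w"
      using v a comm[OF v(1)] by (simp add: mult_AutoGroup_apply N_def)
  qed
qed

end

section \<open>Graded Lie rings from bilinear brackets\<close>

text \<open>The body of \<open>gr_J\<close> with abstract layers and an abstract bracket between
  layers, so that the Lie axioms can be checked without mentioning automorphisms.\<close>

definition graded_sum ::
    "(nat \<Rightarrow> ('a, 'b) monoid_scheme) \<Rightarrow> (nat \<Rightarrow> nat \<Rightarrow> 'a \<Rightarrow> 'a \<Rightarrow> 'a) \<Rightarrow> (nat \<Rightarrow> 'a) graded_lie" where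
  "graded_sum Q br = (let S = sum_group {1..} Q in
     \<lparr>carrier = carrier S, monoid.mult = monoid.mult S, one = one S,
      bracket = (\<lambda>u v. \<lambda>m\<in>{1..}.
        finprod (Q m) (\<lambda>k. br k (m - k) (u k) (v (m - k))) {1..<m}),
      grade = (\<lambda>m. {u \<in> carrier S. \<forall>k\<in>{1..} - {m}. u k = \<one>\<^bsub>Q k\<^esub>})\<rparr>)"

lemma (in comm_monoid) finprod_Sigma:
  assumes "finite I" "\<And>i. i \<in> I \<Longrightarrow> finite (J i)"
    and "\<And>i j. \<lbrakk>i \<in> I; j \<in> J i\<rbrakk> \<Longrightarrow> f i j \<in> carrier G"
  shows "finprod G (\<lambda>i. finprod G (f i) (J i)) I = finprod G (\<lambda>(i, j). f i j) (Sigma I J)"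
  using assms
proof (induction I rule: finite_induct)
  case (insert i I)
  have "Sigma (insert i I) J = Pair i ` J i \<union> Sigma I J" by auto
  moreover have "finprod G (\<lambda>(i, j). f i j) (Pair i ` J i \<union> Sigma I J) =
      finprod G (\<lambda>(i, j). f i j) (Pair i ` J i) \<otimes> finprod G (\<lambda>(i, j). f i j) (Sigma I J)"
    using insert by (intro finprod_Un_disjoint) auto
  moreover have "finprod G (\<lambda>(i, j). f i j) (Pair i ` J i) = finprod G (f i) (J i)"
    using insert.prems by (subst finprod_reindex) (auto simp: inj_on_def)
  moreover have "finprod G (\<lambda>i. finprod G (f i) (J i)) I = finprod G (\<lambda>(i, j). f i j) (Sigma I J)"
    using insert by auto
  ultimately show ?case
    using insert by (subst finprod_insert) auto
qed simp

lemma hom_finprod: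
  assumes "comm_group G" "comm_group H" "h \<in> hom G H" "finite A" "f \<in> A \<rightarrow> carrier G"
  shows "h (finprod G f A) = finprod H (\<lambda>x. h (f x)) A"
proof -
  interpret G: comm_group G by fact
  interpret H: comm_group H by fact
  interpret h: group_hom G H h using assms(3) by unfold_locales
  show ?thesis using assms(4,5)
    by (induction A rule: finite_induct) (auto simp: Pi_iff)
qed

text \<open>The reflection of \<open>k\<close> to \<open>m - k\<close> pairs the lower half
  \<open>X\<close> with the upper half. The middle index of an even \<open>m\<close> is its own
  partner, and there cancellation would only give 2-torsion, hence the extra assumption
  \<open>mid\<close>.\<close>

lemma (in comm_group) finprod_antisymmetric:
  fixes m :: nat
  assumes f: "\<And>k. k \<in> {1..<m} \<Longrightarrow> f k \<in> carrier G"
    and cancel: "\<And>k. k \<in> {1..<m} \<Longrightarrow> f k \<otimes> f (m - k) = \<one>"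
    and mid: "\<And>k. \<lbrakk>k \<in> {1..<m}; k = m - k\<rbrakk> \<Longrightarrow> f k = \<one>"
  shows "finprod G f {1..<m} = \<one>"
proof -
  define X Y where "X = {k. 1 \<le> k \<and> 2 * k < m}" and "Y = {k. 1 \<le> k \<and> 2 * k = m}"
  have sub: "X \<subseteq> {1..<m}" "Y \<subseteq> {1..<m}" "(\<lambda>k. m - k) ` X \<subseteq> {1..<m}" by (auto simp: X_def Y_def)
  have fin: "finite X" "finite Y" using sub finite_subset by blast+
  have eq: "{1..<m} = X \<union> (Y \<union> (\<lambda>k. m - k) ` X)"
  proof (intro equalityI subsetI)
    fix k assume k: "k \<in> {1..<m}"
    then have "k \<in> X \<or> k \<in> Y \<or> (m - k \<in> X \<and> k = m - (m - k))" by (auto simp: X_def Y_def)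
    then show "k \<in> X \<union> (Y \<union> (\<lambda>k. m - k) ` X)" by blast
  qed (use sub in auto)
  have disj: "X \<inter> (Y \<union> (\<lambda>k. m - k) ` X) = {}" "Y \<inter> (\<lambda>k. m - k) ` X = {}"
    by (auto simp: X_def Y_def)
  have fX: "f \<in> X \<rightarrow> carrier G" "f \<in> Y \<rightarrow> carrier G" "f \<in> (\<lambda>k. m - k) ` X \<rightarrow> carrier G"
    using sub f by blast+
  then have fX': "(\<lambda>k. f (m - k)) \<in> X \<rightarrow> carrier G" by auto
  have "finprod G f ((\<lambda>k. m - k) ` X) = finprod G (\<lambda>k. f (m - k)) X"
    using fX by (intro finprod_reindex) (auto simp: inj_on_def X_def)
  moreover have "finprod G f Y = \<one>"
    by (rule finprod_one_eqI) (use mid sub in \<open>auto simp: Y_def\<close>)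
  ultimately have "finprod G f {1..<m} = finprod G f X \<otimes> finprod G (\<lambda>k. f (m - k)) X"
    using fin fX disj fX' unfolding eq by (simp add: finprod_Un_disjoint)
  also have "\<dots> = finprod G (\<lambda>k. f k \<otimes> f (m - k)) X"
    using fX fX' by (simp add: finprod_multf)
  also have "\<dots> = \<one>"
    by (rule finprod_one_eqI) (use cancel sub in blast)
  finally show ?thesis .
qed

text \<open>\<open>br_antisym\<close> with equal arguments only says that twice
  \<open>br k k a a\<close> vanishes, which leaves 2-torsion open; hence the separate
  \<open>br_self\<close>. It concerns equal degrees only, because mixed terms of a self-bracket
  cancel in pairs.\<close>

locale graded_bracket =
  fixes Q :: "nat \<Rightarrow> ('a, 'b) monoid_scheme" and br :: "nat \<Rightarrow> nat \<Rightarrow> 'a \<Rightarrow> 'a \<Rightarrow> 'a"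
  assumes comm_Q: "1 \<le> m \<Longrightarrow> comm_group (Q m)"
    and br_closed: "\<lbrakk>1 \<le> k; 1 \<le> l; a \<in> carrier (Q k); b \<in> carrier (Q l)\<rbrakk>
      \<Longrightarrow> br k l a b \<in> carrier (Q (k + l))"
    and br_left: "\<lbrakk>1 \<le> k; 1 \<le> l; a \<in> carrier (Q k); a' \<in> carrier (Q k); b \<in> carrier (Q l)\<rbrakk>
      \<Longrightarrow> br k l (a \<otimes>\<^bsub>Q k\<^esub> a') b = br k l a b \<otimes>\<^bsub>Q (k + l)\<^esub> br k l a' b"
    and br_right: "\<lbrakk>1 \<le> k; 1 \<le> l; a \<in> carrier (Q k); b \<in> carrier (Q l); b' \<in> carrier (Q l)\<rbrakk>
      \<Longrightarrow> br k l a (b \<otimes>\<^bsub>Q l\<^esub> b') = br k l a b \<otimes>\<^bsub>Q (k + l)\<^esub> br k l a b'"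
    and br_self: "\<lbrakk>1 \<le> k; a \<in> carrier (Q k)\<rbrakk> \<Longrightarrow> br k k a a = \<one>\<^bsub>Q (k + k)\<^esub>"
    and br_antisym: "\<lbrakk>1 \<le> k; 1 \<le> l; a \<in> carrier (Q k); b \<in> carrier (Q l)\<rbrakk>
      \<Longrightarrow> br k l a b \<otimes>\<^bsub>Q (k + l)\<^esub> br l k b a = \<one>\<^bsub>Q (k + l)\<^esub>"
    and br_jacobi: "\<lbrakk>1 \<le> k; 1 \<le> l; 1 \<le> m; a \<in> carrier (Q k); b \<in> carrier (Q l); c \<in> carrier (Q m)\<rbrakk>
      \<Longrightarrow> br k (l + m) a (br l m b c) \<otimes>\<^bsub>Q (k + l + m)\<^esub> br l (m + k) b (br m k c a)
            \<otimes>\<^bsub>Q (k + l + m)\<^esub> br m (k + l) c (br k l a b) = \<one>\<^bsub>Q (k + l + m)\<^esub>"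
begin

lemma group_Q: "1 \<le> m \<Longrightarrow> group (Q m)"
  using comm_Q comm_group.axioms(2) by blast

lemma br_hom_right:
  assumes "1 \<le> k" "1 \<le> l" "a \<in> carrier (Q k)"
  shows "br k l a \<in> hom (Q l) (Q (k + l))"
  using assms br_closed br_right by (auto simp: hom_def)

lemma br_one_right: "\<lbrakk>1 \<le> k; 1 \<le> l; a \<in> carrier (Q k)\<rbrakk> \<Longrightarrow> br k l a \<one>\<^bsub>Q l\<^esub> = \<one>\<^bsub>Q (k + l)\<^esub>"
  using br_hom_right group_Q hom_one by (metis add_leD1 trans_le_add1)

lemma br_one_left:
  assumes "1 \<le> k" "1 \<le> l" "b \<in> carrier (Q l)"
  shows "br k l \<one>\<^bsub>Q k\<^esub> b = \<one>\<^bsub>Q (k + l)\<^esub>"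
proof -
  have "(\<lambda>a. br k l a b) \<in> hom (Q k) (Q (k + l))"
    using assms br_closed br_left by (auto simp: hom_def)
  then show ?thesis
    using hom_one[of "\<lambda>a. br k l a b" "Q k" "Q (k + l)"] group_Q assms by auto
qed

abbreviation L where "L \<equiv> graded_sum Q br"

lemma carrier_graded_sum:
  "carrier L = {x \<in> \<Pi>\<^sub>E i\<in>{1..}. carrier (Q i). finite {i \<in> {1..}. x i \<noteq> \<one>\<^bsub>Q i\<^esub>}}"
proof -
  have "carrier (sum_group {1..} Q) =
      {x \<in> \<Pi>\<^sub>E i\<in>{1..}. carrier (Q i). finite {i \<in> {1..}. x i \<noteq> \<one>\<^bsub>Q i\<^esub>}}"
    by (rule carrier_sum_group) (auto intro: group_Q)
  then show ?thesis by (simp add: graded_sum_def Let_def)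
qed

lemma graded_sum_component: "\<lbrakk>u \<in> carrier L; 1 \<le> m\<rbrakk> \<Longrightarrow> u m \<in> carrier (Q m)"
  by (auto simp: carrier_graded_sum)

lemma mult_graded_sum: "u \<otimes>\<^bsub>L\<^esub> v = (\<lambda>i\<in>{1..}. u i \<otimes>\<^bsub>Q i\<^esub> v i)"
  by (simp add: graded_sum_def Let_def)

lemma one_graded_sum: "\<one>\<^bsub>L\<^esub> = (\<lambda>i\<in>{1..}. \<one>\<^bsub>Q i\<^esub>)"
  by (simp add: graded_sum_def Let_def)

lemma bracket_graded_sum:
  "bracket L u v = (\<lambda>m\<in>{1..}. finprod (Q m) (\<lambda>k. br k (m - k) (u k) (v (m - k))) {1..<m})"
  by (simp add: graded_sum_def Let_def)

lemma graded_sum_eqI: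
  assumes "u \<in> extensional {1..}" "v \<in> extensional {1..}" "\<And>m. 1 \<le> m \<Longrightarrow> u m = v m"
  shows "u = v"
  using assms by (intro extensionalityI[of u "{1..}" v]) auto

lemma comm_group_graded_sum: "comm_group L"
proof -
  have S: "group (sum_group {1..} Q)" by (rule sum_group) (auto intro: group_Q)
  have "group L"
  proof (rule groupI)
    fix x assume "x \<in> carrier L"
    then obtain y where "y \<in> carrier (sum_group {1..} Q)"
      "y \<otimes>\<^bsub>sum_group {1..} Q\<^esub> x = \<one>\<^bsub>sum_group {1..} Q\<^esub>"
      using group.l_inv_ex[OF S, of x] by (auto simp: graded_sum_def Let_def)
    then show "\<exists>y\<in>carrier L. y \<otimes>\<^bsub>L\<^esub> x = \<one>\<^bsub>L\<^esub>"
      by (auto simp: graded_sum_def Let_def)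
  qed (use monoid.m_closed[OF group.is_monoid[OF S]] monoid.m_assoc[OF group.is_monoid[OF S]]
      monoid.one_closed[OF group.is_monoid[OF S]] monoid.l_one[OF group.is_monoid[OF S]]
      in \<open>auto simp: graded_sum_def Let_def simp del: mult_sum_group one_sum_group\<close>)
  moreover have "u \<otimes>\<^bsub>L\<^esub> v = v \<otimes>\<^bsub>L\<^esub> u" if "u \<in> carrier L" "v \<in> carrier L" for u v
    unfolding mult_graded_sum
  proof (rule restrict_ext)
    fix i :: nat assume "i \<in> {1..}"
    then show "u i \<otimes>\<^bsub>Q i\<^esub> v i = v i \<otimes>\<^bsub>Q i\<^esub> u i"
      using comm_groupE(4)[OF comm_Q[of i]] graded_sum_component that by auto
  qed
  ultimately show ?thesis by (rule group.group_comm_groupI)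
qed

lemma br_component_closed:
  assumes "u \<in> carrier L" "v \<in> carrier L" "k \<in> {1..<m}"
  shows "br k (m - k) (u k) (v (m - k)) \<in> carrier (Q m)"
  using br_closed[of k "m - k" "u k" "v (m - k)"] graded_sum_component assms by auto

lemma bracket_closed_graded_sum:
  assumes u: "u \<in> carrier L" and v: "v \<in> carrier L"
  shows "bracket L u v \<in> carrier L"
proof -
  let ?S = "\<lambda>w. {i \<in> {1..}. w i \<noteq> \<one>\<^bsub>Q i\<^esub>}"
  have "bracket L u v m \<in> carrier (Q m)" if "1 \<le> m" for m
  proof -
    interpret Qm: comm_group "Q m" using comm_Q that by blast
    show ?thesis
      using that br_component_closed[OF u v] by (auto simp: bracket_graded_sum intro!: Qm.finprod_closed)
  qed
  \<comment> \<open>A nontrivial component in degree \<open>m\<close> needs \<open>k\<close> and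
    \<open>m - k\<close> in the two supports, so the new support lies among the sums of two finite
    sets.\<close>
  moreover have "?S (bracket L u v) \<subseteq> (\<lambda>(k, l). k + l) ` (?S u \<times> ?S v)"
  proof (rule subsetI, rule ccontr)
    fix m assume m: "m \<in> ?S (bracket L u v)" and not: "m \<notin> (\<lambda>(k, l). k + l) ` (?S u \<times> ?S v)"
    interpret Qm: comm_group "Q m" using comm_Q m by blast
    have "br k (m - k) (u k) (v (m - k)) = \<one>\<^bsub>Q m\<^esub>" if k: "k \<in> {1..<m}" for k
    proof -
      have "m = (\<lambda>(k, l). k + l) (k, m - k)" using k by simp
      then have "(k, m - k) \<notin> ?S u \<times> ?S v" using not by blast
      then have "u k = \<one>\<^bsub>Q k\<^esub> \<or> v (m - k) = \<one>\<^bsub>Q (m - k)\<^esub>" using k by auto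
      then show ?thesis
        using k br_one_left[of k "m - k" "v (m - k)"] br_one_right[of k "m - k" "u k"]
          graded_sum_component[OF u, of k] graded_sum_component[OF v, of "m - k"] by auto
    qed
    then have "finprod (Q m) (\<lambda>k. br k (m - k) (u k) (v (m - k))) {1..<m} = \<one>\<^bsub>Q m\<^esub>"
      by (rule Qm.finprod_one_eqI)
    then have "bracket L u v m = \<one>\<^bsub>Q m\<^esub>" using m by (simp add: bracket_graded_sum)
    then show False using m by blast
  qed
  moreover have "finite (?S u \<times> ?S v)" using u v by (auto simp: carrier_graded_sum)
  ultimately show ?thesis
    unfolding carrier_graded_sum
    by (auto simp: PiE_iff intro: finite_subset finite_imageI) (simp add: bracket_graded_sum)
qed

text \<open>\<open>br k (m - k) (u k)\<close> is a homomorphism and passes through the inner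
  product. What remains is one product over the ways to write m = k + l + c with positive parts,
  indexed by \<open>(k, l)\<close>; in this shape the three terms of the Jacobi identity become
  comparable.\<close>

lemma nested_bracket_component:
  assumes u: "u \<in> carrier L" and v: "v \<in> carrier L" and w: "w \<in> carrier L" and m: "1 \<le> m"
  shows "bracket L u (bracket L v w) m =
    finprod (Q m) (\<lambda>(k, l). br k (m - k) (u k) (br l (m - k - l) (v l) (w (m - k - l))))
      (SIGMA k:{1..<m}. {1..<m - k})"
proof -
  interpret Qm: comm_group "Q m" using comm_Q m by blast
  have cl: "br k (m - k) (u k) (br l (m - k - l) (v l) (w (m - k - l))) \<in> carrier (Q m)"
    if "k \<in> {1..<m}" "l \<in> {1..<m - k}" for k l
    using br_closed[of k "m - k" "u k" "br l (m - k - l) (v l) (w (m - k - l))"] that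
      graded_sum_component[OF u, of k] br_component_closed[OF v w that(2)] by auto
  have "br k (m - k) (u k) (bracket L v w (m - k)) =
      finprod (Q m) (\<lambda>l. br k (m - k) (u k) (br l (m - k - l) (v l) (w (m - k - l)))) {1..<m - k}"
    if k: "k \<in> {1..<m}" for k
  proof -
    have "br k (m - k) (u k) \<in> hom (Q (m - k)) (Q m)"
      using br_hom_right[of k "m - k" "u k"] graded_sum_component[OF u, of k] k by auto
    then show ?thesis
      using hom_finprod[of "Q (m - k)" "Q m" "br k (m - k) (u k)" "{1..<m - k}"
          "\<lambda>l. br l (m - k - l) (v l) (w (m - k - l))"] comm_Q[of "m - k"] Qm.comm_group_axioms
        br_component_closed[OF v w, of _ "m - k"] k
      by (auto simp: bracket_graded_sum)
  qed
  then have "bracket L u (bracket L v w) m =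
      finprod (Q m) (\<lambda>k. finprod (Q m)
        (\<lambda>l. br k (m - k) (u k) (br l (m - k - l) (v l) (w (m - k - l)))) {1..<m - k}) {1..<m}"
    using m cl by (auto simp: bracket_graded_sum[of u] intro!: Qm.finprod_cong' Qm.finprod_closed)
  also have "\<dots> = finprod (Q m) (\<lambda>(k, l). br k (m - k) (u k) (br l (m - k - l) (v l) (w (m - k - l))))
      (SIGMA k:{1..<m}. {1..<m - k})"
    by (rule Qm.finprod_Sigma) (use cl in auto)
  finally show ?thesis .
qed

lemma lie_ring_graded_sum: "lie_ring L"
proof (intro lie_ring.intro lie_ring_axioms.intro comm_group_graded_sum)
  fix u v assume "u \<in> carrier L" "v \<in> carrier L"
  then show "bracket L u v \<in> carrier L" by (rule bracket_closed_graded_sum)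
next
  interpret L: comm_group L by (rule comm_group_graded_sum)
  have ext: "u \<in> extensional {1..}" if "u \<in> carrier L" for u
    using that by (auto simp: carrier_graded_sum PiE_def)
  fix u v w assume u: "u \<in> carrier L" and v: "v \<in> carrier L" and w: "w \<in> carrier L"
  note bc = bracket_closed_graded_sum
  show "bracket L (u \<otimes>\<^bsub>L\<^esub> v) w = bracket L u w \<otimes>\<^bsub>L\<^esub> bracket L v w"
  proof (rule graded_sum_eqI)
    fix m :: nat assume m: "1 \<le> m"
    interpret Qm: comm_group "Q m" using comm_Q m by blast
    have "finprod (Q m) (\<lambda>k. br k (m - k) ((u \<otimes>\<^bsub>L\<^esub> v) k) (w (m - k))) {1..<m} =
        finprod (Q m) (\<lambda>k. br k (m - k) (u k) (w (m - k)) \<otimes>\<^bsub>Q m\<^esub> br k (m - k) (v k) (w (m - k))) {1..<m}"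
    proof (rule Qm.finprod_cong')
      fix k assume k: "k \<in> {1..<m}"
      then have "1 \<le> m - k" by auto
      with k show "br k (m - k) ((u \<otimes>\<^bsub>L\<^esub> v) k) (w (m - k)) =
          br k (m - k) (u k) (w (m - k)) \<otimes>\<^bsub>Q m\<^esub> br k (m - k) (v k) (w (m - k))"
        using br_left[of k "m - k" "u k" "v k" "w (m - k)"] graded_sum_component u v w
        by (simp add: mult_graded_sum)
    qed (use br_component_closed u v w in auto)
    also have "\<dots> = finprod (Q m) (\<lambda>k. br k (m - k) (u k) (w (m - k))) {1..<m} \<otimes>\<^bsub>Q m\<^esub>
        finprod (Q m) (\<lambda>k. br k (m - k) (v k) (w (m - k))) {1..<m}"
      using br_component_closed u v w by (intro Qm.finprod_multf) auto
    finally show "bracket L (u \<otimes>\<^bsub>L\<^esub> v) w m = (bracket L u w \<otimes>\<^bsub>L\<^esub> bracket L v w) m"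
      using m by (simp add: bracket_graded_sum mult_graded_sum[of "restrict _ _"])
  qed (use ext bc u v w in auto)
  show "bracket L u (v \<otimes>\<^bsub>L\<^esub> w) = bracket L u v \<otimes>\<^bsub>L\<^esub> bracket L u w"
  proof (rule graded_sum_eqI)
    fix m :: nat assume m: "1 \<le> m"
    interpret Qm: comm_group "Q m" using comm_Q m by blast
    have "finprod (Q m) (\<lambda>k. br k (m - k) (u k) ((v \<otimes>\<^bsub>L\<^esub> w) (m - k))) {1..<m} =
        finprod (Q m) (\<lambda>k. br k (m - k) (u k) (v (m - k)) \<otimes>\<^bsub>Q m\<^esub> br k (m - k) (u k) (w (m - k))) {1..<m}"
    proof (rule Qm.finprod_cong')
      fix k assume k: "k \<in> {1..<m}"
      then have "1 \<le> m - k" by auto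
      with k show "br k (m - k) (u k) ((v \<otimes>\<^bsub>L\<^esub> w) (m - k)) =
          br k (m - k) (u k) (v (m - k)) \<otimes>\<^bsub>Q m\<^esub> br k (m - k) (u k) (w (m - k))"
        using br_right[of k "m - k" "u k" "v (m - k)" "w (m - k)"] graded_sum_component u v w
        by (simp add: mult_graded_sum)
    qed (use br_component_closed u v w in auto)
    also have "\<dots> = finprod (Q m) (\<lambda>k. br k (m - k) (u k) (v (m - k))) {1..<m} \<otimes>\<^bsub>Q m\<^esub>
        finprod (Q m) (\<lambda>k. br k (m - k) (u k) (w (m - k))) {1..<m}"
      using br_component_closed u v w by (intro Qm.finprod_multf) auto
    finally show "bracket L u (v \<otimes>\<^bsub>L\<^esub> w) m = (bracket L u v \<otimes>\<^bsub>L\<^esub> bracket L u w) m"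
      using m by (simp add: bracket_graded_sum mult_graded_sum[of "restrict _ _"])
  qed (use ext bc u v w in auto)
  show "bracket L u u = \<one>\<^bsub>L\<^esub>"
  proof (rule graded_sum_eqI)
    fix m :: nat assume m: "1 \<le> m"
    interpret Qm: comm_group "Q m" using comm_Q m by blast
    have "finprod (Q m) (\<lambda>k. br k (m - k) (u k) (u (m - k))) {1..<m} = \<one>\<^bsub>Q m\<^esub>"
    proof (rule Qm.finprod_antisymmetric)
      fix k assume k: "k \<in> {1..<m}"
      show "br k (m - k) (u k) (u (m - k)) \<in> carrier (Q m)"
        using br_component_closed u k by blast
      show "br k (m - k) (u k) (u (m - k)) \<otimes>\<^bsub>Q m\<^esub> br (m - k) (m - (m - k)) (u (m - k)) (u (m - (m - k))) = \<one>\<^bsub>Q m\<^esub>"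
        using br_antisym[of k "m - k" "u k" "u (m - k)"] graded_sum_component u k by auto
      \<comment> \<open>The middle degree pairs a component of \<open>u\<close> with itself.\<close>
      show "br k (m - k) (u k) (u (m - k)) = \<one>\<^bsub>Q m\<^esub>" if "k = m - k"
        using br_self[of k "u k"] graded_sum_component[OF u, of k] k that
        by (metis atLeastLessThan_iff le_add_diff_inverse less_imp_le)
    qed
    then show "bracket L u u m = \<one>\<^bsub>L\<^esub> m" using m by (simp add: bracket_graded_sum one_graded_sum)
  qed (use ext bc u in auto)
  show "bracket L u (bracket L v w) \<otimes>\<^bsub>L\<^esub> bracket L v (bracket L w u) \<otimes>\<^bsub>L\<^esub> bracket L w (bracket L u v) = \<one>\<^bsub>L\<^esub>"
  proof (rule graded_sum_eqI)
    fix m :: nat assume m: "1 \<le> m"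
    interpret Qm: comm_group "Q m" using comm_Q m by blast
    define T where "T = (SIGMA k:{1..<m}. {1..<m - k})"
    define F where "F = (\<lambda>u v w (k, l). br k (m - k) (u k) (br l (m - k - l) (v l) (w (m - k - l))))"
    \<comment> \<open>The cyclic rotation of (k, l, c) to (l, c, k). Reindexing the second double
      bracket by \<open>\<rho>\<close> and the third by its square aligns the factors built from the
      same \<open>u k\<close>, \<open>v l\<close>, \<open>w c\<close>, so that
      \<open>br_jacobi\<close> applies factor by factor.\<close>
    define \<rho> where "\<rho> = (\<lambda>(k, l). (l, m - k - l))"
    have FT: "F u v w \<in> T \<rightarrow> carrier (Q m)"
      if "u \<in> carrier L" "v \<in> carrier L" "w \<in> carrier L" for u v w
    proof
      fix t assume "t \<in> T"
      then obtain k l where t: "t = (k, l)" "k \<in> {1..<m}" "l \<in> {1..<m - k}" by (auto simp: T_def)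
      then show "F u v w t \<in> carrier (Q m)"
        using br_closed[of k "m - k" "u k" "br l (m - k - l) (v l) (w (m - k - l))"]
          graded_sum_component[OF that(1), of k] br_component_closed[OF that(2,3) t(3)]
        by (auto simp: F_def)
    qed
    have \<rho>T: "\<rho> ` T = T"
    proof (intro equalityI subsetI)
      fix t assume "t \<in> T"
      then obtain k l where t: "t = (k, l)" "k \<in> {1..<m}" "l \<in> {1..<m - k}" by (auto simp: T_def)
      then have "t = \<rho> (m - k - l, k)" "(m - k - l, k) \<in> T" by (auto simp: \<rho>_def T_def)
      then show "t \<in> \<rho> ` T" by blast
    qed (auto simp: \<rho>_def T_def)
    have \<rho>inj: "inj_on \<rho> T" by (auto simp: \<rho>_def T_def inj_on_def)
    have rot: "finprod (Q m) (F u v w) T = finprod (Q m) (\<lambda>t. F u v w (\<rho> t)) T"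
      if "u \<in> carrier L" "v \<in> carrier L" "w \<in> carrier L" for u v w
      using Qm.finprod_reindex[of "F u v w" \<rho> T] FT[OF that] \<rho>inj by (simp add: \<rho>T)
    have F\<rho>: "(\<lambda>t. F u v w (\<rho> t)) \<in> T \<rightarrow> carrier (Q m)"
      if "u \<in> carrier L" "v \<in> carrier L" "w \<in> carrier L" for u v w
      using FT[OF that] \<rho>T by blast
    have F\<rho>\<rho>: "(\<lambda>t. F u v w (\<rho> (\<rho> t))) \<in> T \<rightarrow> carrier (Q m)"
      if "u \<in> carrier L" "v \<in> carrier L" "w \<in> carrier L" for u v w
      using FT[OF that] \<rho>T by blast
    have rot2: "finprod (Q m) (F u v w) T = finprod (Q m) (\<lambda>t. F u v w (\<rho> (\<rho> t))) T"
      if "u \<in> carrier L" "v \<in> carrier L" "w \<in> carrier L" for u v w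
      using Qm.finprod_reindex[of "\<lambda>t. F u v w (\<rho> t)" \<rho> T] F\<rho>[OF that] \<rho>inj rot[OF that] by (simp add: \<rho>T)
    have "finprod (Q m) (F u v w) T \<otimes>\<^bsub>Q m\<^esub> finprod (Q m) (F v w u) T \<otimes>\<^bsub>Q m\<^esub> finprod (Q m) (F w u v) T =
        finprod (Q m) (\<lambda>t. F u v w t \<otimes>\<^bsub>Q m\<^esub> F v w u (\<rho> t) \<otimes>\<^bsub>Q m\<^esub> F w u v (\<rho> (\<rho> t))) T"
      unfolding rot[OF v w u] rot2[OF w u v]
      using FT[OF u v w] F\<rho>[OF v w u] F\<rho>\<rho>[OF w u v] by (simp add: Qm.finprod_multf Pi_iff)
    also have "\<dots> = \<one>\<^bsub>Q m\<^esub>"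
    proof (rule Qm.finprod_one_eqI)
      fix t assume "t \<in> T"
      then obtain k l where t: "t = (k, l)" "k \<in> {1..<m}" "l \<in> {1..<m - k}" by (auto simp: T_def)
      obtain c where c: "m = k + l + c" "1 \<le> c" 
        using t by (intro that[of "m - k - l"]) auto
      show "F u v w t \<otimes>\<^bsub>Q m\<^esub> F v w u (\<rho> t) \<otimes>\<^bsub>Q m\<^esub> F w u v (\<rho> (\<rho> t)) = \<one>\<^bsub>Q m\<^esub>"
        using br_jacobi[of k l c "u k" "v l" "w c"] t c graded_sum_component u v w
        by (simp add: F_def \<rho>_def add.commute add.left_commute)
    qed
    finally have "finprod (Q m) (F u v w) T \<otimes>\<^bsub>Q m\<^esub> finprod (Q m) (F v w u) T \<otimes>\<^bsub>Q m\<^esub> finprod (Q m) (F w u v) T = \<one>\<^bsub>Q m\<^esub>" .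
    then show "(bracket L u (bracket L v w) \<otimes>\<^bsub>L\<^esub> bracket L v (bracket L w u) \<otimes>\<^bsub>L\<^esub> bracket L w (bracket L u v)) m = \<one>\<^bsub>L\<^esub> m"
      using m u v w by (simp add: mult_graded_sum one_graded_sum nested_bracket_component F_def T_def)
  qed (use ext bc u v w in auto)
qed

end

section \<open>The Lie ring of a central series\<close>

text \<open>A strongly central filtration, or N-series. \<open>F 1\<close> may be a proper subgroup
  of the ambient group, so for every subgroup considered later, cosets and commutators are formed in
  the full automorphism group.\<close>

locale central_series = group +
  fixes F :: "nat \<Rightarrow> 'a set"
  assumes subgroup_F: "1 \<le> m \<Longrightarrow> subgroup (F m) G"
    and F_Suc_subset: "1 \<le> m \<Longrightarrow> F (Suc m) \<subseteq> F m"
    and commutator_F: "\<lbrakk>1 \<le> k; 1 \<le> l; x \<in> F k; y \<in> F l\<rbrakk> \<Longrightarrow> commutator G x y \<in> F (k + l)"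
begin

definition layer :: "nat \<Rightarrow> 'a set monoid" where
  "layer m = G\<lparr>carrier := F m\<rparr> Mod F (m + 1)"

definition coset_bracket :: "nat \<Rightarrow> nat \<Rightarrow> 'a set \<Rightarrow> 'a set \<Rightarrow> 'a set" where
  "coset_bracket k l X Y = (\<Union>x\<in>X. \<Union>y\<in>Y. F (k + l + 1) #> commutator G x y)"

abbreviation cls :: "nat \<Rightarrow> 'a \<Rightarrow> 'a set" where
  "cls m x \<equiv> F (Suc m) #> x"

lemma F_carrier: "\<lbrakk>1 \<le> m; x \<in> F m\<rbrakk> \<Longrightarrow> x \<in> carrier G"
  using subgroup.mem_carrier[OF subgroup_F] .

lemma F_antimono:
  assumes "1 \<le> i" "i \<le> j"
  shows "F j \<subseteq> F i"
  using assms(2,1)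
proof (induction j rule: dec_induct)
  case (step j)
  then show ?case using F_Suc_subset[of j] by auto
qed simp

lemma F_weaken: "\<lbrakk>x \<in> F j; 1 \<le> i; i \<le> j\<rbrakk> \<Longrightarrow> x \<in> F i"
  using F_antimono by blast

lemma F_mult: "\<lbrakk>1 \<le> m; x \<in> F m; y \<in> F m\<rbrakk> \<Longrightarrow> x \<otimes> y \<in> F m"
  using subgroup.m_closed[OF subgroup_F] .

lemma F_inv: "\<lbrakk>1 \<le> m; x \<in> F m\<rbrakk> \<Longrightarrow> inv x \<in> F m"
  using subgroup.m_inv_closed[OF subgroup_F] .

text \<open>The conjugate of \<open>h\<close> by \<open>x\<close> is [x, h] h, and [x, h] has degree
  2m + 1, beyond m + 1.\<close>

lemma normal_layer:
  assumes "1 \<le> m"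
  shows "F (Suc m) \<lhd> G\<lparr>carrier := F m\<rparr>"
proof -
  interpret H: group "G\<lparr>carrier := F m\<rparr>"
    using subgroup.subgroup_is_group[OF subgroup_F[OF assms] is_group] .
  show ?thesis
    unfolding H.normal_inv_iff
  proof (intro conjI ballI)
    show "subgroup (F (Suc m)) (G\<lparr>carrier := F m\<rparr>)"
      using subgroup_incl[OF subgroup_F subgroup_F F_Suc_subset] assms by simp
    fix x h assume x: "x \<in> carrier (G\<lparr>carrier := F m\<rparr>)" and h: "h \<in> F (Suc m)"
    have G: "x \<in> carrier G" "h \<in> carrier G" using x h F_carrier assms by auto
    have "commutator G x h \<in> F (m + Suc m)" using commutator_F[of m "Suc m" x h] x h assms by simp
    then have "commutator G x h \<in> F (Suc m)" by (rule F_weaken) auto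
    then have "commutator G x h \<otimes> h \<in> F (Suc m)" using h F_mult by simp
    moreover have "commutator G x h \<otimes> h = x \<otimes> h \<otimes> inv x" using G by (simp add: word_simps)
    ultimately show "x \<otimes>\<^bsub>G\<lparr>carrier := F m\<rparr>\<^esub> h \<otimes>\<^bsub>G\<lparr>carrier := F m\<rparr>\<^esub> inv\<^bsub>G\<lparr>carrier := F m\<rparr>\<^esub> x \<in> F (Suc m)"
      using x m_inv_consistent[OF subgroup_F[OF assms]] by simp
  qed
qed

lemma group_layer: "1 \<le> m \<Longrightarrow> group (layer m)"
  using normal.factorgroup_is_group[OF normal_layer] by (simp add: layer_def)

lemma carrier_layer: "carrier (layer m) = cls m ` F m"
  by (simp add: layer_def carrier_FactGroup)

lemma cls_carrier [intro]: "x \<in> F m \<Longrightarrow> cls m x \<in> carrier (layer m)"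
  by (simp add: carrier_layer)

lemma cls_mult: "\<lbrakk>1 \<le> m; x \<in> F m; y \<in> F m\<rbrakk> \<Longrightarrow> cls m x \<otimes>\<^bsub>layer m\<^esub> cls m y = cls m (x \<otimes> y)"
  using normal.rcos_sum[OF normal_layer, of m x y] by (simp add: layer_def)

lemma cls_eq_one_iff: "\<lbrakk>1 \<le> m; x \<in> F m\<rbrakk> \<Longrightarrow> cls m x = \<one>\<^bsub>layer m\<^esub> \<longleftrightarrow> x \<in> F (Suc m)"
  using normal.coset_eq_one_iff[OF normal_layer, of m x] by (simp add: layer_def)

lemma cls_inv: "\<lbrakk>1 \<le> m; x \<in> F m\<rbrakk> \<Longrightarrow> inv\<^bsub>layer m\<^esub> cls m x = cls m (inv x)"
  using group.inv_equality[OF group_layer, of m "cls m (inv x)" "cls m x"]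
    cls_mult[of m "inv x" x] cls_eq_one_iff[of m \<one>] F_carrier[of m x] F_inv[of m x]
    subgroup.one_closed[OF subgroup_F, of m] subgroup.one_closed[OF subgroup_F, of "Suc m"]
  by auto

text \<open>A commutator of two elements of degree m has degree 2m, which is at least m + 1 because
  degrees start at 1.\<close>

lemma comm_group_layer:
  assumes "1 \<le> m"
  shows "comm_group (layer m)"
proof (rule group.group_comm_groupI[OF group_layer[OF assms]])
  fix X Y assume "X \<in> carrier (layer m)" "Y \<in> carrier (layer m)"
  then obtain x y where xy: "X = cls m x" "x \<in> F m" "Y = cls m y" "y \<in> F m"
    by (auto simp: carrier_layer)
  have G: "x \<in> carrier G" "y \<in> carrier G" using xy F_carrier assms by blast+
  have c: "commutator G x y \<in> F (m + m)" using commutator_F xy assms by simp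
  have "cls m (commutator G x y) = \<one>\<^bsub>layer m\<^esub>"
    using cls_eq_one_iff[of m "commutator G x y"] F_weaken[OF c, of m] F_weaken[OF c, of "Suc m"] assms by auto
  moreover have "cls m (x \<otimes> y) = cls m (commutator G x y) \<otimes>\<^bsub>layer m\<^esub> cls m (y \<otimes> x)"
    using cls_mult[of m "commutator G x y" "y \<otimes> x"] F_weaken[OF c, of m] F_mult xy assms
      mult_eq_commutator_mult[OF G] by simp
  ultimately have "cls m (x \<otimes> y) = cls m (y \<otimes> x)"
    using monoid.l_one[OF group.is_monoid[OF group_layer[OF assms]] cls_carrier[OF F_mult[OF assms xy(4,2)]]] by simp
  then show "X \<otimes>\<^bsub>layer m\<^esub> Y = Y \<otimes>\<^bsub>layer m\<^esub> X"
    using xy assms by (simp add: cls_mult)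
qed

text \<open>The correction [x, [x', y]] in the expansion has degree 2k + l and so is trivial in
  layer k + l; the order of the two remaining factors does not matter in an abelian layer.\<close>

lemma cls_commutator_mult_left:
  assumes "1 \<le> k" "1 \<le> l" "x \<in> F k" "x' \<in> F k" "y \<in> F l"
  shows "cls (k + l) (commutator G (x \<otimes> x') y) =
    cls (k + l) (commutator G x y) \<otimes>\<^bsub>layer (k + l)\<^esub> cls (k + l) (commutator G x' y)"
proof -
  interpret Q: comm_group "layer (k + l)" using comm_group_layer assms by simp
  have kl: "1 \<le> k + l" using assms by simp
  have c: "commutator G x y \<in> F (k + l)" "commutator G x' y \<in> F (k + l)"
    using commutator_F assms by auto
  have "commutator G x (commutator G x' y) \<in> F (k + (k + l))"
    using commutator_F[OF assms(1) kl assms(3) c(2)] .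
  then have d: "commutator G x (commutator G x' y) \<in> F (Suc (k + l))"
    by (rule F_weaken) (use assms in auto)
  then have "cls (k + l) (commutator G x (commutator G x' y)) = \<one>\<^bsub>layer (k + l)\<^esub>"
    using cls_eq_one_iff[OF kl] F_weaken[OF d, of "k + l"] kl by auto
  then show ?thesis
    using commutator_mult_left[of x x' y] F_carrier assms c d F_weaken[OF d, of "k + l"] kl
      F_mult[OF kl] Q.m_comm[OF cls_carrier[OF c(1)] cls_carrier[OF c(2)]]
    by (simp add: cls_mult[symmetric] cls_carrier)
qed

text \<open>Carries statements about the left argument over to the right one.\<close>

lemma cls_commutator_swap:
  assumes "1 \<le> k" "1 \<le> l" "x \<in> F k" "y \<in> F l"
  shows "cls (k + l) (commutator G x y) = inv\<^bsub>layer (k + l)\<^esub> cls (k + l) (commutator G y x)"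
  using cls_inv[of "k + l" "commutator G y x"] commutator_F[of l k y x] assms
    inv_commutator[of y x] F_carrier by (auto simp: add.commute)

lemma cls_commutator_mult_right:
  assumes "1 \<le> k" "1 \<le> l" "x \<in> F k" "y \<in> F l" "y' \<in> F l"
  shows "cls (k + l) (commutator G x (y \<otimes> y')) =
    cls (k + l) (commutator G x y) \<otimes>\<^bsub>layer (k + l)\<^esub> cls (k + l) (commutator G x y')"
proof -
  interpret Q: comm_group "layer (k + l)" using comm_group_layer assms by simp
  have c: "commutator G y x \<in> F (k + l)" "commutator G y' x \<in> F (k + l)"
    using commutator_F[of l k] assms by (auto simp: add.commute)
  have "cls (k + l) (commutator G (y \<otimes> y') x) =
    cls (k + l) (commutator G y x) \<otimes>\<^bsub>layer (k + l)\<^esub> cls (k + l) (commutator G y' x)"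
    using cls_commutator_mult_left[of l k y y' x] assms by (simp add: add.commute)
  then show ?thesis
    using cls_commutator_swap[of k l x] F_mult assms c by (simp add: Q.inv_mult cls_carrier)
qed

lemma cls_commutator_cong_left:
  assumes "1 \<le> k" "1 \<le> l" "a \<in> F (Suc k)" "x \<in> F k" "y \<in> F l"
  shows "cls (k + l) (commutator G (a \<otimes> x) y) = cls (k + l) (commutator G x y)"
proof -
  interpret Q: comm_group "layer (k + l)" using comm_group_layer assms by simp
  have c: "commutator G a y \<in> F (Suc (k + l))" using commutator_F[of "Suc k" l a y] assms by simp
  then have "cls (k + l) (commutator G a y) = \<one>\<^bsub>layer (k + l)\<^esub>"
    using cls_eq_one_iff[of "k + l"] F_weaken[OF c, of "k + l"] assms by auto
  then show ?thesis
    using cls_commutator_mult_left[of k l a x y] F_weaken[OF assms(3), of k] assms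
      cls_carrier[OF commutator_F[of k l x y]] by simp
qed

lemma cls_commutator_cong_right:
  assumes "1 \<le> k" "1 \<le> l" "b \<in> F (Suc l)" "x \<in> F k" "y \<in> F l"
  shows "cls (k + l) (commutator G x (b \<otimes> y)) = cls (k + l) (commutator G x y)"
proof -
  have "b \<otimes> y \<in> F l" using F_weaken[OF assms(3)] F_mult assms by auto
  then show ?thesis
    using cls_commutator_swap[of k l x] cls_commutator_cong_left[of l k b y x] assms
    by (simp add: add.commute)
qed

text \<open>Other representatives differ by left factors one step deeper, which the two congruence
  lemmas remove. The union defining the bracket therefore runs over equal, and at least one, cosets
  and is that coset.\<close>

lemma coset_bracket_cls:
  assumes "1 \<le> k" "1 \<le> l" "x \<in> F k" "y \<in> F l"
  shows "coset_bracket k l (cls k x) (cls l y) = cls (k + l) (commutator G x y)"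
proof -
  have "cls (k + l) (commutator G x' y') = cls (k + l) (commutator G x y)"
    if "x' \<in> cls k x" "y' \<in> cls l y" for x' y'
  proof -
    obtain a b where ab: "a \<in> F (Suc k)" "x' = a \<otimes> x" "b \<in> F (Suc l)" "y' = b \<otimes> y"
      using \<open>x' \<in> cls k x\<close> \<open>y' \<in> cls l y\<close> by (auto simp: r_coset_def)
    have "y' \<in> F l" using F_weaken[OF ab(3)] F_mult assms ab by auto
    then show ?thesis
      using ab assms cls_commutator_cong_left[of k l a x y'] cls_commutator_cong_right[of k l b x y] by simp
  qed
  then have "coset_bracket k l (cls k x) (cls l y) =
      (\<Union>x'\<in>cls k x. \<Union>y'\<in>cls l y. cls (k + l) (commutator G x y))"
    unfolding coset_bracket_def by simp
  moreover have "x \<in> cls k x" "y \<in> cls l y"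
    using rcos_self[OF _ subgroup_F] F_carrier assms by auto
  ultimately show ?thesis by auto
qed

sublocale graded_bracket layer coset_bracket
proof (rule graded_bracket.intro)
  fix k l m :: nat and X X' Y Y' Z :: "'a set"
  show "comm_group (layer m)" if "1 \<le> m" using that by (rule comm_group_layer)
  show "coset_bracket k l X Y \<in> carrier (layer (k + l))"
    if "1 \<le> k" "1 \<le> l" "X \<in> carrier (layer k)" "Y \<in> carrier (layer l)"
    using that
    by (auto simp: carrier_layer[of k] carrier_layer[of l] coset_bracket_cls intro!: cls_carrier commutator_F)
  show "coset_bracket k l (X \<otimes>\<^bsub>layer k\<^esub> X') Y =
      coset_bracket k l X Y \<otimes>\<^bsub>layer (k + l)\<^esub> coset_bracket k l X' Y"
    if "1 \<le> k" "1 \<le> l" "X \<in> carrier (layer k)" "X' \<in> carrier (layer k)" "Y \<in> carrier (layer l)"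
    using that F_mult by (auto simp: carrier_layer cls_mult coset_bracket_cls cls_commutator_mult_left)
  show "coset_bracket k l X (Y \<otimes>\<^bsub>layer l\<^esub> Y') =
      coset_bracket k l X Y \<otimes>\<^bsub>layer (k + l)\<^esub> coset_bracket k l X Y'"
    if "1 \<le> k" "1 \<le> l" "X \<in> carrier (layer k)" "Y \<in> carrier (layer l)" "Y' \<in> carrier (layer l)"
    using that F_mult by (auto simp: carrier_layer cls_mult coset_bracket_cls cls_commutator_mult_right)
  show "coset_bracket k k X X = \<one>\<^bsub>layer (k + k)\<^esub>" if "1 \<le> k" "X \<in> carrier (layer k)"
    using that F_carrier[of k] subgroup.one_closed[OF subgroup_F] cls_eq_one_iff[of "k + k" \<one>]
    by (clarsimp simp: carrier_layer[of k] coset_bracket_cls commutator_self)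
  show "coset_bracket k l X Y \<otimes>\<^bsub>layer (k + l)\<^esub> coset_bracket l k Y X = \<one>\<^bsub>layer (k + l)\<^esub>"
    if kl: "1 \<le> k" "1 \<le> l" and XY: "X \<in> carrier (layer k)" "Y \<in> carrier (layer l)"
  proof -
    interpret Q: comm_group "layer (k + l)" using comm_group_layer kl by simp
    obtain x y where xy: "X = cls k x" "x \<in> F k" "Y = cls l y" "y \<in> F l"
      using XY by (auto simp: carrier_layer)
    then show ?thesis
      using kl cls_commutator_swap[of k l x y] cls_carrier[OF commutator_F[of l k y x]]
      by (simp add: coset_bracket_cls add.commute[of l k])
  qed
  show "coset_bracket k (l + m) X (coset_bracket l m Y Z) \<otimes>\<^bsub>layer (k + l + m)\<^esub>
        coset_bracket l (m + k) Y (coset_bracket m k Z X) \<otimes>\<^bsub>layer (k + l + m)\<^esub>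
        coset_bracket m (k + l) Z (coset_bracket k l X Y) = \<one>\<^bsub>layer (k + l + m)\<^esub>"
    if klm: "1 \<le> k" "1 \<le> l" "1 \<le> m" and
      XYZ: "X \<in> carrier (layer k)" "Y \<in> carrier (layer l)" "Z \<in> carrier (layer m)"
  proof -
    let ?M = "k + l + m"
    interpret Q: comm_group "layer ?M" using comm_group_layer klm by simp
    obtain x y z where xyz: "X = cls k x" "x \<in> F k" "Y = cls l y" "y \<in> F l" "Z = cls m z" "z \<in> F m"
      using XYZ by (auto simp: carrier_layer)
    have G: "x \<in> carrier G" "y \<in> carrier G" "z \<in> carrier G" using xyz F_carrier klm by blast+
    have c: "commutator G x y \<in> F (k + l)" "commutator G y z \<in> F (l + m)" "commutator G z x \<in> F (m + k)"
      using commutator_F klm xyz by auto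
    \<comment> \<open>Each commutator is deeper than the element it multiplies in
      \<open>hall_witt\<close>, so \<open>commutator G y z \<otimes> z\<close> represents the same
      coset as \<open>z\<close>, and likewise for the others.\<close>
    have c': "commutator G x y \<in> F (Suc l)" "commutator G y z \<in> F (Suc m)" "commutator G z x \<in> F (Suc k)"
      using F_weaken[OF c(1), of "Suc l"] F_weaken[OF c(2), of "Suc m"] F_weaken[OF c(3), of "Suc k"] klm by auto
    have m: "commutator G x y \<otimes> y \<in> F l" "commutator G y z \<otimes> z \<in> F m" "commutator G z x \<otimes> x \<in> F k"
      using F_mult F_weaken[OF c'(1), of l] F_weaken[OF c'(2), of m] F_weaken[OF c'(3), of k] klm xyz by auto
    have e: "commutator G (commutator G x y) z \<in> F ?M" "commutator G (commutator G y z) x \<in> F ?M"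
      "commutator G (commutator G z x) y \<in> F ?M"
      using commutator_F[of "k + l" m, OF _ _ c(1)] commutator_F[of "l + m" k, OF _ _ c(2)]
        commutator_F[of "m + k" l, OF _ _ c(3)] klm xyz by (auto simp: ac_simps)
    have e': "commutator G (commutator G x y) (commutator G y z \<otimes> z) \<in> F ?M"
      "commutator G (commutator G y z) (commutator G z x \<otimes> x) \<in> F ?M"
      "commutator G (commutator G z x) (commutator G x y \<otimes> y) \<in> F ?M"
      using commutator_F[of "k + l" m, OF _ _ c(1) m(2)] commutator_F[of "l + m" k, OF _ _ c(2) m(3)]
        commutator_F[of "m + k" l, OF _ _ c(3) m(1)] klm by (auto simp: ac_simps)
    have f: "cls ?M (commutator G (commutator G x y) (commutator G y z \<otimes> z)) = cls ?M (commutator G (commutator G x y) z)"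
      "cls ?M (commutator G (commutator G y z) (commutator G z x \<otimes> x)) = cls ?M (commutator G (commutator G y z) x)"
      "cls ?M (commutator G (commutator G z x) (commutator G x y \<otimes> y)) = cls ?M (commutator G (commutator G z x) y)"
      using cls_commutator_cong_right[of "k + l" m _ _ z, OF _ _ c'(2) c(1)]
        cls_commutator_cong_right[of "l + m" k _ _ x, OF _ _ c'(3) c(2)]
        cls_commutator_cong_right[of "m + k" l _ _ y, OF _ _ c'(1) c(3)] klm xyz
      by (simp_all add: ac_simps)
    have "cls ?M (commutator G (commutator G x y) z) \<otimes>\<^bsub>layer ?M\<^esub> cls ?M (commutator G (commutator G y z) x)
        \<otimes>\<^bsub>layer ?M\<^esub> cls ?M (commutator G (commutator G z x) y) = cls ?M \<one>"
      using klm e' F_mult[of ?M] hall_witt[OF G] by (simp add: cls_mult flip: f)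
    also have "\<dots> = \<one>\<^bsub>layer ?M\<^esub>"
      using cls_eq_one_iff[of ?M \<one>] subgroup.one_closed[OF subgroup_F] klm by simp
    finally have hw: "cls ?M (commutator G (commutator G x y) z) \<otimes>\<^bsub>layer ?M\<^esub> cls ?M (commutator G (commutator G y z) x)
        \<otimes>\<^bsub>layer ?M\<^esub> cls ?M (commutator G (commutator G z x) y) = \<one>\<^bsub>layer ?M\<^esub>" .
    \<comment> \<open>Hall-Witt speaks of left-nested commutators, the Jacobi identity of
      right-nested ones; the swap costs an inverse in each of the three factors.\<close>
    have s: "cls ?M (commutator G x (commutator G y z)) = inv\<^bsub>layer ?M\<^esub> cls ?M (commutator G (commutator G y z) x)"
      "cls ?M (commutator G y (commutator G z x)) = inv\<^bsub>layer ?M\<^esub> cls ?M (commutator G (commutator G z x) y)"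
      "cls ?M (commutator G z (commutator G x y)) = inv\<^bsub>layer ?M\<^esub> cls ?M (commutator G (commutator G x y) z)"
      using cls_commutator_swap[of k "l + m", OF _ _ xyz(2) c(2)] cls_commutator_swap[of l "m + k", OF _ _ xyz(4) c(3)]
        cls_commutator_swap[of m "k + l", OF _ _ xyz(6) c(1)] klm by (simp_all add: ac_simps)
    have "coset_bracket k (l + m) X (coset_bracket l m Y Z) = cls ?M (commutator G x (commutator G y z))"
      "coset_bracket l (m + k) Y (coset_bracket m k Z X) = cls ?M (commutator G y (commutator G z x))"
      "coset_bracket m (k + l) Z (coset_bracket k l X Y) = cls ?M (commutator G z (commutator G x y))"
      using klm xyz c by (simp_all add: coset_bracket_cls ac_simps)
    then show ?thesis
      using hw e[THEN cls_carrier] by (simp add: s Q.inv_mult[symmetric] Q.m_ac)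
  qed
qed

end

text \<open>The shift by one in \<open>johnson_filt\<close> makes degrees add: automorphisms trivial
  modulo \<Gamma>^(k+1) and \<Gamma>^(l+1) have a commutator trivial modulo
  \<Gamma>^(k+l+1).\<close>

lemma central_series_johnson:
  assumes "subgroup G (AutF n)"
  shows "central_series (AutF n) (johnson_filt n G)"
proof -
  interpret F: group "FX n" by (rule group_free_group)
  interpret A: group "AutF n" by (rule F.AutoGroup)
  interpret S: subgroup G "AutF n" by fact
  show ?thesis
  proof (intro central_series.intro central_series_axioms.intro A.is_group)
    show "subgroup (johnson_filt n G m) (AutF n)" for m
      unfolding johnson_filt_def J_Aut_eq_lcs_kernel
      by (rule subgroup_Int[OF assms F.subgroup_lcs_kernel])
    show "johnson_filt n G (Suc m) \<subseteq> johnson_filt n G m" for m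
      using F.lcs_kernel_antimono[of "m + 1" "Suc m + 1"]
      by (auto simp: johnson_filt_def J_Aut_eq_lcs_kernel)
    show "commutator (AutF n) x y \<in> johnson_filt n G (k + l)"
      if "x \<in> johnson_filt n G k" "y \<in> johnson_filt n G l" for k l x y
    proof -
      have "commutator (AutF n) x y \<in> G"
        using that unfolding commutator_def johnson_filt_def
        by (intro S.m_closed S.m_inv_closed) auto
      then show ?thesis
        using that F.commutator_lcs_kernel[of x k y l]
        by (auto simp: johnson_filt_def J_Aut_eq_lcs_kernel)
    qed
  qed
qed

lemma gr_J_eq_graded_sum: "gr_J n G = graded_sum (johnson_quot n G) (johnson_coset_bracket n G)"
  by (simp add: gr_J_def graded_sum_def)

lemma graded_bracket_johnson:
  assumes "subgroup G (AutF n)"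
  shows "graded_bracket (johnson_quot n G) (johnson_coset_bracket n G)"
proof -
  interpret J: central_series "AutF n" "johnson_filt n G" by (rule central_series_johnson[OF assms])
  have "J.layer = johnson_quot n G"
    by (intro ext) (simp only: J.layer_def johnson_quot_def)
  moreover have "J.coset_bracket = johnson_coset_bracket n G"
    by (intro ext) (simp only: J.coset_bracket_def johnson_coset_bracket_def)
  ultimately show ?thesis using J.graded_bracket_axioms by simp
qed

lemma (in group) conj_solve:
  "\<lbrakk>x = inv g \<otimes> y \<otimes> g; g \<in> carrier G; y \<in> carrier G\<rbrakk> \<Longrightarrow> y = inv (inv g) \<otimes> x \<otimes> inv g"
  by (simp add: word_simps)

section \<open>Free groups\<close>

lemma carrier_free_group: "w \<in> carrier (free_group X) \<longleftrightarrow> reduced w \<and> fst ` set w \<subseteq> X"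
  by (simp add: free_group_def)

lemma mult_free_group [simp]: "u \<otimes>\<^bsub>free_group X\<^esub> v = foldr push_letter u v"
  by (simp add: free_group_def)

lemma one_free_group [simp]: "\<one>\<^bsub>free_group X\<^esub> = []"
  by (simp add: free_group_def)

text \<open>Formal inversion of a list, free of any reference to the generating set; on reduced
  words it is the group inverse by \<open>inv_free_group\<close>.\<close>

definition winv :: "'a word \<Rightarrow> 'a word" where
  "winv w = map inv_letter (rev w)"

lemma winv_simps [simp]:
  "winv [] = []" "winv (a # w) = winv w @ [inv_letter a]" "winv (u @ v) = winv v @ winv u"
  "winv (winv w) = w" "winv w = [] \<longleftrightarrow> w = []" "fst ` set (winv w) = fst ` set w"
  by (auto simp: winv_def rev_map comp_def image_image)

lemma last_winv: "w \<noteq> [] \<Longrightarrow> last (winv w) = inv_letter (hd w)"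
  by (simp add: winv_def last_map last_rev)

lemma hd_winv: "w \<noteq> [] \<Longrightarrow> hd (winv w) = inv_letter (last w)"
  by (simp add: winv_def hd_map hd_rev)

lemma reduced_append:
  "reduced (u @ v) \<longleftrightarrow> reduced u \<and> reduced v \<and> (u = [] \<or> v = [] \<or> hd v \<noteq> inv_letter (last u))"
  by (auto simp: reduced_def successively_append_iff)

lemma reduced_winv: "reduced w \<Longrightarrow> reduced (winv w)"
  by (induction w) (auto simp: reduced_append reduced_Cons last_winv inv_letter_eq_iff)

lemma foldr_push_letter_append: "reduced (u @ v) \<Longrightarrow> foldr push_letter u v = u @ v"
  by (induction u) (auto simp: reduced_Cons push_letter_def hd_append split: if_splits)

lemma foldr_push_letter_winv:
  assumes "reduced w"
  shows "foldr push_letter (winv u) (foldr push_letter u w) = w"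
    "foldr push_letter u (foldr push_letter (winv u) w) = w"
  using foldr_push_letter_inverse[OF assms, of u] foldr_push_letter_inverse[OF assms, of "winv u"]
  by (simp_all flip: winv_def)

lemma length_foldr_push_letter: "length (foldr push_letter u v) \<le> length u + length v"
  by (induction u) (auto simp: push_letter_def intro: le_SucI)

lemma inv_free_group:
  assumes "w \<in> carrier (free_group X)"
  shows "inv\<^bsub>free_group X\<^esub> w = winv w"
proof (rule group.inv_equality[OF group_free_group])
  show "winv w \<otimes>\<^bsub>free_group X\<^esub> w = \<one>\<^bsub>free_group X\<^esub>"
    using foldr_push_letter_winv[of "[]" w] assms
    by (simp add: carrier_free_group foldr_push_letter_Nil)
qed (use assms in \<open>auto simp: carrier_free_group reduced_winv\<close>)

lemma letter_in_free_group: "[a] \<in> carrier (free_group X) \<longleftrightarrow> fst a \<in> X"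
  by (simp add: carrier_free_group reduced_Cons)

lemma free_gen_in_free_group: "free_gen x \<in> carrier (free_group X) \<longleftrightarrow> x \<in> X"
  by (simp add: free_gen_def letter_in_free_group)

lemma letter_eq_free_gen:
  assumes "fst a \<in> X"
  shows "[a] = (if snd a then free_gen (fst a) else inv\<^bsub>free_group X\<^esub> free_gen (fst a))"
proof -
  have "inv\<^bsub>free_group X\<^esub> free_gen (fst a) = winv (free_gen (fst a))"
    using assms by (intro inv_free_group) (simp add: free_gen_in_free_group)
  then show ?thesis by (cases a) (auto simp: free_gen_def inv_letter_def)
qed

lemma Cons_in_free_group:
  "a # w \<in> carrier (free_group X) \<Longrightarrow>
    fst a \<in> X \<and> w \<in> carrier (free_group X) \<and> a # w = [a] \<otimes>\<^bsub>free_group X\<^esub> w"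
  by (auto simp: carrier_free_group reduced_Cons push_letter_def)

lemma hom_free_group_apply:
  assumes "group G" and h: "h \<in> hom (free_group X) G" and "w \<in> carrier (free_group X)"
  shows "h w = foldr (\<lambda>a g. (if snd a then h (free_gen (fst a)) else inv\<^bsub>G\<^esub> h (free_gen (fst a))) \<otimes>\<^bsub>G\<^esub> g) w \<one>\<^bsub>G\<^esub>"
  using assms(3)
proof (induction w)
  case Nil
  then show ?case using hom_one[OF h group_free_group assms(1)] by simp
next
  case (Cons a w)
  interpret h: group_hom "free_group X" G h
    using assms by (simp add: group_hom_def group_hom_axioms_def group_free_group)
  have a: "fst a \<in> X" "w \<in> carrier (free_group X)" "a # w = [a] \<otimes>\<^bsub>free_group X\<^esub> w"
    using Cons_in_free_group[OF Cons.prems] by auto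
  have "h [a] = (if snd a then h (free_gen (fst a)) else inv\<^bsub>G\<^esub> h (free_gen (fst a)))"
    using letter_eq_free_gen[OF a(1)] a(1) by (auto simp: free_gen_in_free_group)
  moreover have "h (a # w) = h [a] \<otimes>\<^bsub>G\<^esub> h w"
    using h.hom_mult[of "[a]" w] a by (metis letter_in_free_group)
  ultimately show ?case using a(2) Cons.IH by simp
qed

lemma hom_free_group_eqI:
  assumes "group G" "h \<in> hom (free_group X) G" "k \<in> hom (free_group X) G"
    "\<And>x. x \<in> X \<Longrightarrow> h (free_gen x) = k (free_gen x)" "w \<in> carrier (free_group X)"
  shows "h w = k w"
proof -
  have "fst a \<in> X" if "a \<in> set w" for a
    using assms(5) that by (auto simp: carrier_free_group)
  then show ?thesis
    using hom_free_group_apply[OF assms(1,2,5)] hom_free_group_apply[OF assms(1,3,5)] assms(4)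
    by (auto intro!: foldr_cong)
qed

context
  fixes X :: "'a set" and G :: "('g, 'b) monoid_scheme" (structure) and f
  assumes G: "group G" and f: "\<And>x. x \<in> X \<Longrightarrow> f x \<in> carrier G"
begin

interpretation group G by (rule G)

text \<open>Evaluating a word in \<open>G\<close> does not see the cancellation performed by
  \<open>push_letter\<close>, since a letter and its inverse evaluate to inverse elements;
  multiplicativity follows letter by letter.\<close>

lemma free_lift_hom: "free_lift X G f \<in> hom (free_group X) G"
proof -
  let ?l = "\<lambda>a. if snd a then f (fst a) else inv f (fst a)"
  let ?v = "\<lambda>w. foldr (\<lambda>a g. ?l a \<otimes> g) w \<one>"
  have l: "?l a \<in> carrier G" if "fst a \<in> X" for a using f that by auto
  have v: "?v w \<in> carrier G" if "fst ` set w \<subseteq> X" for w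
    using that by (induction w) (use l in auto)
  have push: "?v (push_letter a w) = ?l a \<otimes> ?v w" if "fst a \<in> X" "fst ` set w \<subseteq> X" for a w
  proof (cases "w \<noteq> [] \<and> hd w = inv_letter a")
    case True
    then obtain w' where w': "w = inv_letter a # w'" by (cases w) auto
    then have "?l a \<otimes> ?v w = ?v w'"
      using that f[of "fst a"] v[of w'] by (auto simp: inv_letter_def mult_inv_cancel_left)
    then show ?thesis by (simp add: push_letter_def w')
  qed (auto simp: push_letter_def)
  have mult: "?v (foldr push_letter u w) = ?v u \<otimes> ?v w"
    if "fst ` set u \<subseteq> X" "fst ` set w \<subseteq> X" for u w
    using that(1)
  proof (induction u)
    case Nil
    then show ?case using v[OF that(2)] by simp
  next
    case (Cons a u)
    have "fst ` set (foldr push_letter u w) \<subseteq> X"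
      using set_foldr_push_letter[of u w] Cons.prems that(2) by fastforce
    then have "?v (foldr push_letter (a # u) w) = ?l a \<otimes> ?v (foldr push_letter u w)"
      using push Cons.prems by simp
    also have "\<dots> = ?l a \<otimes> (?v u \<otimes> ?v w)" using Cons by simp
    also have "\<dots> = ?v (a # u) \<otimes> ?v w"
      using l[of a] v[of u] v[OF that(2)] Cons.prems by (simp add: m_assoc del: if_split_asm)
    finally show ?case .
  qed
  show ?thesis
  proof (rule homI)
    fix u w assume u: "u \<in> carrier (free_group X)" and w: "w \<in> carrier (free_group X)"
    have "u \<otimes>\<^bsub>free_group X\<^esub> w \<in> carrier (free_group X)"
      using monoid.m_closed[OF group.is_monoid[OF group_free_group] u w] .
    then show "free_lift X G f (u \<otimes>\<^bsub>free_group X\<^esub> w) = free_lift X G f u \<otimes> free_lift X G f w"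
      using mult[of u w] u w carrier_free_group[of u X] carrier_free_group[of w X]
      by (simp add: free_lift_def)
  qed (use v in \<open>auto simp: free_lift_def carrier_free_group\<close>)
qed

lemma free_lift_free_gen: "x \<in> X \<Longrightarrow> free_lift X G f (free_gen x) = f x"
  using f by (simp add: free_lift_def free_gen_in_free_group) (simp add: free_gen_def)

end

section \<open>Basis-conjugating automorphisms\<close>

subsection \<open>Elementary conjugations\<close>

text \<open>Conjugation by a signed letter puts the \<chi>'s and their inverses into one family, so
  that the reduction below need not distinguish signs.\<close>

definition elem_conj :: "nat \<Rightarrow> nat \<Rightarrow> nat letter \<Rightarrow> nat word \<Rightarrow> nat word" where
  "elem_conj n j a = free_lift {1..n} (FX n)
     (\<lambda>k. if k = j then inv\<^bsub>FX n\<^esub> [a] \<otimes>\<^bsub>FX n\<^esub> free_gen j \<otimes>\<^bsub>FX n\<^esub> [a] else free_gen k)"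

lemma chi_eq_elem_conj: "chi n i j = elem_conj n i (j, True)"
  unfolding chi_def elem_conj_def free_gen_def ..

locale free_group_of_rank =
  fixes n :: nat
begin

abbreviation "Fn \<equiv> FX n"
abbreviation "An \<equiv> AutF n"
abbreviation "I \<equiv> {1..n}"

sublocale F: group Fn by (rule group_free_group)
sublocale A: group An by (rule F.AutoGroup)

declare mult_free_group [simp del] one_free_group [simp del] One_nat_def [simp del]

lemma gen_closed: "i \<in> I \<Longrightarrow> free_gen i \<in> carrier Fn"
  by (simp add: free_gen_in_free_group)

lemma letter_closed: "fst a \<in> I \<Longrightarrow> [a] \<in> carrier Fn"
  by (simp add: letter_in_free_group)

lemma letter_eq: "fst a \<in> I \<Longrightarrow> [a] = (if snd a then free_gen (fst a) else inv\<^bsub>Fn\<^esub> free_gen (fst a))"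
  by (rule letter_eq_free_gen)

lemma inv_letter_eq: "fst a \<in> I \<Longrightarrow> [inv_letter a] = inv\<^bsub>Fn\<^esub> [a]"
  using inv_free_group[OF letter_closed, of a] by simp

lemma auto_hom: "\<phi> \<in> auto Fn \<Longrightarrow> \<phi> \<in> hom Fn Fn"
  by (simp add: auto_def)

lemma hom_eqI:
  "\<lbrakk>h \<in> hom Fn Fn; k \<in> hom Fn Fn; \<And>i. i \<in> I \<Longrightarrow> h (free_gen i) = k (free_gen i); w \<in> carrier Fn\<rbrakk> \<Longrightarrow> h w = k w"
  by (rule hom_free_group_eqI[OF group_free_group])

lemma auto_gen_eqI:
  assumes "\<phi> \<in> auto Fn" "\<psi> \<in> auto Fn" "\<And>i. i \<in> I \<Longrightarrow> \<phi> (free_gen i) = \<psi> (free_gen i)"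
  shows "\<phi> = \<psi>"
  by (rule auto_eqI[OF assms(1,2)], rule hom_eqI) (use assms auto_hom in auto)

context
  fixes j :: nat and a :: "nat letter" assumes j: "j \<in> I" and a: "fst a \<in> I"
begin

lemma elem_conj_hom: "elem_conj n j a \<in> hom Fn Fn"
  unfolding elem_conj_def
  by (rule free_lift_hom[OF group_free_group])
    (use j gen_closed letter_closed[OF a] in \<open>auto intro!: F.m_closed F.inv_closed\<close>)

lemma elem_conj_gen:
  "i \<in> I \<Longrightarrow> elem_conj n j a (free_gen i) =
    (if i = j then inv\<^bsub>Fn\<^esub> [a] \<otimes>\<^bsub>Fn\<^esub> free_gen j \<otimes>\<^bsub>Fn\<^esub> [a] else free_gen i)"
  unfolding elem_conj_def
  by (rule free_lift_free_gen[OF group_free_group])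
    (use j gen_closed letter_closed[OF a] in \<open>auto intro!: F.m_closed F.inv_closed\<close>)

lemma elem_conj_letter:
  assumes "fst b \<in> I" "fst b \<noteq> j"
  shows "elem_conj n j a [b] = [b]"
proof -
  interpret h: group_hom Fn Fn "elem_conj n j a"
    using elem_conj_hom by (simp add: group_hom_def group_hom_axioms_def F.is_group)
  show ?thesis
    using assms gen_closed[OF assms(1)] by (simp add: letter_eq elem_conj_gen)
qed

end

lemma elem_conj_inverse:
  assumes "j \<in> I" "fst a \<in> I" "fst a \<noteq> j" "w \<in> carrier Fn"
  shows "elem_conj n j a (elem_conj n j (inv_letter a) w) = w"
proof -
  have a': "fst (inv_letter a) \<in> I" using assms by simp
  note h = elem_conj_hom[OF assms(1,2)] elem_conj_hom[OF assms(1) a']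
  interpret h: group_hom Fn Fn "elem_conj n j a"
    using h by (simp add: group_hom_def group_hom_axioms_def F.is_group)
  have "(elem_conj n j a \<circ> elem_conj n j (inv_letter a)) w = id w"
  proof (rule hom_eqI[of "elem_conj n j a \<circ> elem_conj n j (inv_letter a)" id])
    show "elem_conj n j a \<circ> elem_conj n j (inv_letter a) \<in> hom Fn Fn"
      using h by (rule hom_compose[rotated])
    show "id \<in> hom Fn Fn" by (auto simp: hom_def)
    fix i assume i: "i \<in> I"
    show "(elem_conj n j a \<circ> elem_conj n j (inv_letter a)) (free_gen i) = id (free_gen i)"
    proof (cases "i = j")
      case True
      then show ?thesis
        using elem_conj_gen[OF assms(1) a' i] elem_conj_gen[OF assms(1,2) i]
          elem_conj_letter[OF assms(1,2,2,3)] gen_closed[OF i] letter_closed[OF assms(2)]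
        by (simp add: inv_letter_eq[OF assms(2)] F.word_simps)
    next
      case False
      then show ?thesis
        using elem_conj_gen[OF assms(1) a' i] elem_conj_gen[OF assms(1,2) i] by simp
    qed
  qed (rule assms)
  then show ?thesis by simp
qed

lemma elem_conj_auto:
  assumes "j \<in> I" "fst a \<in> I" "fst a \<noteq> j"
  shows "elem_conj n j a \<in> auto Fn"
proof -
  have h: "elem_conj n j b \<in> carrier Fn \<rightarrow> carrier Fn" if "fst b \<in> I" for b
    using elem_conj_hom[OF assms(1) that] by (simp add: hom_def)
  have "bij_betw (elem_conj n j a) (carrier Fn) (carrier Fn)"
    by (rule bij_betw_byWitness[where f' = "elem_conj n j (inv_letter a)"])
      (use elem_conj_inverse[of j a] elem_conj_inverse[of j "inv_letter a"]
        h[of a] h[of "inv_letter a"] assms in auto)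
  moreover have "elem_conj n j a \<in> extensional (carrier Fn)"
    by (simp add: elem_conj_def free_lift_def)
  ultimately show ?thesis
    using elem_conj_hom assms by (simp add: auto_def Bij_def)
qed

lemma elem_conj_inv:
  assumes "j \<in> I" "fst a \<in> I" "fst a \<noteq> j"
  shows "inv\<^bsub>An\<^esub> elem_conj n j a = elem_conj n j (inv_letter a)"
proof (rule A.inv_equality)
  have 1: "elem_conj n j a \<in> auto Fn" "elem_conj n j (inv_letter a) \<in> auto Fn"
    using elem_conj_auto assms by simp_all
  then show "elem_conj n j a \<in> carrier An" "elem_conj n j (inv_letter a) \<in> carrier An" by simp_all
  show "elem_conj n j (inv_letter a) \<otimes>\<^bsub>An\<^esub> elem_conj n j a = \<one>\<^bsub>An\<^esub>"
  proof (rule auto_eqI[of _ Fn])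
    show "elem_conj n j (inv_letter a) \<otimes>\<^bsub>An\<^esub> elem_conj n j a \<in> auto Fn" "\<one>\<^bsub>An\<^esub> \<in> auto Fn"
      using A.m_closed A.one_closed 1 by simp_all
    fix w assume w: "w \<in> carrier Fn"
    then show "(elem_conj n j (inv_letter a) \<otimes>\<^bsub>An\<^esub> elem_conj n j a) w = \<one>\<^bsub>An\<^esub> w"
      using 1 elem_conj_inverse[of j "inv_letter a" w] assms
      by (simp add: mult_AutoGroup_apply one_AutoGroup)
  qed
qed

subsection \<open>The group of basis-conjugating automorphisms\<close>

abbreviation "P \<equiv> carrier (PSigma n)"

lemma P_iff:
  "\<phi> \<in> P \<longleftrightarrow> \<phi> \<in> auto Fn \<and> (\<forall>i\<in>I. \<exists>g\<in>carrier Fn. \<phi> (free_gen i) = inv\<^bsub>Fn\<^esub> g \<otimes>\<^bsub>Fn\<^esub> free_gen i \<otimes>\<^bsub>Fn\<^esub> g)"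
  by (simp add: PSigma_def)

lemma P_auto: "\<phi> \<in> P \<Longrightarrow> \<phi> \<in> auto Fn" by (simp add: P_iff)

lemma P_conjE:
  assumes "\<phi> \<in> P" "i \<in> I"
  obtains g where "g \<in> carrier Fn" "\<phi> (free_gen i) = inv\<^bsub>Fn\<^esub> g \<otimes>\<^bsub>Fn\<^esub> free_gen i \<otimes>\<^bsub>Fn\<^esub> g"
  using assms unfolding P_iff by blast

lemma PSigma_eq: "PSigma n = An\<lparr>carrier := P\<rparr>"
  by (simp add: PSigma_def)

text \<open>If \<phi> conjugates x_i by g and \<psi> conjugates it by h, then \<phi>\<psi>
  conjugates it by g \<phi>(h). For the inverse, the inverse automorphism is applied to the equation
  for \<phi> x_i, which is then solved.\<close>

lemma subgroup_P: "subgroup P An"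
proof (rule A.subgroupI)
  show "P \<subseteq> carrier An" by (auto simp: P_iff)
  have "\<one>\<^bsub>An\<^esub> \<in> P"
    unfolding P_iff
  proof (intro conjI ballI)
    show "\<one>\<^bsub>An\<^esub> \<in> auto Fn" using A.one_closed by simp
    fix i assume "i \<in> I"
    then have "\<one>\<^bsub>An\<^esub> (free_gen i) = inv\<^bsub>Fn\<^esub> \<one>\<^bsub>Fn\<^esub> \<otimes>\<^bsub>Fn\<^esub> free_gen i \<otimes>\<^bsub>Fn\<^esub> \<one>\<^bsub>Fn\<^esub>"
      using gen_closed by (simp add: one_AutoGroup)
    then show "\<exists>g\<in>carrier Fn. \<one>\<^bsub>An\<^esub> (free_gen i) = inv\<^bsub>Fn\<^esub> g \<otimes>\<^bsub>Fn\<^esub> free_gen i \<otimes>\<^bsub>Fn\<^esub> g"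
      by blast
  qed
  then show "P \<noteq> {}" by blast
next
  fix \<phi> assume "\<phi> \<in> P"
  then have \<phi>: "\<phi> \<in> auto Fn" "\<And>i. i \<in> I \<Longrightarrow> \<exists>g\<in>carrier Fn. \<phi> (free_gen i) = inv\<^bsub>Fn\<^esub> g \<otimes>\<^bsub>Fn\<^esub> free_gen i \<otimes>\<^bsub>Fn\<^esub> g"
    by (auto simp: P_iff)
  let ?\<psi> = "inv\<^bsub>An\<^esub> \<phi>"
  have \<psi>: "?\<psi> \<in> auto Fn" using A.inv_closed \<phi> by simp
  interpret \<psi>: group_hom Fn Fn ?\<psi> using F.auto_group_hom[OF \<psi>] .
  show "?\<psi> \<in> P"
    unfolding P_iff
  proof (intro conjI ballI \<psi>)
    fix i assume i: "i \<in> I"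
    obtain g where g: "g \<in> carrier Fn" "\<phi> (free_gen i) = inv\<^bsub>Fn\<^esub> g \<otimes>\<^bsub>Fn\<^esub> free_gen i \<otimes>\<^bsub>Fn\<^esub> g"
      using \<phi>(2)[OF i] by blast
    have "free_gen i = ?\<psi> (\<phi> (free_gen i))"
      using F.inv_AutoGroup_apply(1)[OF \<phi>(1) gen_closed[OF i]] by simp
    also have "\<dots> = inv\<^bsub>Fn\<^esub> ?\<psi> g \<otimes>\<^bsub>Fn\<^esub> ?\<psi> (free_gen i) \<otimes>\<^bsub>Fn\<^esub> ?\<psi> g"
      using g gen_closed[OF i] by simp
    finally have "free_gen i = inv\<^bsub>Fn\<^esub> ?\<psi> g \<otimes>\<^bsub>Fn\<^esub> ?\<psi> (free_gen i) \<otimes>\<^bsub>Fn\<^esub> ?\<psi> g" .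
    then have "?\<psi> (free_gen i) = inv\<^bsub>Fn\<^esub> (inv\<^bsub>Fn\<^esub> ?\<psi> g) \<otimes>\<^bsub>Fn\<^esub> free_gen i \<otimes>\<^bsub>Fn\<^esub> inv\<^bsub>Fn\<^esub> ?\<psi> g"
      using g gen_closed[OF i] by (intro F.conj_solve) auto
    then show "\<exists>g\<in>carrier Fn. ?\<psi> (free_gen i) = inv\<^bsub>Fn\<^esub> g \<otimes>\<^bsub>Fn\<^esub> free_gen i \<otimes>\<^bsub>Fn\<^esub> g"
      using g by (intro bexI[of _ "inv\<^bsub>Fn\<^esub> ?\<psi> g"]) auto
  qed
next
  fix \<phi> \<psi> assume P: "\<phi> \<in> P" "\<psi> \<in> P"
  then have a: "\<phi> \<in> auto Fn" "\<psi> \<in> auto Fn" by (auto simp: P_iff)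
  interpret \<phi>: group_hom Fn Fn \<phi> using F.auto_group_hom[OF a(1)] .
  show "\<phi> \<otimes>\<^bsub>An\<^esub> \<psi> \<in> P"
    unfolding P_iff
  proof (intro conjI ballI)
    show "\<phi> \<otimes>\<^bsub>An\<^esub> \<psi> \<in> auto Fn" using A.m_closed a by simp
    fix i assume i: "i \<in> I"
    obtain g where g: "g \<in> carrier Fn" "\<phi> (free_gen i) = inv\<^bsub>Fn\<^esub> g \<otimes>\<^bsub>Fn\<^esub> free_gen i \<otimes>\<^bsub>Fn\<^esub> g"
      using P_conjE[OF P(1) i] .
    obtain h where h: "h \<in> carrier Fn" "\<psi> (free_gen i) = inv\<^bsub>Fn\<^esub> h \<otimes>\<^bsub>Fn\<^esub> free_gen i \<otimes>\<^bsub>Fn\<^esub> h"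
      using P_conjE[OF P(2) i] .
    have "(\<phi> \<otimes>\<^bsub>An\<^esub> \<psi>) (free_gen i) = inv\<^bsub>Fn\<^esub> (g \<otimes>\<^bsub>Fn\<^esub> \<phi> h) \<otimes>\<^bsub>Fn\<^esub> free_gen i \<otimes>\<^bsub>Fn\<^esub> (g \<otimes>\<^bsub>Fn\<^esub> \<phi> h)"
      using g h gen_closed[OF i] a by (simp add: mult_AutoGroup_apply F.word_simps)
    then show "\<exists>g\<in>carrier Fn. (\<phi> \<otimes>\<^bsub>An\<^esub> \<psi>) (free_gen i) = inv\<^bsub>Fn\<^esub> g \<otimes>\<^bsub>Fn\<^esub> free_gen i \<otimes>\<^bsub>Fn\<^esub> g"
      using g h by (intro bexI[of _ "g \<otimes>\<^bsub>Fn\<^esub> \<phi> h"]) auto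
  qed
qed

lemma group_PSigma: "group (PSigma n)"
  by (subst PSigma_eq) (rule subgroup.subgroup_is_group[OF subgroup_P A.is_group])

lemma mult_PSigma [simp]: "x \<otimes>\<^bsub>PSigma n\<^esub> y = x \<otimes>\<^bsub>An\<^esub> y"
  by (simp add: PSigma_def)

lemma one_PSigma [simp]: "\<one>\<^bsub>PSigma n\<^esub> = \<one>\<^bsub>An\<^esub>"
  by (simp add: PSigma_def)

lemma inv_PSigma: "x \<in> P \<Longrightarrow> inv\<^bsub>PSigma n\<^esub> x = inv\<^bsub>An\<^esub> x"
  by (subst PSigma_eq) (rule A.m_inv_consistent[OF subgroup_P])

lemma elem_conj_P:
  assumes "j \<in> I" "fst a \<in> I" "fst a \<noteq> j"
  shows "elem_conj n j a \<in> P"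
  unfolding P_iff
proof (intro conjI ballI elem_conj_auto[OF assms])
  fix i assume i: "i \<in> I"
  show "\<exists>g\<in>carrier Fn. elem_conj n j a (free_gen i) = inv\<^bsub>Fn\<^esub> g \<otimes>\<^bsub>Fn\<^esub> free_gen i \<otimes>\<^bsub>Fn\<^esub> g"
  proof (cases "i = j")
    case True
    then show ?thesis
      using elem_conj_gen[OF assms(1,2) i] letter_closed[OF assms(2)] by auto
  next
    case False
    then have "elem_conj n j a (free_gen i) = inv\<^bsub>Fn\<^esub> \<one>\<^bsub>Fn\<^esub> \<otimes>\<^bsub>Fn\<^esub> free_gen i \<otimes>\<^bsub>Fn\<^esub> \<one>\<^bsub>Fn\<^esub>"
      using elem_conj_gen assms i gen_closed by simp
    then show ?thesis by blast
  qed
qed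

lemma chi_P: "\<lbrakk>i \<in> I; j \<in> I; i \<noteq> j\<rbrakk> \<Longrightarrow> chi n i j \<in> P"
  using elem_conj_P[of i "(j, True)"] by (simp add: chi_eq_elem_conj)

end

subsection \<open>Generation by elementary conjugations\<close>

lemma common_suffix:
  obtains p q c where "u = p @ c" "v = q @ c" "p = [] \<or> q = [] \<or> last p \<noteq> last q"
proof -
  have "\<exists>p q c. u = p @ c \<and> v = q @ c \<and> (p = [] \<or> q = [] \<or> last p \<noteq> last q)"
  proof (induction u arbitrary: v rule: rev_induct)
    case (snoc x u)
    show ?case
    proof (cases v rule: rev_cases)
      case (snoc v' y)
      show ?thesis
      proof (cases "x = y")
        case True
        obtain p q c where "u = p @ c" "v' = q @ c" "p = [] \<or> q = [] \<or> last p \<noteq> last q"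
          using snoc.IH by blast
        then show ?thesis
          using True snoc by (intro exI[of _ p] exI[of _ q] exI[of _ "c @ [y]"]) auto
      next
        case False
        then show ?thesis
          using snoc by (intro exI[of _ "u @ [x]"] exI[of _ v] exI[of _ "[]"]) auto
      qed
    qed auto
  qed auto
  then show thesis using that by blast
qed

text \<open>
  No cancellation between conjugates \<open>w i\<inverse> x\<^sub>i w i\<close> reaches a middle letter, so the letter
  with which a word \<open>v\<close> begins can be read off from the product of conjugates that it spells.
\<close>

lemma conjugates_middle_letter:
  fixes w :: "'a \<Rightarrow> 'a word"
  assumes red: "\<And>i. i \<in> X \<Longrightarrow> reduced (w i)"
    and start: "\<And>i. i \<in> X \<Longrightarrow> w i = [] \<or> fst (hd (w i)) \<noteq> i"
    and absorb: "\<And>i j b u. \<lbrakk>i \<in> X; j \<in> X; fst b = i\<rbrakk> \<Longrightarrow> w j \<noteq> u @ b # w i"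
    and v: "reduced (a # v)" "fst ` set (a # v) \<subseteq> X"
  defines "y \<equiv> \<lambda>a. winv (w (fst a)) @ a # w (fst a)"
  shows "\<exists>t. reduced (winv (w (fst a)) @ a # t) \<and>
    foldr (\<lambda>a g. foldr push_letter (y a) g) (a # v) [] = winv (w (fst a)) @ a # t"
  using v
proof (induction v arbitrary: a)
  case Nil
  then have a: "fst a \<in> X" by simp
  have ne: "hd (w (fst a)) \<noteq> inv_letter a" "a \<noteq> hd (w (fst a))" if "w (fst a) \<noteq> []"
    using start[OF a] that by (metis fst_inv_letter, metis)
  then have "reduced (y a)"
    using red[OF a] by (auto simp: y_def reduced_append reduced_Cons reduced_winv last_winv)
  moreover have "foldr (\<lambda>a g. foldr push_letter (y a) g) [a] [] = foldr push_letter (y a) []" by simp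
  ultimately show ?case
    by (simp only: foldr_push_letter_Nil) (auto simp: y_def)
next
  case (Cons b v)
  let ?i = "fst a" and ?j = "fst b"
  have i: "?i \<in> X" and j: "?j \<in> X" using Cons.prems by auto
  have ab: "b \<noteq> inv_letter a" using Cons.prems by (simp add: reduced_Cons)
  obtain t where t: "reduced (winv (w ?j) @ b # t)"
    "foldr (\<lambda>a g. foldr push_letter (y a) g) (b # v) [] = winv (w ?j) @ b # t"
    using Cons.IH[of b] Cons.prems by (auto simp: reduced_Cons)
  obtain p q c where pqc: "w ?i = p @ c" "w ?j = q @ c" "p = [] \<or> q = [] \<or> last p \<noteq> last q"
    using common_suffix .
  \<comment> \<open>What is left of the tail once the common suffix \<open>c\<close> of the two
    conjugators has cancelled.\<close>
  define r where "r = winv q @ b # t"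
  have r: "reduced (winv c @ r)" using t(1) by (simp add: r_def pqc)
  have neb: "hd p \<noteq> inv_letter a" "a \<noteq> hd p" if "p \<noteq> []"
    using start[OF i] that by (auto simp: pqc hd_append)
  have red_left: "reduced (winv (w ?i) @ a # p)"
    using red[OF i] neb start[OF i]
    by (auto simp: reduced_append reduced_Cons reduced_winv last_winv pqc(1)[symmetric]) (auto simp: pqc reduced_append)
  \<comment> \<open>If \<open>p\<close> and \<open>q\<close> are both empty, the letters
    \<open>a\<close> and \<open>b\<close> meet and the word was reduced. If exactly one is empty,
    cancellation would make one conjugator end in a middle letter followed by the other, against
    \<open>absorb\<close>. If neither is empty, their last letters differ by the choice of
    \<open>c\<close>.\<close>
  have junction: "hd r \<noteq> inv_letter (last (a # p))"
  proof (cases "p = []")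
    case True
    show ?thesis
    proof (cases "q = []")
      case True
      then show ?thesis using \<open>p = []\<close> ab by (simp add: r_def)
    next
      case False
      have "last q \<noteq> a"
      proof
        assume "last q = a"
        then have "w ?j = butlast q @ a # w ?i"
          using pqc \<open>p = []\<close> False by (metis append.assoc append_Cons append_Nil append_butlast_last_id)
        then show False using absorb[OF i j refl] by blast
      qed
      then show ?thesis
        using \<open>p = []\<close> False by (auto simp: r_def hd_winv hd_append inv_letter_eq_iff)
    qed
  next
    case False
    show ?thesis
    proof (cases "q = []")
      case True
      have "last p \<noteq> inv_letter b"
      proof
        assume "last p = inv_letter b"
        then have "w ?i = butlast p @ inv_letter b # w ?j"
          using pqc True False by (metis append.assoc append_Cons append_Nil append_butlast_last_id)
        then show False using absorb[of ?j ?i "inv_letter b"] i j by simp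
      qed
      then show ?thesis using True False by (auto simp: r_def)
    next
      case False
      then show ?thesis
        using pqc(3) \<open>p \<noteq> []\<close> by (auto simp: r_def hd_winv hd_append inv_letter_eq_iff)
    qed
  qed
  have red_all: "reduced ((winv (w ?i) @ a # p) @ r)"
    by (subst reduced_append) (use red_left r junction in \<open>auto simp: reduced_append[of "winv c"]\<close>)
  have "foldr push_letter (w ?i) (winv c @ r) = foldr push_letter p r"
    using foldr_push_letter_append[OF r] foldr_push_letter_winv(2)[of r c] r
    by (simp add: pqc reduced_append)
  then have "foldr push_letter (y a) (winv (w ?j) @ b # t) = foldr push_letter (winv (w ?i) @ a # p) r"
    by (simp add: y_def pqc r_def)
  also have "\<dots> = winv (w ?i) @ a # (p @ r)"
    using foldr_push_letter_append[OF red_all] by simp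
  finally show ?case
    using t(2) red_all by (intro exI[of _ "p @ r"]) simp
qed

context free_group_of_rank
begin

lemma auto_apply_conjugates:
  assumes \<phi>: "\<phi> \<in> auto Fn"
    and w: "\<And>i. i \<in> I \<Longrightarrow> w i \<in> carrier Fn"
    and conj: "\<And>i. i \<in> I \<Longrightarrow> \<phi> (free_gen i) = inv\<^bsub>Fn\<^esub> w i \<otimes>\<^bsub>Fn\<^esub> free_gen i \<otimes>\<^bsub>Fn\<^esub> w i"
    and v: "v \<in> carrier Fn"
  shows "\<phi> v = foldr (\<lambda>a g. foldr push_letter (winv (w (fst a)) @ a # w (fst a)) g) v []"
proof -
  interpret \<phi>: group_hom Fn Fn \<phi> using F.auto_group_hom[OF \<phi>] .
  show ?thesis
    using v
  proof (induction v)
    case Nil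
    then show ?case using \<phi>.hom_one by (simp add: one_free_group)
  next
    case (Cons a v)
    have a: "fst a \<in> I" "v \<in> carrier Fn" "a # v = [a] \<otimes>\<^bsub>Fn\<^esub> v"
      using Cons_in_free_group[OF Cons.prems] by auto
    have "\<phi> [a] = inv\<^bsub>Fn\<^esub> w (fst a) \<otimes>\<^bsub>Fn\<^esub> [a] \<otimes>\<^bsub>Fn\<^esub> w (fst a)"
      using a(1) conj[OF a(1)] w[OF a(1)] gen_closed[OF a(1)]
      by (simp add: letter_eq F.word_simps)
    then have "\<phi> (a # v) = inv\<^bsub>Fn\<^esub> w (fst a) \<otimes>\<^bsub>Fn\<^esub> ([a] \<otimes>\<^bsub>Fn\<^esub> (w (fst a) \<otimes>\<^bsub>Fn\<^esub> \<phi> v))"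
      using a w[OF a(1)] letter_closed[OF a(1)] \<phi>.hom_closed[OF a(2)] by (simp add: F.m_assoc)
    then show ?case
      using Cons.IH[OF a(2)] w[OF a(1)] by (simp add: mult_free_group inv_free_group)
  qed
qed

abbreviation "chis \<equiv> {chi n i j |i j. i \<in> I \<and> j \<in> I \<and> i \<noteq> j}"

lemma elem_conj_in_generate:
  assumes "j \<in> I" "fst a \<in> I" "fst a \<noteq> j"
  shows "elem_conj n j a \<in> generate An chis"
proof (cases "snd a")
  case True
  then have "elem_conj n j a = chi n j (fst a)" by (cases a) (simp add: chi_eq_elem_conj)
  then show ?thesis using assms by (intro generate.incl) auto
next
  case False
  then have "elem_conj n j a = inv\<^bsub>An\<^esub> chi n j (fst a)"
    using elem_conj_inv[of j "(fst a, True)"] assms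
    by (cases a) (simp add: chi_eq_elem_conj inv_letter_def)
  then show ?thesis using assms by (auto intro!: generate.inv)
qed

lemma chis_P: "chis \<subseteq> P"
  using chi_P by auto

lemma generate_chis_P: "generate An chis \<subseteq> P"
  using A.generate_subgroup_incl[OF chis_P subgroup_P] .

text \<open>Induction on the total length of the conjugators. A conjugator of x_j starting with a
  power of x_j, or ending in a signed x_i followed by the conjugator of x_i, can be shortened. If
  neither happens, no middle letter ever cancels, and surjectivity of \<phi> forces all conjugators
  to be empty.\<close>

theorem in_generate_chis:
  assumes "\<phi> \<in> auto Fn"
    and "\<And>i. i \<in> I \<Longrightarrow> w i \<in> carrier Fn"
    and "\<And>i. i \<in> I \<Longrightarrow> \<phi> (free_gen i) = inv\<^bsub>Fn\<^esub> w i \<otimes>\<^bsub>Fn\<^esub> free_gen i \<otimes>\<^bsub>Fn\<^esub> w i"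
  shows "\<phi> \<in> generate An chis"
  using assms
proof (induction "\<Sum>i\<in>I. length (w i)" arbitrary: \<phi> w rule: less_induct)
  case less
  note \<phi> = less.prems(1) and w = less.prems(2) and conj = less.prems(3)
  interpret \<phi>: group_hom Fn Fn \<phi> using F.auto_group_hom[OF \<phi>] .
  have smaller: "(\<Sum>i\<in>I. length ((w(j := w')) i)) < (\<Sum>i\<in>I. length (w i))"
    if "j \<in> I" "length w' < length (w j)" for j w'
    using that by (intro sum_strict_mono_ex1) auto
  consider (start) j where "j \<in> I" "w j \<noteq> []" "fst (hd (w j)) = j"
    | (absorb) i j b u where "i \<in> I" "j \<in> I" "fst b = i" "w j = u @ b # w i"
    | (nielsen) "\<And>i. i \<in> I \<Longrightarrow> w i = [] \<or> fst (hd (w i)) \<noteq> i"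
        "\<And>i j b u. \<lbrakk>i \<in> I; j \<in> I; fst b = i\<rbrakk> \<Longrightarrow> w j \<noteq> u @ b # w i"
    by blast
  then show ?case
  proof cases
    case start
    then obtain b r where br: "w j = b # r" "fst b = j" by (cases "w j") auto
    then have b: "fst b \<in> I" "r \<in> carrier Fn" "w j = [b] \<otimes>\<^bsub>Fn\<^esub> r"
      using Cons_in_free_group[of b r I] w[OF start(1)] by auto
    \<comment> \<open>\<open>b\<close> is x_j or its inverse and commutes with x_j, so dropping it
      changes the conjugator but not \<phi>.\<close>
    have "inv\<^bsub>Fn\<^esub> [b] \<otimes>\<^bsub>Fn\<^esub> (free_gen j \<otimes>\<^bsub>Fn\<^esub> ([b] \<otimes>\<^bsub>Fn\<^esub> r)) = free_gen j \<otimes>\<^bsub>Fn\<^esub> r"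
      using letter_eq[OF b(1)] gen_closed[OF b(1)] br b(2) by (simp add: F.word_simps)
    then have "\<phi> (free_gen j) = inv\<^bsub>Fn\<^esub> r \<otimes>\<^bsub>Fn\<^esub> free_gen j \<otimes>\<^bsub>Fn\<^esub> r"
      using conj[OF start(1)] b letter_closed[OF b(1)] gen_closed[OF start(1)]
      by (simp add: F.m_assoc F.inv_mult_group)
    then show ?thesis
      using less.hyps[OF smaller[OF start(1), of r] \<phi>] br b w conj by auto
  next
    case absorb
    have ij: "i \<noteq> j" using absorb(4) by auto
    let ?c = "inv_letter b"
    have c: "fst ?c \<in> I" "fst ?c \<noteq> j" "fst b \<in> I" using absorb ij by auto
    let ?\<psi> = "elem_conj n j ?c"
    have \<psi>: "?\<psi> \<in> auto Fn" using elem_conj_auto[OF absorb(2) c(1,2)] .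
    \<comment> \<open>With w_j = u b w_i, composing \<phi> with the automorphism sending x_j to b
      x_j b^-1 multiplies \<phi> x_j by conjugates of b and yields the conjugator u w_i: the letter
      \<open>b\<close> is gone.\<close>
    define u' where "u' = foldr push_letter u (w i)"
    have wj: "reduced (u @ b # w i)" "fst ` set (u @ b # w i) \<subseteq> I"
      using w[OF absorb(2)] by (auto simp: carrier_free_group absorb(4))
    have u: "u \<in> carrier Fn" using wj by (auto simp: carrier_free_group reduced_append)
    have u': "u' = u \<otimes>\<^bsub>Fn\<^esub> w i" by (simp add: u'_def mult_free_group)
    have wi: "w i \<in> carrier Fn" using w absorb(1) .
    have "w j = foldr push_letter u (foldr push_letter [b] (w i))"
      using foldr_push_letter_append[of "u @ [b]" "w i"] wj absorb(4) by simp
    then have wj': "w j = u \<otimes>\<^bsub>Fn\<^esub> ([b] \<otimes>\<^bsub>Fn\<^esub> w i)" by (simp add: mult_free_group)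
    have \<phi>b: "\<phi> [b] = inv\<^bsub>Fn\<^esub> w i \<otimes>\<^bsub>Fn\<^esub> [b] \<otimes>\<^bsub>Fn\<^esub> w i"
      using absorb(3) c(3) conj[OF absorb(1)] wi gen_closed[OF absorb(1)]
      by (simp add: letter_eq F.word_simps)
    have "\<phi> \<otimes>\<^bsub>An\<^esub> ?\<psi> \<in> generate An chis"
    proof (rule less.hyps[OF smaller[OF absorb(2), of u']])
      show "length u' < length (w j)"
        using length_foldr_push_letter[of u "w i"] by (simp add: u'_def absorb(4))
      show "\<phi> \<otimes>\<^bsub>An\<^esub> ?\<psi> \<in> auto Fn" using A.m_closed \<phi> \<psi> by simp
      show "(w(j := u')) k \<in> carrier Fn" if "k \<in> I" for k
        using that w u u' wi by auto
      fix k assume k: "k \<in> I"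
      show "(\<phi> \<otimes>\<^bsub>An\<^esub> ?\<psi>) (free_gen k) = inv\<^bsub>Fn\<^esub> (w(j := u')) k \<otimes>\<^bsub>Fn\<^esub> free_gen k \<otimes>\<^bsub>Fn\<^esub> (w(j := u')) k"
      proof (cases "k = j")
        case True
        have "(\<phi> \<otimes>\<^bsub>An\<^esub> ?\<psi>) (free_gen j) = \<phi> ([b] \<otimes>\<^bsub>Fn\<^esub> free_gen j \<otimes>\<^bsub>Fn\<^esub> inv\<^bsub>Fn\<^esub> [b])"
          using elem_conj_gen[OF absorb(2) c(1) absorb(2)] \<phi> \<psi> gen_closed[OF absorb(2)] letter_closed[OF c(3)]
          by (simp add: mult_AutoGroup_apply inv_letter_eq[OF c(3)])
        also have "\<dots> = inv\<^bsub>Fn\<^esub> u' \<otimes>\<^bsub>Fn\<^esub> free_gen j \<otimes>\<^bsub>Fn\<^esub> u'"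
          using gen_closed[OF absorb(2)] letter_closed[OF c(3)] u wi
          by (simp add: \<phi>b conj[OF absorb(2)] wj' u' F.word_simps)
        finally show ?thesis using True by simp
      next
        case False
        then show ?thesis
          using elem_conj_gen[OF absorb(2) c(1) k] \<phi> \<psi> gen_closed[OF k] conj[OF k]
          by (simp add: mult_AutoGroup_apply)
      qed
    qed
    moreover have "inv\<^bsub>An\<^esub> ?\<psi> \<in> generate An chis"
      using elem_conj_in_generate[OF absorb(2), of b] elem_conj_inv[OF absorb(2) c(1,2)] absorb ij by simp
    ultimately have "(\<phi> \<otimes>\<^bsub>An\<^esub> ?\<psi>) \<otimes>\<^bsub>An\<^esub> inv\<^bsub>An\<^esub> ?\<psi> \<in> generate An chis"
      by (rule generate.eng)
    moreover have "(\<phi> \<otimes>\<^bsub>An\<^esub> ?\<psi>) \<otimes>\<^bsub>An\<^esub> inv\<^bsub>An\<^esub> ?\<psi> = \<phi>"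
      using A.inv_solve_right'[of \<phi> "\<phi> \<otimes>\<^bsub>An\<^esub> ?\<psi>" ?\<psi>] A.m_closed[of \<phi> ?\<psi>] \<phi> \<psi> by simp
    ultimately show ?thesis by simp
  next
    case nielsen
    \<comment> \<open>A preimage of x_k starting with \<open>a\<close> is sent to a word beginning
      with the inverse conjugator of \<open>a\<close>, then \<open>a\<close>. A one-letter word
      leaves room only for \<open>a\<close> itself, so \<open>a\<close> is x_k and its conjugator is
      empty.\<close>
    have "w k = []" if k: "k \<in> I" for k
    proof -
      obtain v where v: "v \<in> carrier Fn" "\<phi> v = free_gen k"
        using auto_surj[OF \<phi> gen_closed[OF k]] .
      have "v \<noteq> []"
        using v(2) \<phi>.hom_one by (auto simp: one_free_group free_gen_def)
      then obtain a v' where av: "v = a # v'" by (cases v) auto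
      have "reduced (a # v')" "fst ` set (a # v') \<subseteq> I"
        using v(1) by (auto simp: carrier_free_group av)
      moreover have "reduced (w i)" if "i \<in> I" for i
        using w[OF that] by (simp add: carrier_free_group)
      ultimately obtain t where
        "foldr (\<lambda>a g. foldr push_letter (winv (w (fst a)) @ a # w (fst a)) g) (a # v') [] =
          winv (w (fst a)) @ a # t"
        using conjugates_middle_letter[of I w a v', OF _ nielsen] by blast
      then have "\<phi> v = winv (w (fst a)) @ a # t"
        using auto_apply_conjugates[OF \<phi> w conj v(1)] by (simp only: av)
      then have "winv (w (fst a)) @ a # t = [(k, True)]"
        using v(2) by (simp add: free_gen_def)
      then show ?thesis by (auto simp: append_eq_Cons_conv)
    qed
    then have "\<phi> (free_gen i) = \<one>\<^bsub>An\<^esub> (free_gen i)" if "i \<in> I" for i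
      using conj[OF that] gen_closed[OF that] that by (simp add: one_AutoGroup flip: one_free_group[of I])
    then have "\<phi> = \<one>\<^bsub>An\<^esub>"
      using auto_gen_eqI[OF \<phi>, of "\<one>\<^bsub>An\<^esub>"] A.one_closed by simp
    then show ?thesis by (simp add: generate.one)
  qed
qed

corollary P_eq_generate: "P = generate An chis"
proof (intro equalityI generate_chis_P subsetI)
  fix \<phi> assume \<phi>: "\<phi> \<in> P"
  then have "\<forall>i\<in>I. \<exists>g. g \<in> carrier Fn \<and> \<phi> (free_gen i) = inv\<^bsub>Fn\<^esub> g \<otimes>\<^bsub>Fn\<^esub> free_gen i \<otimes>\<^bsub>Fn\<^esub> g"
    unfolding P_iff by blast
  then obtain w where "\<forall>i\<in>I. w i \<in> carrier Fn \<and> \<phi> (free_gen i) = inv\<^bsub>Fn\<^esub> w i \<otimes>\<^bsub>Fn\<^esub> free_gen i \<otimes>\<^bsub>Fn\<^esub> w i"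
    by (rule bchoice[THEN exE])
  then show "\<phi> \<in> generate An chis"
    using in_generate_chis[of \<phi> w] P_auto[OF \<phi>] by blast
qed

end

section \<open>The Heisenberg group as a detector\<close>

text \<open>Integral unitriangular 3 by 3 matrices: the first two coordinates are the entries above
  the diagonal, the third is the corner.\<close>

definition heisenberg :: "(int \<times> int \<times> int) monoid" where
  "heisenberg = \<lparr>carrier = UNIV,
     monoid.mult = (\<lambda>(a, b, c) (a', b', c'). (a + a', b + b', c + c' + a * b')), one = (0, 0, 0)\<rparr>"

lemma heisenberg_simps [simp]:
  "carrier heisenberg = UNIV" "\<one>\<^bsub>heisenberg\<^esub> = (0, 0, 0)"
  "(a, b, c) \<otimes>\<^bsub>heisenberg\<^esub> (a', b', c') = (a + a', b + b', c + c' + a * b')"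
  by (simp_all add: heisenberg_def)

lemma group_heisenberg: "group heisenberg"
proof (rule groupI)
  fix x :: "int \<times> int \<times> int"
  obtain a b c where "x = (a, b, c)" by (cases x)
  then have "(- a, - b, a * b - c) \<otimes>\<^bsub>heisenberg\<^esub> x = \<one>\<^bsub>heisenberg\<^esub>" by simp
  then show "\<exists>y\<in>carrier heisenberg. y \<otimes>\<^bsub>heisenberg\<^esub> x = \<one>\<^bsub>heisenberg\<^esub>"
    by (metis heisenberg_simps(1) UNIV_I)
qed (auto simp: algebra_simps split_paired_all)

lemma inv_heisenberg: "inv\<^bsub>heisenberg\<^esub> (a, b, c) = (- a, - b, a * b - c)"
  by (rule group.inv_equality[OF group_heisenberg]) auto

text \<open>A commutator has only a corner entry, the determinant of the first two coordinates of
  its arguments, and such elements are central.\<close>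

lemma lower_central_heisenberg:
  "lower_central heisenberg 2 \<subseteq> {(0, 0, c) |c. True}" "lower_central heisenberg 3 \<subseteq> {(0, 0, 0)}"
proof -
  interpret H: group heisenberg by (rule group_heisenberg)
  have comm: "commutator heisenberg (a, b, c) (a', b', c') = (0, 0, a * b' - a' * b)" for a b c a' b' c'
    by (simp add: commutator_def inv_heisenberg algebra_simps)
  have "subgroup {(0, 0, c) |c. True} heisenberg"
    by (rule H.subgroupI) (auto simp: inv_heisenberg)
  then show 2: "lower_central heisenberg 2 \<subseteq> {(0, 0, c) |c. True}"
    unfolding numeral_2_eq_2 lower_central.simps
    by (intro H.generate_subgroup_incl) (auto simp: comm)
  have "subgroup {(0, 0, 0)} heisenberg"
    by (rule H.subgroupI) (auto simp: inv_heisenberg)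
  then show "lower_central heisenberg 3 \<subseteq> {(0, 0, 0)}"
    unfolding numeral_3_eq_3 lower_central.simps(3)
    by (intro H.generate_subgroup_incl) (use 2 in \<open>auto simp: comm numeral_2_eq_2\<close>)
qed

lemma (in group_hom) hom_lower_central:
  "x \<in> lower_central G m \<Longrightarrow> h x \<in> lower_central H m"
proof (induction m arbitrary: x rule: nat_less_induct)
  case (1 m)
  consider "m = 0" | "m = Suc 0" | k where "m = Suc (Suc k)" by (metis not0_implies_Suc)
  then show ?case
  proof cases
    case (3 k)
    let ?C = "{commutator G x y |x y. x \<in> lower_central G (Suc k) \<and> y \<in> carrier G}"
    have C: "h c \<in> {commutator H x y |x y. x \<in> lower_central H (Suc k) \<and> y \<in> carrier H} \<and> c \<in> carrier G"
      if c: "c \<in> ?C" for c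
    proof -
      obtain u v where uv: "c = commutator G u v" "u \<in> lower_central G (Suc k)" "v \<in> carrier G"
        using c by blast
      then have "u \<in> carrier G" "h u \<in> lower_central H (Suc k)"
        using 1(1) 3 G.lower_central_carrier by auto
      then show ?thesis
        using uv hom_commutator[of u v] by (metis (mono_tags, lifting) CollectI G.commutator_closed hom_closed)
    qed
    have "x \<in> generate G ?C" using 1(2) by (simp add: 3)
    then have "x \<in> carrier G \<and> h x \<in> lower_central H m"
    proof (induction rule: generate.induct)
      case (inv c)
      then show ?case using C[OF inv] by (auto simp: 3 intro: generate.inv)
    next
      case (incl c)
      then show ?case using C[OF incl] by (auto simp: 3 intro: generate.incl)
    qed (auto simp: 3 intro: generate.one generate.eng)
    then show ?thesis ..
  qed (use 1(2) in auto)
qed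

section \<open>Exponent sums of conjugators as homomorphisms\<close>

context free_group_of_rank
begin

text \<open>Since g^-1 x g = [g^-1, x] x, generators move by elements of \<Gamma>^2, and the
  quotient map need only be compared on generators. This is the inclusion in IA_n; it makes the
  first Johnson step of a subgroup of \<open>P\<close> the whole subgroup.\<close>

lemma P_subset_lcs_kernel: "P \<subseteq> lcs_kernel Fn 2"
proof
  fix \<phi> assume \<phi>: "\<phi> \<in> P"
  define N where "N = lower_central Fn 2"
  interpret N: normal N Fn unfolding N_def by (rule F.normal_lower_central)
  interpret h: group_hom Fn "Fn Mod N" "\<lambda>x. N #>\<^bsub>Fn\<^esub> x" by (rule N.group_hom_Mod)
  interpret \<phi>: group_hom Fn Fn \<phi> using F.auto_group_hom[OF P_auto[OF \<phi>]] .
  show "\<phi> \<in> lcs_kernel Fn 2"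
  proof (rule F.lcs_kernelI[OF P_auto[OF \<phi>]])
    fix w assume w: "w \<in> carrier Fn"
    have "((\<lambda>x. N #>\<^bsub>Fn\<^esub> x) \<circ> \<phi>) w = N #>\<^bsub>Fn\<^esub> w"
    proof (rule hom_free_group_eqI[OF h.H.is_group _ h.homh _ w])
      show "(\<lambda>x. N #>\<^bsub>Fn\<^esub> x) \<circ> \<phi> \<in> hom Fn (Fn Mod N)"
        using \<phi>.homh h.homh by (rule hom_compose)
      fix i assume i: "i \<in> I"
      obtain g where g: "g \<in> carrier Fn" "\<phi> (free_gen i) = inv\<^bsub>Fn\<^esub> g \<otimes>\<^bsub>Fn\<^esub> free_gen i \<otimes>\<^bsub>Fn\<^esub> g"
        using P_conjE[OF \<phi> i] .
      have "\<phi> (free_gen i) = commutator Fn (inv\<^bsub>Fn\<^esub> g) (free_gen i) \<otimes>\<^bsub>Fn\<^esub> free_gen i"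
        using g gen_closed[OF i] by (simp add: F.word_simps)
      moreover have "commutator Fn (inv\<^bsub>Fn\<^esub> g) (free_gen i) \<in> N"
        unfolding N_def numeral_2_eq_2
        by (rule F.commutator_lower_central) (use g gen_closed[OF i] in auto)
      ultimately show "((\<lambda>x. N #>\<^bsub>Fn\<^esub> x) \<circ> \<phi>) (free_gen i) = N #>\<^bsub>Fn\<^esub> free_gen i"
        using N.coset_eq_iff[of "\<phi> (free_gen i)" "free_gen i"] gen_closed[OF i] g
        by (simp add: F.m_assoc)
    qed
    then show "lower_central Fn 2 #>\<^bsub>Fn\<^esub> \<phi> w = lower_central Fn 2 #>\<^bsub>Fn\<^esub> w" by (simp add: N_def)
  qed
qed

text \<open>
  \<open>conj_exponent i \<phi>\<close> is the exponent sum of \<open>x\<^sub>n\<close> in the element conjugating \<open>x\<^sub>i\<close> to \<open>\<phi> x\<^sub>i\<close>.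
\<close>

definition detect :: "nat \<Rightarrow> nat word \<Rightarrow> int \<times> int \<times> int" where
  "detect i = free_lift I heisenberg (\<lambda>k. if k = i then (1, 0, 0) else if k = n then (0, 1, 0) else (0, 0, 0))"

definition conj_exponent :: "nat \<Rightarrow> (nat word \<Rightarrow> nat word) \<Rightarrow> int" where
  "conj_exponent i \<phi> = snd (snd (detect i (\<phi> (free_gen i))))"

lemma detect_hom: "detect i \<in> hom Fn heisenberg"
  unfolding detect_def by (rule free_lift_hom[OF group_heisenberg]) simp

lemma detect_gen: "k \<in> I \<Longrightarrow> detect i (free_gen k) = (if k = i then (1, 0, 0) else if k = n then (0, 1, 0) else (0, 0, 0))"
  unfolding detect_def by (rule free_lift_free_gen[OF group_heisenberg]) auto

lemma detect_group_hom: "group_hom Fn heisenberg (detect i)"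
  using detect_hom by (simp add: group_hom_def group_hom_axioms_def F.is_group group_heisenberg)

text \<open>In the Heisenberg group the conjugate of (1, 0, 0) by (a, b, c) is (1, 0, b). In
  particular the value does not depend on which conjugator \<open>g\<close> is chosen.\<close>

lemma conj_exponent_eq:
  assumes "i \<in> I" "g \<in> carrier Fn" "\<phi> (free_gen i) = inv\<^bsub>Fn\<^esub> g \<otimes>\<^bsub>Fn\<^esub> free_gen i \<otimes>\<^bsub>Fn\<^esub> g"
  shows "conj_exponent i \<phi> = fst (snd (detect i g))"
proof -
  interpret d: group_hom Fn heisenberg "detect i" by (rule detect_group_hom)
  obtain a b c where "detect i g = (a, b, c)" by (cases "detect i g")
  then show ?thesis
    using assms gen_closed[OF assms(1)] detect_gen[OF assms(1), of i]
    by (simp add: conj_exponent_def inv_heisenberg algebra_simps)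
qed

lemma detect_snd_hom: "(\<lambda>w. fst (snd (detect i w))) \<in> hom Fn integer_group"
proof (rule homI)
  interpret d: group_hom Fn heisenberg "detect i" by (rule detect_group_hom)
  fix u v assume "u \<in> carrier Fn" "v \<in> carrier Fn"
  then show "fst (snd (detect i (u \<otimes>\<^bsub>Fn\<^esub> v))) =
      fst (snd (detect i u)) \<otimes>\<^bsub>integer_group\<^esub> fst (snd (detect i v))"
    by (cases "detect i u"; cases "detect i v") simp
qed simp

text \<open>The second coordinate is a homomorphism to an abelian group, where conjugating the
  generators is invisible.\<close>

lemma detect_snd_P:
  assumes \<phi>: "\<phi> \<in> P" and "w \<in> carrier Fn"
  shows "fst (snd (detect i (\<phi> w))) = fst (snd (detect i w))"
proof -
  let ?\<beta> = "\<lambda>w. fst (snd (detect i w))"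
  interpret \<beta>: group_hom Fn integer_group ?\<beta>
    using detect_snd_hom by (simp add: group_hom_def group_hom_axioms_def F.is_group)
  have "(?\<beta> \<circ> \<phi>) w = ?\<beta> w"
  proof (rule hom_free_group_eqI[OF group_integer_group _ detect_snd_hom _ assms(2)])
    show "?\<beta> \<circ> \<phi> \<in> hom Fn integer_group"
      using auto_hom[OF P_auto[OF \<phi>]] detect_snd_hom by (rule hom_compose)
    fix k assume k: "k \<in> I"
    obtain g where g: "g \<in> carrier Fn" "\<phi> (free_gen k) = inv\<^bsub>Fn\<^esub> g \<otimes>\<^bsub>Fn\<^esub> free_gen k \<otimes>\<^bsub>Fn\<^esub> g"
      using P_conjE[OF \<phi> k] .
    then show "(?\<beta> \<circ> \<phi>) (free_gen k) = ?\<beta> (free_gen k)"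
      using \<beta>.hom_mult[of "inv\<^bsub>Fn\<^esub> g \<otimes>\<^bsub>Fn\<^esub> free_gen k" g] \<beta>.hom_mult[of "inv\<^bsub>Fn\<^esub> g" "free_gen k"]
        \<beta>.hom_inv[of g] gen_closed[OF k] by simp
  qed
  then show ?thesis by simp
qed

text \<open>The conjugator of the product is g \<phi>(h), and by \<open>detect_snd_P\<close> the
  factor \<phi>(h) counts as much as h.\<close>

lemma conj_exponent_mult:
  assumes "\<phi> \<in> P" "\<psi> \<in> P" "i \<in> I"
  shows "conj_exponent i (\<phi> \<otimes>\<^bsub>An\<^esub> \<psi>) = conj_exponent i \<phi> + conj_exponent i \<psi>"
proof -
  interpret \<phi>: group_hom Fn Fn \<phi> using F.auto_group_hom[OF P_auto[OF assms(1)]] .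
  interpret \<beta>: group_hom Fn integer_group "\<lambda>w. fst (snd (detect i w))"
    using detect_snd_hom by (simp add: group_hom_def group_hom_axioms_def F.is_group)
  obtain g where g: "g \<in> carrier Fn" "\<phi> (free_gen i) = inv\<^bsub>Fn\<^esub> g \<otimes>\<^bsub>Fn\<^esub> free_gen i \<otimes>\<^bsub>Fn\<^esub> g"
    using P_conjE[OF assms(1,3)] .
  obtain h where h: "h \<in> carrier Fn" "\<psi> (free_gen i) = inv\<^bsub>Fn\<^esub> h \<otimes>\<^bsub>Fn\<^esub> free_gen i \<otimes>\<^bsub>Fn\<^esub> h"
    using P_conjE[OF assms(2,3)] .
  have "(\<phi> \<otimes>\<^bsub>An\<^esub> \<psi>) (free_gen i) = inv\<^bsub>Fn\<^esub> (g \<otimes>\<^bsub>Fn\<^esub> \<phi> h) \<otimes>\<^bsub>Fn\<^esub> free_gen i \<otimes>\<^bsub>Fn\<^esub> (g \<otimes>\<^bsub>Fn\<^esub> \<phi> h)"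
    using g h gen_closed[OF assms(3)] P_auto[OF assms(1)] P_auto[OF assms(2)]
    by (simp add: mult_AutoGroup_apply F.word_simps)
  then have "conj_exponent i (\<phi> \<otimes>\<^bsub>An\<^esub> \<psi>) = fst (snd (detect i (g \<otimes>\<^bsub>Fn\<^esub> \<phi> h)))"
    using conj_exponent_eq[OF assms(3), of "g \<otimes>\<^bsub>Fn\<^esub> \<phi> h"] g h by simp
  then show ?thesis
    using conj_exponent_eq[of i g \<phi>, OF assms(3) g] conj_exponent_eq[of i h \<psi>, OF assms(3) h]
      \<beta>.hom_mult[of g "\<phi> h"] detect_snd_P[OF assms(1) h(1)] g h by simp
qed

text \<open>Here \<phi> x_i = c x_i with \<open>c\<close> in \<Gamma>^3, which a group of class two
  cannot see, so the detected triple is that of x_i itself.\<close>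

lemma conj_exponent_eq_0:
  assumes \<phi>: "\<phi> \<in> lcs_kernel Fn 3" and i: "i \<in> I"
  shows "conj_exponent i \<phi> = 0"
proof -
  interpret d: group_hom Fn heisenberg "detect i" by (rule detect_group_hom)
  let ?c = "\<phi> (free_gen i) \<otimes>\<^bsub>Fn\<^esub> inv\<^bsub>Fn\<^esub> free_gen i"
  have "?c \<in> lower_central Fn 3" using \<phi> gen_closed[OF i] by (simp add: lcs_kernel_def)
  then have "detect i ?c = (0, 0, 0)" "?c \<in> carrier Fn"
    using d.hom_lower_central lower_central_heisenberg(2) F.lower_central_carrier by blast+
  moreover have "\<phi> (free_gen i) = ?c \<otimes>\<^bsub>Fn\<^esub> free_gen i"
    using auto_closed[OF F.lcs_kernel_auto[OF \<phi>] gen_closed[OF i]] gen_closed[OF i] by (simp add: F.m_assoc)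
  ultimately have "detect i (\<phi> (free_gen i)) = (0, 0, 0) \<otimes>\<^bsub>heisenberg\<^esub> (1, 0, 0)"
    using d.hom_mult[of ?c "free_gen i"] gen_closed[OF i] detect_gen[OF i, of i] by simp
  then show ?thesis by (simp add: conj_exponent_def)
qed

lemma conj_exponent_chi:
  assumes "i \<in> I" "j \<in> I" "i \<noteq> j" "k \<in> I" "k \<noteq> n"
  shows "conj_exponent k (chi n i j) = (if k = i \<and> j = n then 1 else 0)"
proof (cases "k = i")
  case True
  have "chi n i j (free_gen i) = inv\<^bsub>Fn\<^esub> free_gen j \<otimes>\<^bsub>Fn\<^esub> free_gen i \<otimes>\<^bsub>Fn\<^esub> free_gen j"
    using elem_conj_gen[of i "(j, True)" i] assms by (simp add: chi_eq_elem_conj free_gen_def)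
  then show ?thesis
    using conj_exponent_eq[of i "free_gen j"] assms gen_closed True by (simp add: detect_gen)
next
  case False
  have "chi n i j (free_gen k) = inv\<^bsub>Fn\<^esub> \<one>\<^bsub>Fn\<^esub> \<otimes>\<^bsub>Fn\<^esub> free_gen k \<otimes>\<^bsub>Fn\<^esub> \<one>\<^bsub>Fn\<^esub>"
    using elem_conj_gen[of i "(j, True)" k] assms False gen_closed by (simp add: chi_eq_elem_conj)
  moreover have "detect k \<one>\<^bsub>Fn\<^esub> = (0, 0, 0)"
    using group_hom.hom_one[OF detect_group_hom] by simp
  ultimately show ?thesis
    using conj_exponent_eq[of k "\<one>\<^bsub>Fn\<^esub>"] assms False by simp
qed

text \<open>The formula for \<open>q\<close>. It makes sense on all of \<open>P\<close>, beyond the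
  domain of \<open>q\<close>, so conjugation by arbitrary elements of \<open>P\<close> leaves it
  unchanged in the abelian target.\<close>

definition total_exponent :: "(nat word \<Rightarrow> nat word) \<Rightarrow> (nat word \<Rightarrow> nat word) \<Rightarrow>\<^sub>0 int" where
  "total_exponent \<phi> = (\<Sum>i\<in>{1..<n}. frag_cmul (conj_exponent i \<phi>) (frag_of (chi n i n)))"

lemma total_exponent_hom: "total_exponent \<in> hom (PSigma n) (chi_lattice n)"
proof (rule homI)
  fix \<phi> \<psi> assume "\<phi> \<in> P" "\<psi> \<in> P"
  then show "total_exponent (\<phi> \<otimes>\<^bsub>PSigma n\<^esub> \<psi>) = total_exponent \<phi> \<otimes>\<^bsub>chi_lattice n\<^esub> total_exponent \<psi>"
    by (simp add: total_exponent_def chi_lattice_def conj_exponent_mult frag_cmul_distrib sum.distrib)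
next
  fix \<phi> assume "\<phi> \<in> P"
  show "total_exponent \<phi> \<in> carrier (chi_lattice n)"
    unfolding total_exponent_def chi_lattice_def
    by (rule sum_closed_free_Abelian_group) (auto simp: keys_cmul split: if_splits)
qed

lemma total_exponent_chi:
  assumes "i \<in> {1..<n}"
  shows "total_exponent (chi n i n) = frag_of (chi n i n)" "total_exponent (chi n n i) = 0"
proof -
  have "total_exponent (chi n i n) = (\<Sum>k\<in>{1..<n}. if k = i then frag_of (chi n i n) else 0)"
    unfolding total_exponent_def
    by (rule sum.cong) (use assms in \<open>auto simp: conj_exponent_chi\<close>)
  then show "total_exponent (chi n i n) = frag_of (chi n i n)" using assms by simp
  show "total_exponent (chi n n i) = 0"
    unfolding total_exponent_def
    by (rule sum.neutral) (use assms in \<open>auto simp: conj_exponent_chi\<close>)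
qed

lemma total_exponent_eq_0: "\<phi> \<in> lcs_kernel Fn 3 \<Longrightarrow> total_exponent \<phi> = 0"
  unfolding total_exponent_def by (rule sum.neutral) (auto simp: conj_exponent_eq_0)

end

section \<open>The kernel of the projection\<close>

locale p_map = free_group_of_rank +
  fixes p :: "(nat word \<Rightarrow> nat word) \<Rightarrow> nat word \<Rightarrow> nat word"
  assumes n: "2 \<le> n" and p: "is_p_map n p"
begin

sublocale M: free_group_of_rank "n - 1" .

abbreviation "K \<equiv> KK n p"

lemma p_group_hom: "group_hom (PSigma n) (PSigma (n - 1)) p"
  using p group_PSigma M.group_PSigma
  by (simp add: is_p_map_def epi_def group_hom_def group_hom_axioms_def)

sublocale p: group_hom "PSigma n" "PSigma (n - 1)" p by (rule p_group_hom)

lemma p_chi: "\<lbrakk>i \<in> I; j \<in> I; i \<noteq> j\<rbrakk> \<Longrightarrow>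
    p (chi n i j) = (if n \<in> {i, j} then \<one>\<^bsub>PSigma (n - 1)\<^esub> else chi (n - 1) i j)"
  using p by (simp add: is_p_map_def)

lemma K_iff: "\<phi> \<in> K \<longleftrightarrow> \<phi> \<in> P \<and> p \<phi> = \<one>\<^bsub>PSigma (n - 1)\<^esub>"
  by (auto simp: KK_def kernel_def)

lemma subgroup_K_PSigma: "subgroup K (PSigma n)"
  unfolding KK_def by (rule p.subgroup_kernel)

lemma subgroup_K: "subgroup K An"
  using A.incl_subgroup[OF subgroup_P, folded PSigma_eq] subgroup_K_PSigma .

definition last_chis :: "(nat word \<Rightarrow> nat word) set" where
  "last_chis = {chi n i n |i. i \<in> {1..<n}} \<union> {chi n n i |i. i \<in> {1..<n}}"

definition last_conjugates :: "(nat word \<Rightarrow> nat word) set" where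
  "last_conjugates = {g \<otimes>\<^bsub>PSigma n\<^esub> c \<otimes>\<^bsub>PSigma n\<^esub> inv\<^bsub>PSigma n\<^esub> g |g c. g \<in> P \<and> c \<in> last_chis}"

abbreviation "first_chis \<equiv> {chi n i j |i j. i \<in> {1..<n} \<and> j \<in> {1..<n} \<and> i \<noteq> j}"

lemma last_chis_P: "last_chis \<subseteq> P"
  using chi_P by (auto simp: last_chis_def)

lemma first_chis_P: "first_chis \<subseteq> P"
  using chi_P by auto

lemma last_chis_K: "last_chis \<subseteq> K"
  using last_chis_P p_chi by (auto simp: K_iff last_chis_def)

lemma last_conjugates_K: "last_conjugates \<subseteq> K"
  using last_chis_K normal.inv_op_closed2[OF p.normal_kernel] unfolding KK_def last_conjugates_def by blast

text \<open>Words in fewer letters are literally words in more letters, so an automorphism of the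
  larger free group can be compared with one of the smaller on the same elements.\<close>

lemma carrier_FX_mono: "w \<in> carrier (FX (n - 1)) \<Longrightarrow> w \<in> carrier Fn"
proof -
  have "{1..n - 1} \<subseteq> I" by auto
  then show "w \<in> carrier (FX (n - 1)) \<Longrightarrow> w \<in> carrier Fn"
    unfolding carrier_free_group by blast
qed

lemma chi_restrict:
  assumes "i \<in> {1..<n}" "j \<in> {1..<n}" "i \<noteq> j" "w \<in> carrier (FX (n - 1))"
  shows "chi n i j w = chi (n - 1) i j w"
proof (rule hom_free_group_eqI[OF F.is_group _ _ _ assms(4)])
  have ij: "i \<in> I" "j \<in> I" "i \<in> {1..n - 1}" "j \<in> {1..n - 1}" using assms by auto
  have h: "elem_conj n i (j, True) \<in> hom Fn Fn"
    "elem_conj (n - 1) i (j, True) \<in> hom (FX (n - 1)) (FX (n - 1))"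
    using elem_conj_hom[of i "(j, True)"] M.elem_conj_hom[of i "(j, True)"] ij by auto
  then show "chi n i j \<in> hom (FX (n - 1)) Fn" "chi (n - 1) i j \<in> hom (FX (n - 1)) Fn"
    using carrier_FX_mono by (auto simp: hom_def chi_eq_elem_conj mult_free_group Pi_iff)
  fix k assume k: "k \<in> {1..n - 1}"
  then have "k \<in> I" by auto
  then show "chi n i j (free_gen k) = chi (n - 1) i j (free_gen k)"
    using elem_conj_gen[of i "(j, True)" k] M.elem_conj_gen[of i "(j, True)" k] ij k
      letter_closed[of "(j, True)"] M.letter_closed[of "(j, True)"]
    by (simp add: chi_eq_elem_conj inv_free_group mult_free_group)
qed

text \<open>\<open>p\<close> is known only on generators, so the statement is propagated along
  products and inverses. For an inverse, surjectivity of \<open>p h\<close> on the smaller free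
  group provides \<open>v\<close> with \<open>p h v = w\<close>; then \<open>h v = w\<close> too,
  and both inverses send \<open>w\<close> to \<open>v\<close>.\<close>

lemma p_eq_restrict:
  assumes "h \<in> generate (PSigma n) first_chis"
  shows "h \<in> P \<and> h (free_gen n) = free_gen n \<and> (\<forall>w\<in>carrier (FX (n - 1)). p h w = h w)"
proof -
  have ninI: "n \<in> I" using n by auto
  have p_auto: "p h \<in> auto (FX (n - 1))" if "h \<in> P" for h
    using M.P_auto p.hom_closed that by blast
  have chi: "c \<in> P \<and> c (free_gen n) = free_gen n \<and> (\<forall>w\<in>carrier (FX (n - 1)). p c w = c w)"
    if c0: "c \<in> first_chis" for c
  proof -
    obtain i j where c: "c = chi n i j" "i \<in> {1..<n}" "j \<in> {1..<n}" "i \<noteq> j" using c0 by blast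
    have ij: "i \<in> I" "j \<in> I" using c by auto
    have "c (free_gen n) = free_gen n"
      using elem_conj_gen[of i "(j, True)" n] ij ninI c by (simp add: chi_eq_elem_conj)
    moreover have "p c = chi (n - 1) i j" using p_chi[OF ij c(4)] c by auto
    ultimately show ?thesis using chi_restrict[OF c(2,3,4)] chi_P[OF ij c(4)] c(1) by simp
  qed
  show ?thesis
    using assms
  proof (induction rule: generate.induct)
    case one
    have "\<one>\<^bsub>PSigma n\<^esub> w = w" if "w \<in> carrier Fn" for w
      using that by (simp add: one_AutoGroup)
    moreover have "\<one>\<^bsub>PSigma (n - 1)\<^esub> w = w" if "w \<in> carrier (FX (n - 1))" for w
      using that by (simp add: one_AutoGroup)
    ultimately show ?case
      using p.hom_one gen_closed[OF ninI] carrier_FX_mono p.G.one_closed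
      by (simp del: one_PSigma M.one_PSigma)
  next
    case (incl h)
    then show ?case by (rule chi)
  next
    case (inv h)
    have h: "h \<in> P" "h (free_gen n) = free_gen n" "\<And>w. w \<in> carrier (FX (n - 1)) \<Longrightarrow> p h w = h w"
      using chi[OF inv] by auto
    have ph: "p h \<in> carrier (PSigma (n - 1))" using p.hom_closed[OF h(1)] .
    have "(inv\<^bsub>PSigma n\<^esub> h) (free_gen n) = free_gen n"
      using F.inv_AutoGroup_apply(1)[OF P_auto[OF h(1)] gen_closed[OF ninI]] h by (simp add: inv_PSigma)
    moreover have "p (inv\<^bsub>PSigma n\<^esub> h) w = (inv\<^bsub>PSigma n\<^esub> h) w" if w: "w \<in> carrier (FX (n - 1))" for w
    proof -
      obtain v where v: "v \<in> carrier (FX (n - 1))" "p h v = w"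
        using auto_surj[OF p_auto[OF h(1)] w] .
      have "p (inv\<^bsub>PSigma n\<^esub> h) w = v"
        using M.F.inv_AutoGroup_apply(1)[OF p_auto[OF h(1)] v(1)] v(2) ph h(1)
        by (simp add: M.inv_PSigma)
      moreover have "(inv\<^bsub>PSigma n\<^esub> h) w = v"
        using F.inv_AutoGroup_apply(1)[OF P_auto[OF h(1)] carrier_FX_mono[OF v(1)]] h(3)[OF v(1)] v(2) h(1)
        by (simp add: inv_PSigma)
      ultimately show ?thesis by simp
    qed
    ultimately show ?case using p.G.inv_closed[OF h(1)] by blast
  next
    case (eng h1 h2)
    have "p (h1 \<otimes>\<^bsub>PSigma n\<^esub> h2) w = (h1 \<otimes>\<^bsub>PSigma n\<^esub> h2) w" if w: "w \<in> carrier (FX (n - 1))" for w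
    proof -
      have "p h2 w \<in> carrier (FX (n - 1))" using auto_closed[OF p_auto w] eng by blast
      then show ?thesis
        using eng w carrier_FX_mono[OF w] p_auto[of h1] p_auto[of h2] P_auto[of h1] P_auto[of h2]
        by (simp add: mult_AutoGroup_apply p.hom_mult[unfolded mult_PSigma M.mult_PSigma])
    qed
    moreover have "(h1 \<otimes>\<^bsub>PSigma n\<^esub> h2) (free_gen n) = free_gen n"
      using eng gen_closed[OF ninI] P_auto[of h1] P_auto[of h2] by (simp add: mult_AutoGroup_apply)
    ultimately show ?case using p.G.m_closed eng by blast
  qed
qed

text \<open>Such an \<open>h\<close> fixes x_n anyway and fixes the other generators because
  \<open>p h\<close> is its restriction.\<close>

lemma p_eq_one:
  assumes h: "h \<in> generate (PSigma n) first_chis" and "p h = \<one>\<^bsub>PSigma (n - 1)\<^esub>"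
  shows "h = \<one>\<^bsub>PSigma n\<^esub>"
proof -
  have "h (free_gen i) = \<one>\<^bsub>An\<^esub> (free_gen i)" if i: "i \<in> I" for i
  proof (cases "i = n")
    case True
    then show ?thesis using p_eq_restrict[OF h] gen_closed[OF i] by (simp add: one_AutoGroup)
  next
    case False
    then have "free_gen i \<in> carrier (FX (n - 1))" using i by (intro M.gen_closed) auto
    then show ?thesis
      using p_eq_restrict[OF h] assms(2) gen_closed[OF i] by (auto simp: one_AutoGroup)
  qed
  then show ?thesis
    using auto_gen_eqI[of h "\<one>\<^bsub>An\<^esub>"] p_eq_restrict[OF h] P_auto A.one_closed by simp
qed

lemma normal_last_conjugates: "generate (PSigma n) last_conjugates \<lhd> PSigma n"
proof (rule p.G.normal_generateI)
  show "last_conjugates \<subseteq> P" using last_conjugates_K by (auto simp: K_iff)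
  fix h g assume "h \<in> last_conjugates" and g: "g \<in> P"
  then obtain k c where kc: "h = k \<otimes>\<^bsub>PSigma n\<^esub> c \<otimes>\<^bsub>PSigma n\<^esub> inv\<^bsub>PSigma n\<^esub> k" "k \<in> P" "c \<in> last_chis"
    by (auto simp: last_conjugates_def simp del: mult_PSigma)
  then have "c \<in> P" using last_chis_P by blast
  then have "g \<otimes>\<^bsub>PSigma n\<^esub> h \<otimes>\<^bsub>PSigma n\<^esub> inv\<^bsub>PSigma n\<^esub> g =
      (g \<otimes>\<^bsub>PSigma n\<^esub> k) \<otimes>\<^bsub>PSigma n\<^esub> c \<otimes>\<^bsub>PSigma n\<^esub> inv\<^bsub>PSigma n\<^esub> (g \<otimes>\<^bsub>PSigma n\<^esub> k)"
    using kc g by (simp add: p.G.word_simps del: mult_PSigma)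
  moreover have "g \<otimes>\<^bsub>PSigma n\<^esub> k \<in> P" using g kc(2) by (rule p.G.m_closed)
  ultimately show "g \<otimes>\<^bsub>PSigma n\<^esub> h \<otimes>\<^bsub>PSigma n\<^esub> inv\<^bsub>PSigma n\<^esub> g \<in> last_conjugates"
    unfolding last_conjugates_def using kc(3) by blast
qed

text \<open>The normal subgroup \<open>?N\<close> and the subgroup \<open>?H\<close> contain all
  \<chi>'s between them, so every element of \<open>P\<close> is a product \<nu> h. As
  \<open>?N\<close> lies in the kernel, an element \<nu> h of the kernel has \<open>p h\<close>
  trivial, and \<open>p_eq_one\<close> removes \<open>h\<close>.\<close>

lemma K_subset_generate: "K \<subseteq> generate (PSigma n) last_conjugates"
proof
  let ?N = "generate (PSigma n) last_conjugates" and ?H = "generate (PSigma n) first_chis"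
  interpret N: normal ?N "PSigma n" by (rule normal_last_conjugates)
  have H: "subgroup ?H (PSigma n)" by (rule p.G.generate_is_subgroup[OF first_chis_P])
  interpret H: subgroup ?H "PSigma n" by (rule H)
  have last: "c \<in> ?N" if "c \<in> last_chis" for c
  proof -
    have "c = \<one>\<^bsub>PSigma n\<^esub> \<otimes>\<^bsub>PSigma n\<^esub> c \<otimes>\<^bsub>PSigma n\<^esub> inv\<^bsub>PSigma n\<^esub> \<one>\<^bsub>PSigma n\<^esub>"
      using that last_chis_P by (simp del: mult_PSigma one_PSigma add: subsetD)
    then have "c \<in> last_conjugates"
      unfolding last_conjugates_def using that p.G.one_closed by blast
    then show ?thesis by (rule generate.incl)
  qed
  have chi_cases: "c \<in> ?N \<or> c \<in> ?H" if c0: "c \<in> chis" for c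
  proof -
    obtain i j where c: "c = chi n i j" "i \<in> I" "j \<in> I" "i \<noteq> j" using c0 by blast
    consider "j = n" | "i = n" | "i \<noteq> n" "j \<noteq> n" by blast
    then show ?thesis
    proof cases
      case 1
      then have "c \<in> last_chis" using c by (auto simp: last_chis_def)
      then show ?thesis using last by blast
    next
      case 2
      then have "c \<in> last_chis" using c by (auto simp: last_chis_def)
      then show ?thesis using last by blast
    next
      case 3
      then have "i \<in> {1..<n}" "j \<in> {1..<n}" using c by auto
      then have "c \<in> first_chis" using c by blast
      then have "c \<in> ?H" by (rule generate.incl)
      then show ?thesis ..
    qed
  qed
  fix \<phi> assume \<phi>: "\<phi> \<in> K"
  have "generate An chis = generate (PSigma n) chis"
    using A.generate_consistent[OF chis_P subgroup_P, folded PSigma_eq] by simp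
  then have "\<phi> \<in> generate (PSigma n) chis"
    using \<phi> P_eq_generate by (auto simp: K_iff)
  then have "\<exists>\<nu>\<in>?N. \<exists>h\<in>?H. \<phi> = \<nu> \<otimes>\<^bsub>PSigma n\<^esub> h"
  proof (induction rule: generate.induct)
    case one
    have "\<one>\<^bsub>PSigma n\<^esub> = \<one>\<^bsub>PSigma n\<^esub> \<otimes>\<^bsub>PSigma n\<^esub> \<one>\<^bsub>PSigma n\<^esub>"
      by (simp del: mult_PSigma one_PSigma)
    then show ?case using N.one_closed H.one_closed by blast
  next
    case (incl c)
    then have "c \<in> P" using chis_P by blast
    then have "c = c \<otimes>\<^bsub>PSigma n\<^esub> \<one>\<^bsub>PSigma n\<^esub>" "c = \<one>\<^bsub>PSigma n\<^esub> \<otimes>\<^bsub>PSigma n\<^esub> c"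
      by (simp_all del: mult_PSigma one_PSigma)
    then show ?case using chi_cases[OF incl] N.one_closed H.one_closed by blast
  next
    case (inv c)
    then have "inv\<^bsub>PSigma n\<^esub> c \<in> P" using chis_P by (intro p.G.inv_closed) blast
    then have *: "inv\<^bsub>PSigma n\<^esub> c = inv\<^bsub>PSigma n\<^esub> c \<otimes>\<^bsub>PSigma n\<^esub> \<one>\<^bsub>PSigma n\<^esub>"
      "inv\<^bsub>PSigma n\<^esub> c = \<one>\<^bsub>PSigma n\<^esub> \<otimes>\<^bsub>PSigma n\<^esub> inv\<^bsub>PSigma n\<^esub> c"
      by (simp_all del: mult_PSigma one_PSigma)
    from chi_cases[OF inv] show ?case
    proof
      assume "c \<in> ?N"
      then have "inv\<^bsub>PSigma n\<^esub> c \<in> ?N" by (rule N.m_inv_closed)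
      with *(1) H.one_closed show ?thesis by (intro bexI)
    next
      assume "c \<in> ?H"
      then have "inv\<^bsub>PSigma n\<^esub> c \<in> ?H" by (rule H.m_inv_closed)
      with *(2) N.one_closed show ?thesis by (intro bexI)
    qed
  next
    case (eng x y)
    then obtain \<nu> h \<nu>' h' where *: "\<nu> \<in> ?N" "h \<in> ?H" "x = \<nu> \<otimes>\<^bsub>PSigma n\<^esub> h"
      "\<nu>' \<in> ?N" "h' \<in> ?H" "y = \<nu>' \<otimes>\<^bsub>PSigma n\<^esub> h'" by blast
    then have G: "\<nu> \<in> P" "h \<in> P" "\<nu>' \<in> P" "h' \<in> P" using N.mem_carrier H.mem_carrier by blast+
    \<comment> \<open>Moving \<nu>' to the left past \<open>h\<close> replaces it by a conjugate,
      which stays in the normal subgroup.\<close>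
    have "x \<otimes>\<^bsub>PSigma n\<^esub> y =
        (\<nu> \<otimes>\<^bsub>PSigma n\<^esub> (h \<otimes>\<^bsub>PSigma n\<^esub> \<nu>' \<otimes>\<^bsub>PSigma n\<^esub> inv\<^bsub>PSigma n\<^esub> h)) \<otimes>\<^bsub>PSigma n\<^esub> (h \<otimes>\<^bsub>PSigma n\<^esub> h')"
      using G by (simp add: * p.G.word_simps del: mult_PSigma)
    moreover have "\<nu> \<otimes>\<^bsub>PSigma n\<^esub> (h \<otimes>\<^bsub>PSigma n\<^esub> \<nu>' \<otimes>\<^bsub>PSigma n\<^esub> inv\<^bsub>PSigma n\<^esub> h) \<in> ?N"
      using N.m_closed[OF *(1) N.inv_op_closed2[OF G(2) *(4)]] .
    moreover have "h \<otimes>\<^bsub>PSigma n\<^esub> h' \<in> ?H" using H.m_closed * by blast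
    ultimately show ?case by blast
  qed
  then obtain \<nu> h where \<nu>h: "\<nu> \<in> ?N" "h \<in> ?H" "\<phi> = \<nu> \<otimes>\<^bsub>PSigma n\<^esub> h" by blast
  have "?N \<subseteq> K"
    using p.G.generate_subgroup_incl[OF last_conjugates_K subgroup_K_PSigma] .
  then have "p \<nu> = \<one>\<^bsub>PSigma (n - 1)\<^esub>" "\<nu> \<in> P" "h \<in> P"
    using \<nu>h H.mem_carrier by (auto simp: K_iff)
  then have "p h = \<one>\<^bsub>PSigma (n - 1)\<^esub>"
    using \<phi> \<nu>h p.hom_mult[of \<nu> h] p.hom_closed[of h] p.H.l_one[of "p h"] K_iff by metis
  then have "h = \<one>\<^bsub>PSigma n\<^esub>" using p_eq_one \<nu>h by blast
  then show "\<phi> \<in> ?N" using \<nu>h \<open>\<nu> \<in> P\<close> p.G.r_one[of \<nu>] by metis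
qed

end

section \<open>Identification of \<open>q\<close> with the exponent formula\<close>

locale pq_map = p_map +
  fixes q :: "(nat word \<Rightarrow> nat word) \<Rightarrow> ((nat word \<Rightarrow> nat word) \<Rightarrow>\<^sub>0 int)"
  assumes q: "is_q_map n p q"
begin

abbreviation "W \<equiv> WW n p q"

lemma q_hom: "q \<in> hom (PSigma n\<lparr>carrier := K\<rparr>) (chi_lattice n)"
  using q by (simp add: is_q_map_def)

lemma group_chi_lattice: "group (chi_lattice n)"
  by (simp add: chi_lattice_def)

sublocale q: group_hom "PSigma n\<lparr>carrier := K\<rparr>" "chi_lattice n" q
  using q_hom group_chi_lattice subgroup.subgroup_is_group[OF subgroup_K_PSigma group_PSigma]
  by (simp add: group_hom_def group_hom_axioms_def)

lemma q_mult: "\<lbrakk>x \<in> K; y \<in> K\<rbrakk> \<Longrightarrow> q (x \<otimes>\<^bsub>An\<^esub> y) = q x \<otimes>\<^bsub>chi_lattice n\<^esub> q y"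
  using q.hom_mult[of x y] by simp

lemma q_conj:
  assumes "g \<in> P" "i \<in> {1..<n}"
  shows "q (g \<otimes>\<^bsub>PSigma n\<^esub> chi n i n \<otimes>\<^bsub>PSigma n\<^esub> inv\<^bsub>PSigma n\<^esub> g) = frag_of (chi n i n)"
    "q (g \<otimes>\<^bsub>PSigma n\<^esub> chi n n i \<otimes>\<^bsub>PSigma n\<^esub> inv\<^bsub>PSigma n\<^esub> g) = 0"
  using q assms by (simp_all add: is_q_map_def chi_lattice_def del: mult_PSigma)

text \<open>Two homomorphisms into the lattice that agree on the generating conjugates: the
  conjugating element drops out of \<open>total_exponent\<close> by commutativity, and out of
  \<open>q\<close> by hypothesis.\<close>

theorem q_eq_total_exponent:
  assumes "\<phi> \<in> K"
  shows "q \<phi> = total_exponent \<phi>"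
proof -
  interpret e: group_hom "PSigma n" "chi_lattice n" total_exponent
    using total_exponent_hom group_PSigma group_chi_lattice by (simp add: group_hom_def group_hom_axioms_def)
  have gen: "x \<in> K \<and> q x = total_exponent x" if x: "x \<in> last_conjugates" for x
  proof -
    obtain g c where gc: "x = g \<otimes>\<^bsub>PSigma n\<^esub> c \<otimes>\<^bsub>PSigma n\<^esub> inv\<^bsub>PSigma n\<^esub> g" "g \<in> P" "c \<in> last_chis"
      using x unfolding last_conjugates_def by blast
    have c: "c \<in> P" using gc last_chis_P by blast
    \<comment> \<open>Inversion in a free abelian group is negation for elements supported on the
      basis; this lets the contributions of \<open>g\<close> and its inverse cancel.\<close>
    have "Poly_Mapping.keys (total_exponent g) \<subseteq> (\<lambda>i. chi n i n) ` {1..<n}"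
      using e.hom_closed[OF gc(2)] by (simp add: chi_lattice_def)
    then have "total_exponent x = total_exponent c"
      using gc c e.hom_mult[of "g \<otimes>\<^bsub>PSigma n\<^esub> c" "inv\<^bsub>PSigma n\<^esub> g"] e.hom_mult[of g c] e.hom_inv[of g]
        p.G.m_closed[of g c] p.G.inv_closed[of g]
      by (simp add: chi_lattice_def del: mult_PSigma)
    moreover have "q x = total_exponent c"
    proof -
      consider i where "c = chi n i n" "i \<in> {1..<n}" | i where "c = chi n n i" "i \<in> {1..<n}"
        using gc(3) by (auto simp: last_chis_def)
      then show ?thesis
        by cases (simp_all only: gc(1) q_conj[OF gc(2)] total_exponent_chi)
    qed
    ultimately show ?thesis using last_conjugates_K x by auto
  qed
  have inv_K: "inv\<^bsub>PSigma n\<lparr>carrier := K\<rparr>\<^esub> x = inv\<^bsub>PSigma n\<^esub> x" if "x \<in> K" for x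
    using p.G.m_inv_consistent[OF subgroup_K_PSigma that] .
  have KP: "x \<in> P" if "x \<in> K" for x using that by (simp add: K_iff)
  have "\<phi> \<in> generate (PSigma n) last_conjugates" using assms K_subset_generate by blast
  then have "\<phi> \<in> K \<and> q \<phi> = total_exponent \<phi>"
  proof (induction rule: generate.induct)
    case one
    then show ?case using q.hom_one e.hom_one subgroup.one_closed[OF subgroup_K_PSigma] by simp
  next
    case (incl x)
    then show ?case by (rule gen)
  next
    case (inv x)
    then show ?case
      using gen[OF inv] q.hom_inv[of x] e.hom_inv[of x] inv_K[of x] KP[of x]
        subgroup.m_inv_closed[OF subgroup_K_PSigma, of x] by simp
  next
    case (eng x y)
    then show ?case
      using q.hom_mult[of x y] e.hom_mult[of x y] KP[of x] KP[of y]
        subgroup.m_closed[OF subgroup_K_PSigma, of x y] by simp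
  qed
  then show ?thesis ..
qed

lemma W_iff: "\<phi> \<in> W \<longleftrightarrow> \<phi> \<in> K \<and> q \<phi> = 0"
  by (auto simp: WW_def kernel_def chi_lattice_def)

lemma subgroup_W: "subgroup W An"
proof -
  have "subgroup W (PSigma n\<lparr>carrier := K\<rparr>)" unfolding WW_def by (rule q.subgroup_kernel)
  then have "subgroup W (PSigma n)" using p.G.incl_subgroup[OF subgroup_K_PSigma] by blast
  then show ?thesis using A.incl_subgroup[OF subgroup_P, folded PSigma_eq] by blast
qed

text \<open>Term 3 of the lower central series corresponds to degree 2 of the filtration, so this
  puts the second Johnson step of \<open>K\<close> inside \<open>W\<close>; the comparison of the
  two filtrations rests on it.\<close>

lemma K_lcs_kernel_subset_W: "K \<inter> lcs_kernel Fn 3 \<subseteq> W"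
  using q_eq_total_exponent total_exponent_eq_0 by (auto simp: W_iff)

end

section \<open>The short exact sequence\<close>

text \<open>The isomorphism sends x to (\<pi> x, x s(\<pi> x)^-1), with inverse (z, y) to y s(z).
  \<open>L\<close> is described by carrier and multiplication, the data an isomorphism involves,
  because it will be a record of its own and not a restriction of \<open>M\<close>.\<close>

lemma iso_DirProd_of_split:
  fixes M :: "('a, 'b) monoid_scheme" and N :: "('c, 'd) monoid_scheme" and L :: "('a, 'e) monoid_scheme"
  assumes "comm_group M" "group N" "\<pi> \<in> hom M N" "s \<in> hom N M"
    and split: "\<And>z. z \<in> carrier N \<Longrightarrow> \<pi> (s z) = z"
    and L: "carrier L = kernel M N \<pi>" "monoid.mult L = monoid.mult M"
  shows "M \<cong> N \<times>\<times> L"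
proof -
  interpret M: comm_group M by fact
  interpret N: group N by fact
  interpret \<pi>: group_hom M N \<pi> using assms(3) by unfold_locales
  interpret s: group_hom N M s using assms(4) by unfold_locales
  define f where "f = (\<lambda>x. (\<pi> x, x \<otimes>\<^bsub>M\<^esub> inv\<^bsub>M\<^esub> s (\<pi> x)))"
  define g where "g = (\<lambda>(z, y). y \<otimes>\<^bsub>M\<^esub> s z)"
  have ker: "x \<otimes>\<^bsub>M\<^esub> inv\<^bsub>M\<^esub> s (\<pi> x) \<in> carrier L" if "x \<in> carrier M" for x
    using that split by (simp add: L kernel_def)
  have kerL: "y \<in> carrier M" "\<pi> y = \<one>\<^bsub>N\<^esub>" if "y \<in> carrier L" for y
    using that by (simp_all add: L kernel_def)
  have "f \<in> iso M (N \<times>\<times> L)"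
  proof (rule isoI)
    show "f \<in> hom M (N \<times>\<times> L)"
    proof (rule homI)
      fix x y assume xy: "x \<in> carrier M" "y \<in> carrier M"
      then show "f (x \<otimes>\<^bsub>M\<^esub> y) = f x \<otimes>\<^bsub>N \<times>\<times> L\<^esub> f y"
        by (simp add: f_def L M.inv_mult M.m_ac)
    qed (use ker in \<open>simp add: f_def\<close>)
    show "bij_betw f (carrier M) (carrier (N \<times>\<times> L))"
    proof (rule bij_betw_byWitness[where f' = g])
      show "\<forall>x\<in>carrier M. g (f x) = x" by (simp add: f_def g_def M.m_assoc)
      show "\<forall>x\<in>carrier (N \<times>\<times> L). f (g x) = x"
        using kerL split by (auto simp: f_def g_def M.m_assoc)
    qed (use ker kerL in \<open>auto simp: f_def g_def\<close>)
  qed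
  then show ?thesis by (auto simp: is_iso_def)
qed

lemma lie_ring_abelian_lie_deg1:
  assumes "comm_group A"
  shows "lie_ring (abelian_lie_deg1 A)"
proof -
  interpret A: comm_group A by fact
  have "comm_group (abelian_lie_deg1 A)"
    by (rule comm_groupI) (use A.l_inv_ex in \<open>auto simp: abelian_lie_deg1_def A.m_ac\<close>)
  then show ?thesis
    by (intro lie_ring.intro lie_ring_axioms.intro) (auto simp: abelian_lie_deg1_def)
qed

lemma carrier_johnson_quot:
  "carrier (johnson_quot n G m) = (\<lambda>x. johnson_filt n G (m + 1) #>\<^bsub>AutF n\<^esub> x) ` johnson_filt n G m"
  by (simp add: johnson_quot_def carrier_FactGroup)

lemma one_johnson_quot: "\<one>\<^bsub>johnson_quot n G m\<^esub> = johnson_filt n G (m + 1)"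
  by (simp add: johnson_quot_def)

lemma mult_johnson_quot: "monoid.mult (johnson_quot n G m) = set_mult (AutF n)"
  by (simp add: johnson_quot_def fun_eq_iff)

lemma carrier_gr_J:
  assumes "subgroup G (AutF n)"
  shows "carrier (gr_J n G) = {u \<in> \<Pi>\<^sub>E i\<in>{1..}. carrier (johnson_quot n G i).
    finite {i \<in> {1..}. u i \<noteq> \<one>\<^bsub>johnson_quot n G i\<^esub>}}"
  using graded_bracket.carrier_graded_sum[OF graded_bracket_johnson[OF assms]]
  by (simp only: gr_J_eq_graded_sum)

lemma mult_gr_J: "u \<otimes>\<^bsub>gr_J n G\<^esub> v = (\<lambda>i\<in>{1..}. u i \<otimes>\<^bsub>johnson_quot n G i\<^esub> v i)"
  by (simp add: gr_J_def Let_def)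

lemma bracket_gr_J: "bracket (gr_J n G) u v = (\<lambda>m\<in>{1..}. finprod (johnson_quot n G m)
    (\<lambda>k. johnson_coset_bracket n G k (m - k) (u k) (v (m - k))) {1..<m})"
  by (simp add: gr_J_def Let_def)

lemma grade_gr_J: "grade (gr_J n G) m = {u \<in> carrier (gr_J n G). \<forall>k\<in>{1..} - {m}. u k = \<one>\<^bsub>johnson_quot n G k\<^esub>}"
  by (simp add: gr_J_def Let_def)

lemma lie_ring_gr_J:
  assumes "subgroup G (AutF n)"
  shows "lie_ring (gr_J n G)"
  using graded_bracket.lie_ring_graded_sum[OF graded_bracket_johnson[OF assms]]
  by (simp only: gr_J_eq_graded_sum)

lemma comm_group_johnson_quot:
  assumes "subgroup G (AutF n)" "1 \<le> m"
  shows "comm_group (johnson_quot n G m)"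
  using graded_bracket.comm_Q[OF graded_bracket_johnson[OF assms(1)] assms(2)] .

lemma johnson_class_carrier:
  assumes G: "subgroup G (AutF n)" and m: "1 \<le> m" and x: "x \<in> johnson_filt n G m"
  shows "johnson_class n G m x \<in> carrier (gr_J n G)"
proof -
  have "\<one>\<^bsub>johnson_quot n G k\<^esub> \<in> carrier (johnson_quot n G k)" if "1 \<le> k" for k
    using comm_group_johnson_quot[OF G that] by (simp add: comm_group.axioms(2) group.is_monoid)
  moreover have "{i \<in> {1..}. johnson_class n G m x i \<noteq> \<one>\<^bsub>johnson_quot n G i\<^esub>} \<subseteq> {m}"
    by (auto simp: johnson_class_def)
  then have "finite {i \<in> {1..}. johnson_class n G m x i \<noteq> \<one>\<^bsub>johnson_quot n G i\<^esub>}"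
    by (rule finite_subset) simp
  ultimately show ?thesis
    using m x by (auto simp: carrier_gr_J[OF G] johnson_class_def carrier_johnson_quot)
qed

section \<open>Degree-by-degree comparison of the two Johnson algebras\<close>

context pq_map
begin

lemma johnson_filt_eq: "johnson_filt n G m = G \<inter> lcs_kernel Fn (m + 1)"
  by (simp only: johnson_filt_def J_Aut_eq_lcs_kernel)

lemma K_subset_P: "K \<subseteq> P" by (auto simp: K_iff)

lemma W_subset_K: "W \<subseteq> K" by (auto simp: W_iff)

lemma johnson_filt_1: "G \<subseteq> P \<Longrightarrow> johnson_filt n G 1 = G"
  using P_subset_lcs_kernel unfolding johnson_filt_eq one_add_one by blast

lemma johnson_filt_W:
  assumes "2 \<le> m"
  shows "johnson_filt n W m = johnson_filt n K m"
proof -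
  have "lcs_kernel Fn (m + 1) \<subseteq> lcs_kernel Fn 3"
    using assms by (intro F.lcs_kernel_antimono) simp
  then show ?thesis
    using K_lcs_kernel_subset_W W_subset_K unfolding johnson_filt_eq by blast
qed

lemma johnson_filt_W_Suc: "1 \<le> m \<Longrightarrow> johnson_filt n W (m + 1) = johnson_filt n K (m + 1)"
  by (rule johnson_filt_W) simp

lemma johnson_quot_W: "2 \<le> m \<Longrightarrow> johnson_quot n W m = johnson_quot n K m"
  using johnson_filt_W[of m] johnson_filt_W[of "m + 1"] by (simp add: johnson_quot_def)

lemma one_johnson_quot_W: "1 \<le> m \<Longrightarrow> \<one>\<^bsub>johnson_quot n W m\<^esub> = \<one>\<^bsub>johnson_quot n K m\<^esub>"
  unfolding one_johnson_quot by (rule johnson_filt_W_Suc)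

text \<open>Even in degree 1 both quotients consist of cosets of the same subgroup, the second step
  of \<open>K\<close>, so elements of one are literally elements of the other.\<close>

lemma carrier_johnson_quot_W: "1 \<le> m \<Longrightarrow> carrier (johnson_quot n W m) \<subseteq> carrier (johnson_quot n K m)"
  unfolding carrier_johnson_quot johnson_filt_W_Suc using W_subset_K
  by (auto simp: johnson_filt_def)

lemma johnson_coset_bracket_W:
  assumes "1 \<le> k + l"
  shows "johnson_coset_bracket n W k l = johnson_coset_bracket n K k l"
  unfolding johnson_coset_bracket_def johnson_filt_W_Suc[OF assms] ..

lemma bracket_gr_J_W: "bracket (gr_J n W) u v = bracket (gr_J n K) u v"
  unfolding bracket_gr_J
proof (rule restrict_ext)
  fix m :: nat assume m: "m \<in> {1..}"
  show "finprod (johnson_quot n W m) (\<lambda>k. johnson_coset_bracket n W k (m - k) (u k) (v (m - k))) {1..<m} =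
      finprod (johnson_quot n K m) (\<lambda>k. johnson_coset_bracket n K k (m - k) (u k) (v (m - k))) {1..<m}"
  \<comment> \<open>Only in degree 1 do the quotient groups differ, and there the product over
    \<open>{1..<1}\<close> is empty, so just the two neutral elements have to agree.\<close>
  proof (cases "m = 1")
    case True
    interpret W1: comm_group "johnson_quot n W 1" using comm_group_johnson_quot[OF subgroup_W] by simp
    interpret K1: comm_group "johnson_quot n K 1" using comm_group_johnson_quot[OF subgroup_K] by simp
    show ?thesis using one_johnson_quot_W[of 1] by (simp add: True)
  next
    case False
    then have "2 \<le> m" using m by auto
    moreover have "1 \<le> k + (m - k)" for k using m by auto
    ultimately show ?thesis by (simp only: johnson_quot_W johnson_coset_bracket_W)
  qed
qed

text \<open>Cosets multiply as sets inside the full automorphism group, whichever subgroup they come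
  from.\<close>

lemma mult_gr_J_W: "u \<otimes>\<^bsub>gr_J n W\<^esub> v = u \<otimes>\<^bsub>gr_J n K\<^esub> v"
  by (simp add: mult_gr_J mult_johnson_quot)

lemma carrier_gr_J_W:
  "u \<in> carrier (gr_J n W) \<longleftrightarrow> u \<in> carrier (gr_J n K) \<and> u 1 \<in> carrier (johnson_quot n W 1)"
proof -
  have fin: "{i \<in> {1..}. u i \<noteq> \<one>\<^bsub>johnson_quot n W i\<^esub>} = {i \<in> {1..}. u i \<noteq> \<one>\<^bsub>johnson_quot n K i\<^esub>}"
    using one_johnson_quot_W by auto
  have "(\<forall>i\<in>{1..}. u i \<in> carrier (johnson_quot n W i)) \<longleftrightarrow>
      (\<forall>i\<in>{1..}. u i \<in> carrier (johnson_quot n K i)) \<and> u 1 \<in> carrier (johnson_quot n W 1)"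
  proof (intro iffI conjI ballI)
    fix i :: nat
    assume *: "(\<forall>i\<in>{1..}. u i \<in> carrier (johnson_quot n K i)) \<and> u 1 \<in> carrier (johnson_quot n W 1)"
      and i: "i \<in> {1..}"
    show "u i \<in> carrier (johnson_quot n W i)"
      using * i johnson_quot_W[of i] by (cases "i = 1") auto
  qed (use carrier_johnson_quot_W in auto)
  then show ?thesis
    unfolding carrier_gr_J[OF subgroup_W] carrier_gr_J[OF subgroup_K] mem_Collect_eq fin PiE_iff by blast
qed

lemma grade_gr_J_W: "grade (gr_J n W) m \<subseteq> grade (gr_J n K) m"
  using one_johnson_quot_W by (auto simp: grade_gr_J carrier_gr_J_W)

lemma johnson_class_W: "1 \<le> m \<Longrightarrow> johnson_class n W m x = johnson_class n K m x"
  unfolding johnson_class_def using johnson_filt_W_Suc one_johnson_quot_W by (intro restrict_ext) auto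

text \<open>The choice of representative is immaterial, as \<open>q\<close> vanishes on the second filtration step.\<close>

definition pr :: "(nat \<Rightarrow> (nat word \<Rightarrow> nat word) set) \<Rightarrow> (nat word \<Rightarrow> nat word) \<Rightarrow>\<^sub>0 int" where
  "pr u = q (SOME x. x \<in> u 1)"

lemma pr_eq:
  assumes x: "x \<in> K" and u: "u 1 = johnson_filt n K 2 #>\<^bsub>An\<^esub> x"
  shows "pr u = q x"
proof -
  have An: "x \<in> carrier An" using subgroup.mem_carrier[OF subgroup_K x] .
  have "subgroup (johnson_filt n K 2) An"
    using central_series.subgroup_F[OF central_series_johnson[OF subgroup_K]] by simp
  then have "x \<in> u 1" using A.rcos_self[OF An] u by simp
  then have "(SOME x. x \<in> u 1) \<in> u 1" by (rule someI[of "\<lambda>x. x \<in> u 1"])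
  then obtain a where a: "a \<in> johnson_filt n K 2" "(SOME x. x \<in> u 1) = a \<otimes>\<^bsub>An\<^esub> x"
    by (auto simp: u r_coset_def)
  have "a \<in> W" using a(1) johnson_filt_W[of 2] by (auto simp: johnson_filt_def)
  then have "a \<in> K" "q a = 0" by (auto simp: W_iff)
  then show ?thesis using q_mult[OF _ x, of a] a by (simp add: pr_def chi_lattice_def)
qed

lemma gr_J_degree_1:
  assumes "u \<in> carrier (gr_J n K)"
  obtains x where "x \<in> K" "u 1 = johnson_filt n K 2 #>\<^bsub>An\<^esub> x"
proof -
  have "u 1 \<in> carrier (johnson_quot n K 1)"
    using assms unfolding carrier_gr_J[OF subgroup_K] by auto
  then show thesis
    using that unfolding carrier_johnson_quot johnson_filt_1[OF K_subset_P] one_add_one by blast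
qed

lemma comm_group_gr_J_K: "comm_group (gr_J n K)"
  using lie_ring_gr_J[OF subgroup_K] by (simp add: lie_ring_def)

lemma comm_group_chi_lattice: "comm_group (chi_lattice n)"
  by (simp add: chi_lattice_def abelian_free_Abelian_group)

lemma q_closed: "x \<in> K \<Longrightarrow> q x \<in> carrier (chi_lattice n)"
  using q.hom_closed[of x] by simp

lemma pr_hom: "pr \<in> hom (gr_J n K) (chi_lattice n)"
proof (rule homI)
  fix u assume "u \<in> carrier (gr_J n K)"
  then obtain x where "x \<in> K" "u 1 = johnson_filt n K 2 #>\<^bsub>An\<^esub> x" by (rule gr_J_degree_1)
  then show "pr u \<in> carrier (chi_lattice n)" using pr_eq[of x u] q_closed by simp
next
  fix u v assume "u \<in> carrier (gr_J n K)" "v \<in> carrier (gr_J n K)"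
  then obtain x y where x: "x \<in> K" "u 1 = johnson_filt n K 2 #>\<^bsub>An\<^esub> x"
    and y: "y \<in> K" "v 1 = johnson_filt n K 2 #>\<^bsub>An\<^esub> y"
    by (metis gr_J_degree_1)
  interpret C: central_series An "johnson_filt n K" by (rule central_series_johnson[OF subgroup_K])
  have xy: "x \<otimes>\<^bsub>An\<^esub> y \<in> K" using subgroup.m_closed[OF subgroup_K] x y by blast
  have "C.layer = johnson_quot n K" by (intro ext) (simp only: C.layer_def johnson_quot_def)
  then have "(u \<otimes>\<^bsub>gr_J n K\<^esub> v) 1 = johnson_filt n K 2 #>\<^bsub>An\<^esub> (x \<otimes>\<^bsub>An\<^esub> y)"
    using C.cls_mult[of 1 x y] x y johnson_filt_1[OF K_subset_P]
    by (simp add: mult_gr_J)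
  then show "pr (u \<otimes>\<^bsub>gr_J n K\<^esub> v) = pr u \<otimes>\<^bsub>chi_lattice n\<^esub> pr v"
    using pr_eq[OF xy, of "u \<otimes>\<^bsub>gr_J n K\<^esub> v"] pr_eq[OF x(1), of u] x(2) pr_eq[OF y(1), of v] y(2) q_mult[OF x(1) y(1)] by simp
qed

lemma pr_eq_0:
  assumes "u \<in> carrier (gr_J n K)" "u 1 = \<one>\<^bsub>johnson_quot n K 1\<^esub>"
  shows "pr u = 0"
proof -
  have "\<one>\<^bsub>An\<^esub> \<in> K" using subgroup.one_closed[OF subgroup_K] .
  moreover have "johnson_filt n K 2 \<subseteq> carrier An"
    using subgroup.subset[OF subgroup_K] by (auto simp: johnson_filt_def)
  then have "u 1 = johnson_filt n K 2 #>\<^bsub>An\<^esub> \<one>\<^bsub>An\<^esub>"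
    using assms(2) A.coset_mult_one unfolding one_johnson_quot one_add_one by simp
  ultimately show ?thesis using pr_eq q.hom_one by (simp add: chi_lattice_def)
qed

lemma carrier_johnson_quot_W_1:
  "carrier (johnson_quot n W 1) = (\<lambda>x. johnson_filt n K 2 #>\<^bsub>An\<^esub> x) ` W"
  using johnson_filt_W[of 2] johnson_filt_1[OF order_trans[OF W_subset_K K_subset_P]]
  by (simp only: carrier_johnson_quot one_add_one)

text \<open>If x represents the degree 1 component, \<open>pr\<close> returns \<open>q x\<close>,
  which vanishes exactly when x lies in \<open>W\<close>. In higher degrees the two algebras agree,
  so no further condition arises.\<close>

lemma kernel_pr: "kernel (gr_J n K) (chi_lattice n) pr = carrier (gr_J n W)"
proof (intro equalityI subsetI)
  fix u assume "u \<in> kernel (gr_J n K) (chi_lattice n) pr"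
  then have u: "u \<in> carrier (gr_J n K)" "pr u = 0" by (auto simp: kernel_def chi_lattice_def)
  obtain x where x: "x \<in> K" "u 1 = johnson_filt n K 2 #>\<^bsub>An\<^esub> x" using gr_J_degree_1[OF u(1)] .
  then have "x \<in> W" using pr_eq[OF x(1), of u] x(2) u by (simp add: W_iff)
  then have "u 1 \<in> carrier (johnson_quot n W 1)"
    unfolding carrier_johnson_quot_W_1 x(2) by (rule imageI)
  then show "u \<in> carrier (gr_J n W)" using u carrier_gr_J_W by blast
next
  fix u assume "u \<in> carrier (gr_J n W)"
  then have u: "u \<in> carrier (gr_J n K)" "u 1 \<in> carrier (johnson_quot n W 1)"
    using carrier_gr_J_W by auto
  then obtain x where "x \<in> W" "u 1 = johnson_filt n K 2 #>\<^bsub>An\<^esub> x"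
    unfolding carrier_johnson_quot_W_1 by blast
  then have "pr u = 0" using pr_eq[of x u] by (simp add: W_iff)
  then show "u \<in> kernel (gr_J n K) (chi_lattice n) pr"
    using u by (simp add: kernel_def chi_lattice_def)
qed

lemma pr_class: "x \<in> K \<Longrightarrow> pr (johnson_class n K 1 x) = q x"
  by (rule pr_eq) (simp_all add: johnson_class_def)

lemma chi_K: "i \<in> {1..<n} \<Longrightarrow> chi n i n \<in> K"
  using last_chis_K by (auto simp: last_chis_def)

lemma q_chi:
  assumes "i \<in> {1..<n}"
  shows "q (chi n i n) = frag_of (chi n i n)"
  using q_eq_total_exponent[OF chi_K[OF assms]] total_exponent_chi(1)[OF assms] by simp

text \<open>Freeness of the lattice allows each basis element \<open>chi n i n\<close> to be sent to
  its own class in degree 1, where \<open>pr\<close> returns \<open>q (chi n i n)\<close>, the basis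
  element again.\<close>

lemma pr_section:
  obtains s where "s \<in> hom (chi_lattice n) (gr_J n K)" "\<forall>z\<in>carrier (chi_lattice n). pr (s z) = z"
proof -
  let ?X = "(\<lambda>i. chi n i n) ` {1..<n}"
  have "johnson_class n K 1 ` ?X \<subseteq> carrier (gr_J n K)"
    using johnson_class_carrier[OF subgroup_K, of 1] chi_K johnson_filt_1[OF K_subset_P] by auto
  then obtain s where s: "s \<in> hom (chi_lattice n) (gr_J n K)"
    "\<And>x. x \<in> ?X \<Longrightarrow> s (frag_of x) = johnson_class n K 1 x"
    using comm_group.free_Abelian_group_universal[OF comm_group_gr_J_K] unfolding chi_lattice_def by blast
  have "pr \<circ> s \<in> hom (chi_lattice n) (chi_lattice n)"
    using s(1) pr_hom by (rule hom_compose)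
  then interpret h: group_hom "chi_lattice n" "chi_lattice n" "pr \<circ> s"
    using group_chi_lattice by (simp add: group_hom_def group_hom_axioms_def)
  have "(pr \<circ> s) z = z" if "z \<in> carrier (chi_lattice n)" for z
  proof -
    have "Poly_Mapping.keys z \<subseteq> ?X" using that by (simp add: chi_lattice_def)
    then show ?thesis
    proof (induction rule: free_Abelian_group_induct[consumes 1])
      case 1
      then show ?case using h.hom_one by (simp add: chi_lattice_def)
    next
      case (2 x y)
      then have xy: "x \<in> carrier (chi_lattice n)" "y \<in> carrier (chi_lattice n)"
        by (simp_all add: chi_lattice_def)
      have inv: "inv\<^bsub>chi_lattice n\<^esub> y = - y" using 2 by (simp add: chi_lattice_def)
      have "(pr \<circ> s) (x \<otimes>\<^bsub>chi_lattice n\<^esub> inv\<^bsub>chi_lattice n\<^esub> y) = x \<otimes>\<^bsub>chi_lattice n\<^esub> inv\<^bsub>chi_lattice n\<^esub> y"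
        using h.hom_mult[OF xy(1) group.inv_closed[OF group_chi_lattice xy(2)]] h.hom_inv[OF xy(2)] 2 by simp
      then show ?case by (simp add: inv) (simp add: chi_lattice_def)
    next
      case (3 a)
      then show ?case using s(2)[OF 3] pr_class[OF chi_K] q_chi by auto
    qed
  qed
  then show thesis using that s(1) by simp
qed

text \<open>Degrees start at 1, so brackets start in degree 2 and the defining product here is
  empty. Hence \<open>pr\<close> kills brackets, matching the zero bracket of the lattice.\<close>

lemma bracket_degree_1:
  "bracket (gr_J n K) u v 1 = \<one>\<^bsub>johnson_quot n K 1\<^esub>"
proof -
  interpret K1: comm_group "johnson_quot n K 1" using comm_group_johnson_quot[OF subgroup_K] by simp
  show ?thesis by (simp add: bracket_gr_J)
qed

lemma pr_graded_lie_hom: "pr \<in> graded_lie_hom (gr_J n K) (abelian_lie_deg1 (chi_lattice n))"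
proof -
  have "pr (bracket (gr_J n K) u v) = 0" if "u \<in> carrier (gr_J n K)" "v \<in> carrier (gr_J n K)" for u v
    using pr_eq_0 bracket_degree_1 lie_ring.bracket_closed[OF lie_ring_gr_J[OF subgroup_K] that] by blast
  moreover have "pr \<in> hom (gr_J n K) (abelian_lie_deg1 (chi_lattice n))"
    using pr_hom by (simp add: hom_def abelian_lie_deg1_def)
  moreover have "pr ` grade (gr_J n K) m \<subseteq> grade (abelian_lie_deg1 (chi_lattice n)) m" for m
  proof (cases "m = 1")
    case True
    then show ?thesis
      using pr_hom by (auto simp: grade_gr_J abelian_lie_deg1_def hom_def)
  next
    case False
    then have "pr u = 0" if "u \<in> grade (gr_J n K) m" for u
      using that by (intro pr_eq_0) (auto simp: grade_gr_J)
    then show ?thesis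
      using False by (auto simp: abelian_lie_deg1_def chi_lattice_def)
  qed
  ultimately show ?thesis
    by (auto simp: graded_lie_hom_def abelian_lie_deg1_def chi_lattice_def)
qed

lemma lie_short_exact_gr_J:
  "lie_short_exact (gr_J n W) (gr_J n K) (abelian_lie_deg1 (chi_lattice n)) id pr"
proof -
  obtain s where s: "s \<in> hom (chi_lattice n) (gr_J n K)" "\<forall>z\<in>carrier (chi_lattice n). pr (s z) = z"
    by (rule pr_section)
  have "id \<in> graded_lie_hom (gr_J n W) (gr_J n K)"
    using grade_gr_J_W by (auto simp: graded_lie_hom_def hom_def carrier_gr_J_W mult_gr_J_W bracket_gr_J_W)
  moreover from this have "id \<in> mon (gr_J n W) (gr_J n K)"
    by (auto simp: mon_def graded_lie_hom_def)
  moreover have "kernel (gr_J n K) (abelian_lie_deg1 (chi_lattice n)) pr = carrier (gr_J n W)"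
    using kernel_pr by (simp add: kernel_def abelian_lie_deg1_def)
  \<comment> \<open>Surjectivity of \<open>pr\<close> is read off from the section.\<close>
  moreover have "carrier (chi_lattice n) \<subseteq> pr ` carrier (gr_J n K)"
  proof
    fix z assume z: "z \<in> carrier (chi_lattice n)"
    then have "s z \<in> carrier (gr_J n K)" using s(1) by (auto simp: hom_def)
    then show "z \<in> pr ` carrier (gr_J n K)" using s(2) z by (metis image_eqI)
  qed
  then have "pr \<in> epi (gr_J n K) (abelian_lie_deg1 (chi_lattice n))"
    using pr_hom by (auto simp: epi_def hom_def abelian_lie_deg1_def)
  ultimately show ?thesis
    using lie_ring_gr_J[OF subgroup_W] lie_ring_gr_J[OF subgroup_K] pr_graded_lie_hom
      lie_ring_abelian_lie_deg1[OF comm_group_chi_lattice]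
    by (simp add: lie_short_exact_def)
qed

end

theorem theorem7p3:
  fixes n :: nat
    and p :: "(nat word \<Rightarrow> nat word) \<Rightarrow> (nat word \<Rightarrow> nat word)"
    and q :: "(nat word \<Rightarrow> nat word) \<Rightarrow> ((nat word \<Rightarrow> nat word) \<Rightarrow>\<^sub>0 int)"
  assumes "2 \<le> n"
    and "is_p_map n p"
    and "is_q_map n p q"
  shows "(\<exists>\<iota> \<pi>.
            lie_short_exact (gr_J n (WW n p q)) (gr_J n (KK n p))
              (abelian_lie_deg1 (chi_lattice n)) \<iota> \<pi> \<and>
            (\<forall>m\<ge>1. \<forall>x\<in>johnson_filt n (WW n p q) m.
               \<iota> (johnson_class n (WW n p q) m x) = johnson_class n (KK n p) m x) \<and>
            (\<forall>x\<in>KK n p. \<pi> (johnson_class n (KK n p) 1 x) = q x) \<and>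
            (\<exists>s\<in>hom (chi_lattice n) (gr_J n (KK n p)).
               \<forall>z\<in>carrier (chi_lattice n). \<pi> (s z) = z)) \<and>
         gr_J n (KK n p) \<cong> chi_lattice n \<times>\<times> gr_J n (WW n p q)"
proof -
  interpret pq_map n p q
    using assms by (simp add: pq_map_def p_map_def pq_map_axioms_def)
  obtain s where s: "s \<in> hom (chi_lattice n) (gr_J n K)" "\<forall>z\<in>carrier (chi_lattice n). pr (s z) = z"
    by (rule pr_section)
  have "gr_J n K \<cong> chi_lattice n \<times>\<times> gr_J n W"
  proof (rule iso_DirProd_of_split[OF comm_group_gr_J_K group_chi_lattice pr_hom s(1)])
    show "pr (s z) = z" if "z \<in> carrier (chi_lattice n)" for z using s(2) that by blast
    show "carrier (gr_J n W) = kernel (gr_J n K) (chi_lattice n) pr" by (simp add: kernel_pr)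
    show "monoid.mult (gr_J n W) = monoid.mult (gr_J n K)" by (intro ext mult_gr_J_W)
  qed
  moreover have "id (johnson_class n W m x) = johnson_class n K m x" if "1 \<le> m" for m x
    using johnson_class_W[OF that] by simp
  ultimately show ?thesis
    using lie_short_exact_gr_J pr_class s
    by (intro conjI exI[of _ id] exI[of _ pr] bexI[of _ s]) auto
qed

end
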